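(* Let $\hbar\in\mathbb{R}_{>0}\setminus\mathbb{Q}$, let $\Gamma$ be a $\mathcal{D}$-seed of rank $n$, let $k\in\{1,\dots,n\}$, and let $\Gamma'=\mu_k(\Gamma)$, so that $\Gamma=\mu_k(\Gamma')$. Let $c_{A_1}\in\mathrm{U}(1)\subset\mathbb{C}^\times$ be the constant such that $$\mathbf{K}^\hbar_{\Gamma\stackrel{k}{\to}\Gamma'}\;\mathbf{K}^\hbar_{\Gamma'\stackrel{k}{\to}\Gamma}=c_{A_1}\cdot\mathrm{id}_{\mathscr{H}_\Gamma}$$ (such a constant exists by a theorem of Fock and Goncharov). Then $c_{A_1}=1$; that is, $\mathbf{K}^\hbar_{\Gamma\stackrel{k}{\to}\Gamma'}\,\mathbf{K}^\hbar_{\Gamma'\stackrel{k}{\to}\Gamma}=\mathrm{id}_{\mathscr{H}_\Gamma}$.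
   Context: **Seeds and mutations.** Fix $n\ge1$; $[a]_+=\max(a,0)$. A $\mathcal{D}$-seed $\Gamma$ has an exchange matrix $\varepsilon=(\varepsilon_{ij})\in\mathbb{Z}^{n\times n}$ and a skew-symmetrizer $d=(d_1,\dots,d_n)$ of positive integers such that $\varepsilon_{ij}d_j^{-1}=-\varepsilon_{ji}d_i^{-1}$ for all $i,j$. (It also carries $2n$ formal cluster variables $B_i,X_i$, which play no role in the operators below; all operators depend only on $(\varepsilon,d)$.) The mutated seed $\Gamma'=\mu_k(\Gamma)$ has data $(\varepsilon',d')$ with $d'=d$, $\varepsilon'_{ij}=-\varepsilon_{ij}$ if $i=k$ or $j=k$, and $\varepsilon'_{ij}=\varepsilon_{ij}+\frac12(|\varepsilon_{ik}|\varepsilon_{kj}+\varepsilon_{ik}|\varepsilon_{kj}|)$ otherwise. One has $\mu_k(\mu_k(\Gamma))=\Gamma$. **Hilbert space and operators.** $\hbar_k:=\hbar/d_k$. To each seed is attached $\mathscr{H}_\Gamma=L^2(\mathbb{R}^n,da_1\cdots da_n)$ and the dense subspace $D_\Gamma$ spanned by the functions $e^{-\sum_i(\alpha_ia_i^2+\beta_ia_i)}P(a_1,\dots,a_n)$ with $\alpha_i,\beta_i\in\mathbb{C}$, $\mathrm{Re}(\alpha_i)>0$, $P$ a complex polynomial. On $D_\Gamma$ put $\widehat{\mathbf q}_i^\hbar=a_i$ (multiplication), $\widehat{\mathbf p}_i^\hbar=2\pi\sqrt{-1}\,\hbar\,\frac{\partial}{\partial a_i}$, and $$\widehat{\mathbf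 x}^\hbar_{\Gamma;i}=\tfrac12d_i^{-1}\widehat{\mathbf p}_i^\hbar-\sum_{j}\varepsilon_{ij}\widehat{\mathbf q}_j^\hbar,\qquad \widehat{\widetilde{\mathbf x}}{}^\hbar_{\Gamma;i}=\tfrac12d_i^{-1}\widehat{\mathbf p}_i^\hbar+\sum_{j}\varepsilon_{ij}\widehat{\mathbf q}_j^\hbar .$$ These are essentially self-adjoint on $D_\Gamma$; the same symbols denote the unique self-adjoint extensions inside functional calculus. **Quantum dilogarithm.** For real $h>0$ and real $z$, $$\Phi^h(z)=\exp\left(-\frac14\int_\Omega\frac{e^{-\sqrt{-1}\,pz}}{\sinh(\pi p)\sinh(\pi hp)}\frac{dp}{p}\right),$$ where $\Omega$ is the real line (oriented left to right) avoiding the origin by a small half circle above it. One has $|\Phi^h(z)|=1$ for real $z$. **Intertwiner.** For $\Gamma'=\mu_k(\Gamma)$, $\mathbf{K}^\hbar_{\Gamma\stackrel{k}{\to}\Gamma'}:\mathscr{H}_{\Gamma'}\to\mathscr{H}_\Gamma$ is the unitary map $$\mathbf{K}^\hbar_{\Gamma\stackrel{k}{\to}\Gamma'}=\Phi^{\hbar_k}(\widehat{\mathbf x}^\hbar_{\Gamma;k})\,\bigl(\Phi^{\hbar_k}(\widehat{\widetilde{\mathbf x}}{}^\hbar_{\Gamma;k})\bigr)^{-1}\circ\mathbf{K}'_{\Gamma\stackrel{k}{\to}\Gamma'},$$ where the first two factors are defined by functional calculus and $(\mathbf{K}'_{\Gamma\stackrel{k}{\to}\Gamma'}f)(a_1,\dots,a_n)=f(a_1',\dots,a_n')$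 with $a'_i=a_i$ for $i\ne k$ and $a'_k=-a_k+\sum_{j=1}^n[-\varepsilon_{kj}]_+a_j$. *)

theory Defs
  imports "HOL-Complex_Analysis.Contour_Integration"
begin

section \<open>Seeds\<close>

text \<open>
  The rank is the cardinality of the index type. The formal cluster variables are omitted: the
  Hilbert space and the operators depend on the exchange matrix and the skew-symmetrizer only.
\<close>

record 'n seed =
  exch :: "'n \<Rightarrow> 'n \<Rightarrow> int"
  symm :: "'n \<Rightarrow> nat"

definition D_seed :: "'n seed \<Rightarrow> bool" where
  "D_seed \<Gamma> \<longleftrightarrow> (\<forall>i. symm \<Gamma> i > 0) \<and>
     (\<forall>i j. real_of_int (exch \<Gamma> i j) * inverse (real (symm \<Gamma> j)) =
            - real_of_int (exch \<Gamma> j i) * inverse (real (symm \<Gamma> i)))"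

text \<open>The numerator below is always even, so the integer division is exact.\<close>

definition mutate :: "'n \<Rightarrow> 'n seed \<Rightarrow> 'n seed" where
  "mutate k \<Gamma> = \<lparr>
     exch = (\<lambda>i j. if i = k \<or> j = k then - exch \<Gamma> i j
       else exch \<Gamma> i j +
         (\<bar>exch \<Gamma> i k\<bar> * exch \<Gamma> k j + exch \<Gamma> i k * \<bar>exch \<Gamma> k j\<bar>) div 2),
     symm = symm \<Gamma>\<rparr>"

lemma mutate_numerator_even: "even (\<bar>x\<bar> * y + x * \<bar>y\<bar>)" for x y :: int
  by simp

lemma mutate_mutate: "mutate k (mutate k \<Gamma>) = (\<Gamma> :: 'n seed)"
proof -
  have neg: "(- N) div 2 = - (N div 2)" if "even N" for N :: int
    using that by presburger
  have minus: "(- (\<bar>x\<bar> * y) - x * \<bar>y\<bar>) div 2 = - ((\<bar>x\<bar> * y + x * \<bar>y\<bar>) div 2)" for x y :: int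
    using neg[OF mutate_numerator_even[of x y]] by simp
  show ?thesis
    by (cases \<Gamma>) (simp add: mutate_def fun_eq_iff minus)
qed


section \<open>The Hilbert space of square-integrable functions\<close>

definition sq_integrable :: "(real^'n \<Rightarrow> complex) \<Rightarrow> bool" where
  "sq_integrable f \<longleftrightarrow> f \<in> borel_measurable lborel \<and> integrable lborel (\<lambda>a. (cmod (f a))\<^sup>2)"

definition l2_rel :: "(real^'n \<Rightarrow> complex) \<Rightarrow> (real^'n \<Rightarrow> complex) \<Rightarrow> bool" where
  "l2_rel f g \<longleftrightarrow> sq_integrable f \<and> sq_integrable g \<and> (AE a in lborel. f a = g a)"

lemma sq_integrable_zero: "sq_integrable (\<lambda>a. 0)"
  by (simp add: sq_integrable_def)

lemma sq_integrable_scale: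
  assumes "sq_integrable f" shows "sq_integrable (\<lambda>a. c * f a)"
  using assms by (auto simp: sq_integrable_def norm_mult power_mult_distrib)

lemma sq_integrable_add:
  assumes "sq_integrable f" "sq_integrable g" shows "sq_integrable (\<lambda>a. f a + g a)"
proof -
  have m [measurable]: "f \<in> borel_measurable lborel" "g \<in> borel_measurable lborel"
    using assms by (auto simp: sq_integrable_def)
  have "integrable lborel (\<lambda>a. 2 * (cmod (f a))\<^sup>2 + 2 * (cmod (g a))\<^sup>2)"
    using assms by (auto simp: sq_integrable_def)
  moreover have "(cmod (f a + g a))\<^sup>2 \<le> 2 * (cmod (f a))\<^sup>2 + 2 * (cmod (g a))\<^sup>2" for a
  proof -
    have "(cmod (f a + g a))\<^sup>2 \<le> (cmod (f a) + cmod (g a))\<^sup>2"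
      by (intro power_mono norm_triangle_ineq norm_ge_zero)
    also have "\<dots> \<le> 2 * (cmod (f a))\<^sup>2 + 2 * (cmod (g a))\<^sup>2"
      using zero_le_power2[of "cmod (f a) - cmod (g a)"]
      by (simp add: power2_sum power2_diff)
    finally show ?thesis .
  qed
  ultimately have "integrable lborel (\<lambda>a. (cmod (f a + g a))\<^sup>2)"
    by (intro Bochner_Integration.integrable_bound[where g = "\<lambda>a. (cmod (f a + g a))\<^sup>2"
          and f = "\<lambda>a. 2 * (cmod (f a))\<^sup>2 + 2 * (cmod (g a))\<^sup>2"]) (auto intro!: AE_I2)
  then show ?thesis by (simp add: sq_integrable_def)
qed

quotient_type 'n l2 = "real^'n \<Rightarrow> complex" / partial: l2_rel
proof (rule part_equivpI)
  show "\<exists>f :: real^'n \<Rightarrow> complex. l2_rel f f"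
    by (rule exI[of _ "\<lambda>a. 0"]) (simp add: l2_rel_def sq_integrable_zero)
  show "symp (l2_rel :: (real^'n \<Rightarrow> complex) \<Rightarrow> _)"
    by (rule sympI) (auto simp: l2_rel_def)
  show "transp (l2_rel :: (real^'n \<Rightarrow> complex) \<Rightarrow> _)"
    by (rule transpI) (auto simp: l2_rel_def elim: AE_mp)
qed

instantiation l2 :: (finite) ab_group_add
begin

lift_definition zero_l2 :: "'a l2" is "\<lambda>a. 0"
  by (simp add: l2_rel_def sq_integrable_zero)

lift_definition plus_l2 :: "'a l2 \<Rightarrow> 'a l2 \<Rightarrow> 'a l2" is "\<lambda>f g a. f a + g a"
  by (auto simp: l2_rel_def intro!: sq_integrable_add)

lift_definition uminus_l2 :: "'a l2 \<Rightarrow> 'a l2" is "\<lambda>f a. - f a"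
  by (auto simp: l2_rel_def sq_integrable_def)

definition minus_l2 :: "'a l2 \<Rightarrow> 'a l2 \<Rightarrow> 'a l2" where
  "minus_l2 f g = f + - g"

instance
  by standard
    (unfold minus_l2_def, (transfer, auto simp: l2_rel_def sq_integrable_zero algebra_simps
      intro: sq_integrable_add simp del: add_uminus_conv_diff)+)

end

lift_definition l2_scale :: "complex \<Rightarrow> 'n::finite l2 \<Rightarrow> 'n l2" is "\<lambda>c f a. c * f a"
  by (auto simp: l2_rel_def intro!: sq_integrable_scale)

interpretation l2: vector_space "l2_scale :: complex \<Rightarrow> 'n::finite l2 \<Rightarrow> 'n l2"
  by standard
    (transfer, auto simp: l2_rel_def algebra_simps
      intro!: sq_integrable_add sq_integrable_scale)+

lift_definition l2_inner :: "'n::finite l2 \<Rightarrow> 'n l2 \<Rightarrow> complex"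
  is "\<lambda>f g. \<integral>a. cnj (f a) * g a \<partial>lborel"
proof (rule integral_cong_AE)
  have [measurable]: "cnj \<in> borel_measurable borel"
    by (intro borel_measurable_continuous_onI continuous_intros)
  fix f f' g g' :: "real^'n \<Rightarrow> complex"
  assume rel: "l2_rel f f'" "l2_rel g g'"
  then have [measurable]: "f \<in> borel_measurable lborel" "f' \<in> borel_measurable lborel"
      "g \<in> borel_measurable lborel" "g' \<in> borel_measurable lborel"
    by (auto simp: l2_rel_def sq_integrable_def)
  show "(\<lambda>a. cnj (f a) * g a) \<in> borel_measurable lborel"
    by measurable
  show "(\<lambda>a. cnj (f' a) * g' a) \<in> borel_measurable lborel"
    by measurable
  show "AE a in lborel. cnj (f a) * g a = cnj (f' a) * g' a"
    using rel by (auto simp: l2_rel_def)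
qed


section \<open>Self-adjoint operators and functional calculus\<close>

text \<open>An unbounded operator is represented by its graph.\<close>

definition adjoint_graph :: "('n::finite l2 \<times> 'n l2) set \<Rightarrow> ('n l2 \<times> 'n l2) set" where
  "adjoint_graph T = {(u, v). \<forall>(f, g) \<in> T. l2_inner u g = l2_inner v f}"

text \<open>
  Density of the domain is automatic: if \<open>w\<close> is orthogonal to the domain, then
  \<open>(0, w)\<close> lies in the adjoint graph, so \<open>w = 0\<close> by single-valuedness. Likewise
  linearity, since an adjoint graph is a linear subspace.
\<close>

definition self_adjoint :: "('n::finite l2 \<times> 'n l2) set \<Rightarrow> bool" where
  "self_adjoint T \<longleftrightarrow> single_valued T \<and> adjoint_graph T = T"

definition self_adjoint_ext :: "('n::finite l2 \<times> 'n l2) set \<Rightarrow> ('n l2 \<times> 'n l2) set" where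
  "self_adjoint_ext T = (THE S. self_adjoint S \<and> T \<subseteq> S)"

abbreviation l2_linear :: "('n::finite l2 \<Rightarrow> 'n l2) \<Rightarrow> bool" where
  "l2_linear \<equiv> Vector_Spaces.linear l2_scale l2_scale"

definition projection_valued_measure :: "(real set \<Rightarrow> 'n::finite l2 \<Rightarrow> 'n l2) \<Rightarrow> bool" where
  "projection_valued_measure E \<longleftrightarrow>
     (\<forall>A \<in> sets borel. l2_linear (E A) \<and> E A \<circ> E A = E A \<and>
        (\<forall>u v. l2_inner (E A u) v = l2_inner u (E A v))) \<and>
     E UNIV = id \<and>
     (\<forall>A :: nat \<Rightarrow> real set. range A \<subseteq> sets borel \<longrightarrow> disjoint_family A \<longrightarrow>
        (\<forall>u v. (\<lambda>m. l2_inner u (E (A m) v)) sums l2_inner u (E (\<Union>m. A m) v)))"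

definition spectral_distr ::
    "(real set \<Rightarrow> 'n::finite l2 \<Rightarrow> 'n l2) \<Rightarrow> 'n l2 \<Rightarrow> real measure" where
  "spectral_distr E u = measure_of UNIV (sets borel) (\<lambda>A. ennreal (Re (l2_inner u (E A u))))"

text \<open>
  \<open>E\<close> is the spectral measure of the self-adjoint operator \<open>T\<close>, i.e. \<open>T\<close> is the integral of
  the identity function against \<open>E\<close>. As usual the integral is given by its quadratic form, which
  by polarization determines a linear operator.
\<close>

definition spectral_measure ::
    "('n::finite l2 \<times> 'n l2) set \<Rightarrow> (real set \<Rightarrow> 'n l2 \<Rightarrow> 'n l2) \<Rightarrow> bool" where
  "spectral_measure T E \<longleftrightarrow> self_adjoint T \<and> projection_valued_measure E \<and>
     Domain T = {u. integrable (spectral_distr E u) (\<lambda>t. t\<^sup>2)} \<and>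
     (\<forall>(u, v) \<in> T. l2_inner u v = of_real (\<integral>t. t \<partial>spectral_distr E u))"

text \<open>\<open>\<phi>(T)\<close> for a self-adjoint operator \<open>T\<close> and a bounded Borel function \<open>\<phi>\<close>.\<close>

definition func_calc ::
    "(real \<Rightarrow> complex) \<Rightarrow> ('n::finite l2 \<times> 'n l2) set \<Rightarrow> 'n l2 \<Rightarrow> 'n l2" where
  "func_calc \<phi> T = (THE S. l2_linear S \<and>
     (\<exists>E. spectral_measure T E \<and>
        (\<forall>u. l2_inner u (S u) = (\<integral>t. \<phi> t \<partial>spectral_distr E u))))"


section \<open>The position and momentum operators and their combinations\<close>

text \<open>The linear span of Gaussians times polynomials.\<close>

inductive_set gauss_poly :: "(real^'n::finite \<Rightarrow> complex) set" where
  base: "(\<forall>i. Re (\<alpha> i) > 0) \<Longrightarrow> polynomial_function P \<Longrightarrow>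
    (\<lambda>a. exp (- (\<Sum>i\<in>UNIV. \<alpha> i * of_real ((a $ i)\<^sup>2) + \<beta> i * of_real (a $ i))) * P a) \<in> gauss_poly"
| scale: "f \<in> gauss_poly \<Longrightarrow> (\<lambda>a. c * f a) \<in> gauss_poly"
| add: "f \<in> gauss_poly \<Longrightarrow> g \<in> gauss_poly \<Longrightarrow> (\<lambda>a. f a + g a) \<in> gauss_poly"

definition q_op :: "'n \<Rightarrow> (real^'n::finite \<Rightarrow> complex) \<Rightarrow> real^'n \<Rightarrow> complex" where
  "q_op i f a = of_real (a $ i) * f a"

definition p_op :: "real \<Rightarrow> 'n \<Rightarrow> (real^'n::finite \<Rightarrow> complex) \<Rightarrow> real^'n \<Rightarrow> complex" where
  "p_op hbar i f a =
     2 * of_real pi * \<i> * of_real hbar * vector_derivative (\<lambda>t. f (a + t *\<^sub>R axis i 1)) (at 0)"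

definition x_op ::
    "real \<Rightarrow> 'n seed \<Rightarrow> 'n \<Rightarrow> (real^'n::finite \<Rightarrow> complex) \<Rightarrow> real^'n \<Rightarrow> complex" where
  "x_op hbar \<Gamma> i f a = 1 / 2 * inverse (of_nat (symm \<Gamma> i)) * p_op hbar i f a
     - (\<Sum>j\<in>UNIV. of_int (exch \<Gamma> i j) * q_op j f a)"

definition xt_op ::
    "real \<Rightarrow> 'n seed \<Rightarrow> 'n \<Rightarrow> (real^'n::finite \<Rightarrow> complex) \<Rightarrow> real^'n \<Rightarrow> complex" where
  "xt_op hbar \<Gamma> i f a = 1 / 2 * inverse (of_nat (symm \<Gamma> i)) * p_op hbar i f a
     + (\<Sum>j\<in>UNIV. of_int (exch \<Gamma> i j) * q_op j f a)"

definition graph_on_gauss_poly ::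
    "((real^'n::finite \<Rightarrow> complex) \<Rightarrow> real^'n \<Rightarrow> complex) \<Rightarrow> ('n l2 \<times> 'n l2) set" where
  "graph_on_gauss_poly X = {(abs_l2 f, abs_l2 (X f)) | f. f \<in> gauss_poly}"

definition x_sa :: "real \<Rightarrow> 'n::finite seed \<Rightarrow> 'n \<Rightarrow> ('n l2 \<times> 'n l2) set" where
  "x_sa hbar \<Gamma> i = self_adjoint_ext (graph_on_gauss_poly (x_op hbar \<Gamma> i))"

definition xt_sa :: "real \<Rightarrow> 'n::finite seed \<Rightarrow> 'n \<Rightarrow> ('n l2 \<times> 'n l2) set" where
  "xt_sa hbar \<Gamma> i = self_adjoint_ext (graph_on_gauss_poly (xt_op hbar \<Gamma> i))"


section \<open>The quantum dilogarithm\<close>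

definition qdilog_integrand :: "real \<Rightarrow> real \<Rightarrow> complex \<Rightarrow> complex" where
  "qdilog_integrand h z p =
     exp (- \<i> * p * of_real z) / (sinh (of_real pi * p) * sinh (of_real (pi * h) * p)) / p"

text \<open>
  Apart from the origin, the pole of the integrand nearest to the origin is at distance
  \<open>min 1 (1 / h)\<close>, so the value of the integral does not depend on the radius of the half circle
  as long as it is smaller than that.
\<close>

definition qdilog_radius :: "real \<Rightarrow> real" where
  "qdilog_radius h = min 1 (1 / h) / 2"

definition qdilog :: "real \<Rightarrow> real \<Rightarrow> complex" where
  "qdilog h z = (let r = qdilog_radius h; F = qdilog_integrand h z in
     exp (- (1 / 4) *
       ((LINT p:{..-r}|lborel. F (of_real p))
        + contour_integral (part_circlepath 0 r pi 0) F
        + (LINT p:{r..}|lborel. F (of_real p)))))"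


section \<open>The intertwiner\<close>

definition mutate_coord :: "'n seed \<Rightarrow> 'n \<Rightarrow> real^'n::finite \<Rightarrow> real^'n" where
  "mutate_coord \<Gamma> k a = (\<chi> i. if i = k
     then - a $ k + (\<Sum>j\<in>UNIV. of_int (max (- exch \<Gamma> k j) 0) * a $ j)
     else a $ i)"

text \<open>
  For a seed, \<open>mutate_coord \<Gamma> k\<close> is a linear automorphism of determinant -1, so the result does
  not depend on the representative.
\<close>

definition K_prime :: "'n::finite seed \<Rightarrow> 'n \<Rightarrow> 'n l2 \<Rightarrow> 'n l2" where
  "K_prime \<Gamma> k f = abs_l2 (\<lambda>a. rep_l2 f (mutate_coord \<Gamma> k a))"

text \<open>
  The operator from the Hilbert space of \<open>mutate k \<Gamma>\<close> to that of \<open>\<Gamma>\<close>; as Hilbert spaces both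
  are the same type.
\<close>

definition intertwiner :: "real \<Rightarrow> 'n::finite seed \<Rightarrow> 'n \<Rightarrow> 'n l2 \<Rightarrow> 'n l2" where
  "intertwiner hbar \<Gamma> k =
     func_calc (qdilog (hbar / real (symm \<Gamma> k))) (x_sa hbar \<Gamma> k)
     \<circ> inv (func_calc (qdilog (hbar / real (symm \<Gamma> k))) (xt_sa hbar \<Gamma> k))
     \<circ> K_prime \<Gamma> k"

end

theory Submission
  imports Defs "HOL-Probability.Probability" "HOL-Complex_Analysis.Complex_Analysis"
begin

text \<open>
  Let \<open>h = hbar / d\<^sub>k\<close>, let \<open>\<phi>\<close> be the quantum dilogarithm with parameter \<open>h\<close>, and let
  \<open>E = \<Sum>\<^sub>j \<epsilon>\<^sub>k\<^sub>j a\<^sub>j\<close>. Skew-symmetrizability gives \<open>\<epsilon>\<^sub>k\<^sub>k = 0\<close>, so \<open>E\<close> does not involve \<open>a\<^sub>k\<close>, and the two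
  operators of the intertwiner are \<open>\<i> \<pi> h \<partial>\<^sub>k - E\<close> and \<open>\<i> \<pi> h \<partial>\<^sub>k + E\<close>. The Fourier transform in the
  single variable \<open>a\<^sub>k\<close> turns them into multiplication by the real functions
  \<open>l = - \<pi> h a\<^sub>k - E\<close> and \<open>l' = - \<pi> h a\<^sub>k + E\<close>, and their functional calculus into multiplication by
  \<open>\<phi> \<circ> l\<close> and \<open>\<phi> \<circ> l'\<close>. It turns the substitution \<open>a\<^sub>k \<mapsto> N - a\<^sub>k\<close> with \<open>N = \<Sum>\<^sub>j [- \<epsilon>\<^sub>k\<^sub>j]\<^sub>+ a\<^sub>j\<close> into the
  reflection \<open>a\<^sub>k \<mapsto> - a\<^sub>k\<close> followed by multiplication by \<open>exp (- \<i> N a\<^sub>k)\<close>.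

  Mutation at \<open>k\<close> negates row \<open>k\<close> of the exchange matrix. It therefore exchanges \<open>l\<close> and \<open>l'\<close>, and
  replaces \<open>N\<close> by \<open>N + E\<close>, because \<open>[\<epsilon>]\<^sub>+ - [- \<epsilon>]\<^sub>+ = \<epsilon>\<close>. The reflection sends \<open>l\<close> to \<open>- l'\<close> and \<open>l'\<close> to
  \<open>- l\<close>. Hence the composite of the two intertwiners becomes multiplication by
    \<open>\<phi>(l) \<phi>(- l) \<cdot> cnj (\<phi>(l') \<phi>(- l')) \<cdot> exp (\<i> E a\<^sub>k)\<close>.
  The inversion formula \<open>\<phi>(z) \<phi>(- z) = C exp (- \<i> z\<^sup>2 / (4 \<pi> h))\<close> with \<open>\<bar>C\<bar> = 1\<close> and the identity
  \<open>l\<^sup>2 - l'\<^sup>2 = 4 \<pi> h E a\<^sub>k\<close> show that this function is the constant 1. The inversion formula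
  (\<open>qdilog_mult_minus\<close>) holds because in the sum of the exponents at \<open>z\<close> and \<open>- z\<close> the contributions of
  the half lines cancel and the half circles close up to a circle about the triple pole at the
  origin, whose residue is a quadratic polynomial in \<open>z\<close> without linear term.

  Three points make this rigorous. The partial Fourier transform is obtained from Gaussians: the
  functions \<open>exp (c \<bullet> a - \<bar>a\<bar>\<^sup>2 / 2)\<close> and their expected transforms have the same Gram matrix and both
  families are total, so there is a unitary that takes one to the other (\<open>unitary_of_equal_gram\<close>,
  \<open>partial_fourier_exists\<close>); matrix elements between Gaussians then determine every operator in
  sight. Next, the self-adjoint extension is unique: whatever is adjoint to the differential operator
  on Gaussians alone already lies in the graph of the multiplication operator
  (\<open>self_adjoint_ext_fibre_op\<close>). Last, the functional calculus of a multiplication operator is the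
  expected one, which requires the uniqueness of the spectral measure
  (\<open>func_calc_spectral_graph\<close>).
\<close>


section \<open>The Hilbert space\<close>

lemma sq_integrable_rep [simp]: "sq_integrable (rep_l2 u)"
  using Quotient3_rep_reflp[OF Quotient3_l2, of u] by (simp add: l2_rel_def)

lemma measurable_rep [measurable]: "rep_l2 u \<in> borel_measurable borel"
  using sq_integrable_rep[of u] by (simp add: sq_integrable_def)

lemma abs_rep_l2 [simp]: "abs_l2 (rep_l2 u) = u"
  by (rule Quotient3_abs_rep[OF Quotient3_l2])

lemma abs_l2_eq_iff:
  "sq_integrable f \<Longrightarrow> sq_integrable g \<Longrightarrow> abs_l2 f = abs_l2 g \<longleftrightarrow> (AE a in lborel. f a = g a)"
  using Quotient3_rel[OF Quotient3_l2, of f g] by (auto simp: l2_rel_def)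

lemma rep_abs_l2: "sq_integrable f \<Longrightarrow> AE a in lborel. rep_l2 (abs_l2 f) a = f a"
  using abs_l2_eq_iff[of "rep_l2 (abs_l2 f)" f] by simp

lemma l2_eq_iff: "u = v \<longleftrightarrow> (AE a in lborel. rep_l2 u a = rep_l2 v a)"
  using abs_l2_eq_iff[of "rep_l2 u" "rep_l2 v"] by simp

lemma abs_l2_eqI: "sq_integrable f \<Longrightarrow> (AE a in lborel. rep_l2 u a = f a) \<Longrightarrow> abs_l2 f = u"
  using abs_l2_eq_iff[of "rep_l2 u" f] by simp

lemma rep_plus: "AE a in lborel. rep_l2 (u + v) a = rep_l2 u a + rep_l2 v a"
proof -
  have "u + v = abs_l2 (\<lambda>a. rep_l2 u a + rep_l2 v a)"
    using plus_l2.abs_eq[of "rep_l2 u" "rep_l2 v"] by (simp add: l2_rel_def)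
  then show ?thesis
    by (simp add: rep_abs_l2 sq_integrable_add)
qed

lemma rep_scale: "AE a in lborel. rep_l2 (l2_scale c u) a = c * rep_l2 u a"
proof -
  have "l2_scale c u = abs_l2 (\<lambda>a. c * rep_l2 u a)"
    using l2_scale.abs_eq[of "rep_l2 u" c] by (simp add: l2_rel_def)
  then show ?thesis
    by (simp add: rep_abs_l2 sq_integrable_scale)
qed

lemma rep_zero: "AE a in lborel. rep_l2 0 a = 0"
  unfolding zero_l2_def by (simp add: rep_abs_l2 sq_integrable_zero)

lemma uminus_l2_eq_scale: "- u = l2_scale (-1) (u :: 'n::finite l2)"
  using l2.scale_minus_left[of 1 u] by simp

lemma rep_minus: "AE a in lborel. rep_l2 (u - v) a = rep_l2 u a - rep_l2 v a"
proof -
  have *: "u - v = u + l2_scale (-1) v"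
    by (simp add: uminus_l2_eq_scale[symmetric])
  show ?thesis
    unfolding * using rep_plus[of u "l2_scale (-1) v"] rep_scale[of "-1" v]
    by eventually_elim simp
qed

lemma l2_inner_eq: "l2_inner u v = (\<integral>a. cnj (rep_l2 u a) * rep_l2 v a \<partial>lborel)"
  by (simp add: l2_inner.rep_eq)

lemma measurable_cnj [measurable]: "cnj \<in> borel_measurable borel"
  by (intro borel_measurable_continuous_onI continuous_intros)

lemma integrable_sq_prod:
  assumes "sq_integrable f" "sq_integrable g"
  shows "integrable lborel (\<lambda>a. cnj (f a) * g a)" "integrable lborel (\<lambda>a. f a * g a)"
proof -
  have m [measurable]: "f \<in> borel_measurable lborel" "g \<in> borel_measurable lborel"
    using assms by (auto simp: sq_integrable_def)
  have i: "integrable lborel (\<lambda>a. (cmod (f a))\<^sup>2 + (cmod (g a))\<^sup>2)"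
    using assms by (auto simp: sq_integrable_def)
  have b: "cmod (f a) * cmod (g a) \<le> (cmod (f a))\<^sup>2 + (cmod (g a))\<^sup>2" for a
  proof -
    have "0 \<le> cmod (f a) * cmod (g a)" by simp
    with sum_squares_bound[of "cmod (f a)" "cmod (g a)"] show ?thesis by linarith
  qed
  show "integrable lborel (\<lambda>a. cnj (f a) * g a)" "integrable lborel (\<lambda>a. f a * g a)"
    by (rule Bochner_Integration.integrable_bound[OF i]; use b in \<open>auto simp: norm_mult\<close>)+
qed

lemma integrable_inner: "integrable lborel (\<lambda>a. cnj (rep_l2 u a) * rep_l2 v a)"
  by (simp add: integrable_sq_prod)

lemma l2_inner_commute: "l2_inner u v = cnj (l2_inner v u)"
  unfolding l2_inner_eq by (subst Bochner_Integration.integral_cnj[symmetric]) (simp add: mult.commute)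

lemma l2_inner_add_right: "l2_inner u (v + w) = l2_inner u v + l2_inner u w"
proof -
  have "l2_inner u (v + w) = (\<integral>a. cnj (rep_l2 u a) * rep_l2 v a + cnj (rep_l2 u a) * rep_l2 w a \<partial>lborel)"
    unfolding l2_inner_eq
  proof (rule integral_cong_AE)
    show "AE a in lborel. cnj (rep_l2 u a) * rep_l2 (v + w) a
        = cnj (rep_l2 u a) * rep_l2 v a + cnj (rep_l2 u a) * rep_l2 w a"
      using rep_plus[of v w] by eventually_elim (simp add: distrib_left)
  qed simp_all
  then show ?thesis
    by (simp add: integrable_inner l2_inner_eq)
qed

lemma l2_inner_scale_right: "l2_inner u (l2_scale c v) = c * l2_inner u v"
proof -
  have "l2_inner u (l2_scale c v) = (\<integral>a. c * (cnj (rep_l2 u a) * rep_l2 v a) \<partial>lborel)"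
    unfolding l2_inner_eq
  proof (rule integral_cong_AE)
    show "AE a in lborel. cnj (rep_l2 u a) * rep_l2 (l2_scale c v) a
        = c * (cnj (rep_l2 u a) * rep_l2 v a)"
      using rep_scale[of c v] by eventually_elim simp
  qed simp_all
  then show ?thesis
    by (simp add: l2_inner_eq)
qed

lemma l2_inner_add_left: "l2_inner (u + v) w = l2_inner u w + l2_inner v w"
  using l2_inner_add_right[of w u v] l2_inner_commute[of "u + v" w] l2_inner_commute[of u w]
    l2_inner_commute[of v w] by simp

lemma l2_inner_scale_left: "l2_inner (l2_scale c v) w = cnj c * l2_inner v w"
  using l2_inner_scale_right[of w c v] l2_inner_commute[of "l2_scale c v" w]
    l2_inner_commute[of v w] by simp

lemma l2_inner_zero [simp]: "l2_inner 0 w = 0" "l2_inner w 0 = 0"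
  using l2_inner_scale_left[of 0 0 w] l2_inner_scale_right[of w 0 0] by simp_all

lemma l2_inner_minus [simp]: "l2_inner (- u) w = - l2_inner u w" "l2_inner w (- u) = - l2_inner w u"
  unfolding uminus_l2_eq_scale[of u] l2_inner_scale_left l2_inner_scale_right by simp_all

lemma l2_inner_diff_left: "l2_inner (u - v) w = l2_inner u w - l2_inner v w"
  and l2_inner_diff_right: "l2_inner w (u - v) = l2_inner w u - l2_inner w v"
  using l2_inner_add_left[of u "- v" w] l2_inner_add_right[of w u "- v"] by simp_all

lemmas l2_inner_simps = l2_inner_add_left l2_inner_add_right l2_inner_scale_left
  l2_inner_scale_right l2_inner_diff_left l2_inner_diff_right

lemma l2_inner_self: "l2_inner u u = of_real (\<integral>a. (cmod (rep_l2 u a))\<^sup>2 \<partial>lborel)"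
proof -
  have "l2_inner u u = (\<integral>a. complex_of_real ((cmod (rep_l2 u a))\<^sup>2) \<partial>lborel)"
    unfolding l2_inner_eq
    by (rule Bochner_Integration.integral_cong) (simp_all only: complex_norm_square mult.commute)
  then show ?thesis by (simp only: integral_complex_of_real)
qed

lemma integrable_rep_sq: "integrable lborel (\<lambda>a. (cmod (rep_l2 u a))\<^sup>2)"
  using sq_integrable_rep[of u] by (simp add: sq_integrable_def)

lemma l2_inner_self_eq_0: "l2_inner u u = 0 \<longleftrightarrow> u = 0"
proof
  assume "l2_inner u u = 0"
  then have "(\<integral>a. (cmod (rep_l2 u a))\<^sup>2 \<partial>lborel) = 0"
    by (simp add: l2_inner_self)
  then have "AE a in lborel. rep_l2 u a = 0"
    by (subst (asm) integral_nonneg_eq_0_iff_AE) (auto simp: integrable_rep_sq)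
  then show "u = 0"
    using rep_zero unfolding l2_eq_iff by eventually_elim simp
qed auto

text \<open>The real inner product is the real part of the hermitian one; both have the same norm.\<close>

instantiation l2 :: (finite) real_inner
begin

definition scaleR_l2 :: "real \<Rightarrow> 'a l2 \<Rightarrow> 'a l2" where
  "scaleR_l2 r u = l2_scale (of_real r) u"

definition inner_l2 :: "'a l2 \<Rightarrow> 'a l2 \<Rightarrow> real" where
  "inner_l2 u v = Re (l2_inner u v)"

definition norm_l2 :: "'a l2 \<Rightarrow> real" where
  "norm_l2 u = sqrt (inner u u)"

definition sgn_l2 :: "'a l2 \<Rightarrow> 'a l2" where
  "sgn_l2 u = scaleR (inverse (norm u)) u"

definition dist_l2 :: "'a l2 \<Rightarrow> 'a l2 \<Rightarrow> real" where
  "dist_l2 u v = norm (u - v)"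

definition uniformity_l2 :: "('a l2 \<times> 'a l2) filter" where
  "uniformity_l2 = (INF e\<in>{0 <..}. principal {(x, y). dist x y < e})"

definition open_l2 :: "'a l2 set \<Rightarrow> bool" where
  "open_l2 S \<longleftrightarrow> (\<forall>x\<in>S. eventually (\<lambda>(x', y). x' = x \<longrightarrow> y \<in> S) uniformity)"

instance
proof
  fix u v w :: "'a l2" and r s :: real
  have Re_self: "Re (l2_inner u u) = (\<integral>a. (cmod (rep_l2 u a))\<^sup>2 \<partial>lborel)"
    by (simp add: l2_inner_self)
  show "r *\<^sub>R (u + v) = r *\<^sub>R u + r *\<^sub>R v" "(r + s) *\<^sub>R u = r *\<^sub>R u + s *\<^sub>R u"
      "r *\<^sub>R s *\<^sub>R u = (r * s) *\<^sub>R u" "1 *\<^sub>R u = u"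
    by (simp_all add: scaleR_l2_def l2.scale_right_distrib l2.scale_left_distrib)
  show "inner u v = inner v u"
    by (simp add: inner_l2_def l2_inner_commute[of u v])
  show "inner (u + v) w = inner u w + inner v w" "inner (r *\<^sub>R u) v = r * inner u v"
    by (simp_all add: inner_l2_def scaleR_l2_def l2_inner_simps)
  show "0 \<le> inner u u"
    by (simp add: inner_l2_def Re_self)
  show "inner u u = 0 \<longleftrightarrow> u = 0"
    using l2_inner_self_eq_0[of u]
    by (simp add: inner_l2_def l2_inner_self)
qed (simp_all add: norm_l2_def sgn_l2_def dist_l2_def uniformity_l2_def open_l2_def)

end

lemma l2_norm_sq: "(norm u)\<^sup>2 = (\<integral>a. (cmod (rep_l2 u a))\<^sup>2 \<partial>lborel)" for u :: "'n::finite l2"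
  by (simp add: power2_norm_eq_inner inner_l2_def l2_inner_self)

lemma l2_inner_self_norm: "l2_inner u u = of_real ((norm u)\<^sup>2)"
  by (simp only: l2_norm_sq l2_inner_self)

lemma norm_l2_scale [simp]: "norm (l2_scale c u) = cmod c * norm u"
proof -
  have "complex_of_real ((norm (l2_scale c u))\<^sup>2) = of_real ((cmod c * norm u)\<^sup>2)"
    unfolding l2_inner_self_norm[symmetric] power_mult_distrib of_real_mult
    by (simp add: l2_inner_simps complex_norm_square[symmetric] mult.assoc[symmetric] del: of_real_power)
  then have "(norm (l2_scale c u))\<^sup>2 = (cmod c * norm u)\<^sup>2"
    by (simp only: of_real_eq_iff)
  then show ?thesis
    by (simp add: power2_eq_iff_nonneg)
qed

lemma l2_inner_eqI:
  assumes "\<And>v. l2_inner v u = l2_inner v w"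
  shows "u = w"
proof -
  have "l2_inner (u - w) (u - w) = 0"
    using assms[of "u - w"] by (simp add: l2_inner_diff_right)
  then show ?thesis
    by (simp add: l2_inner_self_eq_0)
qed

lemma cmod_l2_inner_le: "cmod (l2_inner u v) \<le> norm u * norm v"
proof (cases "l2_inner u v = 0")
  case False
  define c where "c = cnj (l2_inner u v) / of_real (cmod (l2_inner u v))"
  have c1: "cmod c = 1"
    using False by (simp add: c_def norm_divide)
  have "l2_inner u (l2_scale c v) = of_real (cmod (l2_inner u v))"
    using False complex_norm_square[of "l2_inner u v"]
    by (simp add: l2_inner_simps c_def field_simps power2_eq_square)
  then have "cmod (l2_inner u v) = inner u (l2_scale c v)"
    by (simp add: inner_l2_def)
  also have "\<dots> \<le> norm u * norm v"
    using norm_cauchy_schwarz[of u "l2_scale c v"] c1 by simp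
  finally show ?thesis .
qed auto

lemma bounded_linear_l2_scale: "bounded_linear (l2_scale c)"
  by (rule bounded_linear_intro[where K = "cmod c"])
     (auto simp: scaleR_l2_def l2.scale_right_distrib mult.commute)

lemmas tendsto_l2_scale = bounded_linear.tendsto[OF bounded_linear_l2_scale]

text \<open>
  The theorem of Riesz and Fischer is proved for series whose norms decay geometrically. The squares
  of their terms, even after multiplication by \<open>2 ^ m\<close>, have summable integrals, so the weighted
  series of squares is finite almost everywhere, and it controls the series itself.
\<close>

lemma AE_summable_of_norm_bound:
  fixes u :: "nat \<Rightarrow> 'n::finite l2"
  assumes "\<And>m. norm (u m) \<le> (1 / 2) ^ m"
  shows "AE a in lborel. summable (\<lambda>m. cmod (rep_l2 (u m) a))"
proof -
  have e: "(\<integral>\<^sup>+ a. ennreal (2 ^ m * (cmod (rep_l2 (u m) a))\<^sup>2) \<partial>lborel) \<le> ennreal ((1 / 2) ^ m)" for m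
  proof -
    have "(\<integral>\<^sup>+ a. ennreal (2 ^ m * (cmod (rep_l2 (u m) a))\<^sup>2) \<partial>lborel) = ennreal (2 ^ m * (norm (u m))\<^sup>2)"
      by (subst nn_integral_eq_integral) (auto simp: integrable_rep_sq l2_norm_sq)
    also have "\<dots> \<le> ennreal (2 ^ m * ((1 / 2) ^ m)\<^sup>2)"
      by (intro ennreal_leI mult_left_mono power_mono assms) auto
    also have "2 ^ m * ((1 / 2) ^ m)\<^sup>2 = (1 / 2 :: real) ^ m"
      by (simp add: power2_eq_square field_simps)
    finally show ?thesis .
  qed
  have "(\<integral>\<^sup>+ a. (\<Sum>m. ennreal (2 ^ m * (cmod (rep_l2 (u m) a))\<^sup>2)) \<partial>lborel)
      = (\<Sum>m. \<integral>\<^sup>+ a. ennreal (2 ^ m * (cmod (rep_l2 (u m) a))\<^sup>2) \<partial>lborel)"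
    by (rule nn_integral_suminf) measurable
  also have "\<dots> \<le> (\<Sum>m. ennreal ((1 / 2) ^ m))"
    by (intro suminf_le e) auto
  also have "\<dots> = ennreal (\<Sum>m. (1 / 2) ^ m)"
    by (rule suminf_ennreal2) (auto simp: summable_geometric)
  finally have fin: "(\<integral>\<^sup>+ a. (\<Sum>m. ennreal (2 ^ m * (cmod (rep_l2 (u m) a))\<^sup>2)) \<partial>lborel) \<noteq> \<infinity>"
    by (auto simp: top_unique)
  then have "AE a in lborel. (\<Sum>m. ennreal (2 ^ m * (cmod (rep_l2 (u m) a))\<^sup>2)) \<noteq> \<infinity>"
    by (intro nn_integral_noteq_infinite) measurable
  then have *: "AE a in lborel. summable (\<lambda>m. 2 ^ m * (cmod (rep_l2 (u m) a))\<^sup>2)"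
    by eventually_elim (rule summable_suminf_not_top, auto)
  then show ?thesis
  proof eventually_elim
    case (elim a)
    have s: "summable (\<lambda>m. (1 / 2) ^ m + 2 ^ m * (cmod (rep_l2 (u m) a))\<^sup>2)"
      by (intro summable_add elim summable_geometric) auto
    \<comment> \<open>\<open>x \<le> (1 / 2) ^ m\<close> or \<open>x \<le> 2 ^ m * x\<^sup>2\<close>\<close>
    have b: "cmod (rep_l2 (u m) a) \<le> (1 / 2) ^ m + 2 ^ m * (cmod (rep_l2 (u m) a))\<^sup>2" for m
    proof -
      define x where "x = cmod (rep_l2 (u m) a)"
      have "0 \<le> (1 - 2 ^ m * x)\<^sup>2 + 2 ^ m * x"
        by (simp add: x_def)
      then have "2 ^ m * x \<le> 1 + (2 ^ m * x)\<^sup>2"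
        by (simp add: power2_diff algebra_simps)
      then have "(1 / 2) ^ m * (2 ^ m * x) \<le> (1 / 2) ^ m * (1 + (2 ^ m * x)\<^sup>2)"
        by (intro mult_left_mono) auto
      also have "\<dots> = (1 / 2) ^ m + 2 ^ m * x\<^sup>2"
        by (simp add: power2_eq_square field_simps)
      also have "(1 / 2) ^ m * (2 ^ m * x) = x"
        by (simp add: field_simps)
      finally show ?thesis by (simp add: x_def)
    qed
    show ?case
      by (rule summable_comparison_test'[OF s, of 0]) (use b in simp)
  qed
qed

lemma l2_norm_sum_le:
  fixes u :: "nat \<Rightarrow> 'n::finite l2"
  assumes "\<And>m. norm (u m) \<le> (1 / 2) ^ m"
  shows "norm (\<Sum>m=i..<j. u m) \<le> 2 * (1 / 2) ^ i"
proof -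
  have "norm (\<Sum>m=i..<j. u m) \<le> (\<Sum>m=i..<j. (1 / 2) ^ m)"
    by (rule order_trans[OF norm_sum]) (intro sum_mono assms)
  also have "\<dots> \<le> 2 * (1 / 2) ^ i"
  proof (cases "i \<le> j")
    case True
    then have "(\<Sum>m=i..<j. (1 / 2) ^ m) = 2 * (1 / 2) ^ i - 2 * (1 / 2 :: real) ^ j"
      by (induction rule: dec_induct) auto
    then show ?thesis by simp
  qed simp
  finally show ?thesis .
qed

lemma rep_sum: "AE a in lborel. rep_l2 (\<Sum>m<i. u m) a = (\<Sum>m<i. rep_l2 (u m) a)"
  for u :: "nat \<Rightarrow> 'n::finite l2"
proof (induction i)
  case 0
  show ?case using rep_zero by simp
next
  case (Suc i)
  from Suc rep_plus[of "\<Sum>m<i. u m" "u i"] show ?case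
    by eventually_elim simp
qed

text \<open>
  The pointwise limit of the partial sums is their limit in the mean, by Fatou's lemma applied to
  the differences.
\<close>

lemma l2_geometric_sum_converges:
  fixes u :: "nat \<Rightarrow> 'n::finite l2"
  assumes u: "\<And>m. norm (u m) \<le> (1 / 2) ^ m"
  shows "convergent (\<lambda>i. \<Sum>m<i. u m)"
proof -
  define s where "s i = (\<Sum>m<i. u m)" for i
  define g where "g a = lim (\<lambda>i. rep_l2 (s i) a)" for a
  have g_meas [measurable]: "g \<in> borel_measurable borel"
    unfolding g_def by measurable
  have "AE a in lborel. \<forall>i. rep_l2 (s i) a = (\<Sum>m<i. rep_l2 (u m) a)"
    unfolding s_def by (subst AE_all_countable) (intro allI rep_sum)
  with AE_summable_of_norm_bound[OF u]
  have lim: "AE a in lborel. (\<lambda>i. rep_l2 (s i) a) \<longlonglongrightarrow> g a"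
  proof eventually_elim
    case (elim a)
    then have "convergent (\<lambda>i. rep_l2 (s i) a)"
      using summable_norm_cancel[of "\<lambda>m. rep_l2 (u m) a"]
      by (simp add: summable_iff_convergent)
    then show ?case
      by (simp add: g_def convergent_LIMSEQ_iff)
  qed
  have dist_s: "norm (s j - s i) \<le> 2 * (1 / 2) ^ i" if "i \<le> j" for i j
  proof -
    have "s j - s i = (\<Sum>m=i..<j. u m)"
      using sum_diff_nat_ivl[of 0 i j u] that by (simp add: s_def atLeast0LessThan)
    then show ?thesis using l2_norm_sum_le[OF u] by simp
  qed
  have bound: "(\<integral>\<^sup>+ a. ennreal ((cmod (g a - rep_l2 (s i) a))\<^sup>2) \<partial>lborel) \<le> ennreal ((2 * (1 / 2) ^ i)\<^sup>2)" for i
  proof -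
    have "AE a in lborel. ennreal ((cmod (g a - rep_l2 (s i) a))\<^sup>2)
        = liminf (\<lambda>j. ennreal ((cmod (rep_l2 (s j) a - rep_l2 (s i) a))\<^sup>2))"
      using lim
    proof eventually_elim
      case (elim a)
      have "(\<lambda>j. ennreal ((cmod (rep_l2 (s j) a - rep_l2 (s i) a))\<^sup>2))
          \<longlonglongrightarrow> ennreal ((cmod (g a - rep_l2 (s i) a))\<^sup>2)"
        by (intro tendsto_ennrealI tendsto_intros elim)
      from lim_imp_Liminf[OF sequentially_bot this] show ?case
        by (rule sym)
    qed
    then have "(\<integral>\<^sup>+ a. ennreal ((cmod (g a - rep_l2 (s i) a))\<^sup>2) \<partial>lborel)
        = (\<integral>\<^sup>+ a. liminf (\<lambda>j. ennreal ((cmod (rep_l2 (s j) a - rep_l2 (s i) a))\<^sup>2)) \<partial>lborel)"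
      by (rule nn_integral_cong_AE)
    also have "\<dots> \<le> liminf (\<lambda>j. \<integral>\<^sup>+ a. ennreal ((cmod (rep_l2 (s j) a - rep_l2 (s i) a))\<^sup>2) \<partial>lborel)"
      by (rule nn_integral_liminf) measurable
    also have "\<dots> = liminf (\<lambda>j. ennreal ((norm (s j - s i))\<^sup>2))"
    proof -
      have "(\<integral>\<^sup>+ a. ennreal ((cmod (rep_l2 (s j) a - rep_l2 (s i) a))\<^sup>2) \<partial>lborel)
          = (\<integral>\<^sup>+ a. ennreal ((cmod (rep_l2 (s j - s i) a))\<^sup>2) \<partial>lborel)" for j
      proof (rule nn_integral_cong_AE)
        show "AE a in lborel. ennreal ((cmod (rep_l2 (s j) a - rep_l2 (s i) a))\<^sup>2)
            = ennreal ((cmod (rep_l2 (s j - s i) a))\<^sup>2)"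
          using rep_minus[of "s j" "s i"] by eventually_elim simp
      qed
      then show ?thesis
        by (simp add: nn_integral_eq_integral integrable_rep_sq l2_norm_sq)
    qed
    also have "\<dots> \<le> limsup (\<lambda>j. ennreal ((norm (s j - s i))\<^sup>2))"
      by (rule Liminf_le_Limsup) simp
    also have "\<dots> \<le> ennreal ((2 * (1 / 2) ^ i)\<^sup>2)"
      by (intro Limsup_bounded eventually_sequentiallyI[of i] ennreal_leI power_mono dist_s norm_ge_zero)
    finally show ?thesis .
  qed
  have d: "sq_integrable (\<lambda>a. g a - rep_l2 (s i) a)" for i
  proof -
    have "integrable lborel (\<lambda>a. (cmod (g a - rep_l2 (s i) a))\<^sup>2)"
      by (rule integrableI_bounded) (use bound[of i] in \<open>auto simp: le_less_trans\<close>)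
    then show ?thesis by (simp add: sq_integrable_def)
  qed
  have g: "sq_integrable g"
    using sq_integrable_add[OF d[of 0] sq_integrable_rep[of "s 0"]] by simp
  have "norm (s i - abs_l2 g) \<le> 2 * (1 / 2) ^ i" for i
  proof -
    have "ennreal ((norm (abs_l2 g - s i))\<^sup>2)
        = (\<integral>\<^sup>+ a. ennreal ((cmod (rep_l2 (abs_l2 g - s i) a))\<^sup>2) \<partial>lborel)"
      by (simp add: nn_integral_eq_integral integrable_rep_sq l2_norm_sq)
    also have "\<dots> = (\<integral>\<^sup>+ a. ennreal ((cmod (g a - rep_l2 (s i) a))\<^sup>2) \<partial>lborel)"
    proof (rule nn_integral_cong_AE)
      show "AE a in lborel. ennreal ((cmod (rep_l2 (abs_l2 g - s i) a))\<^sup>2)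
          = ennreal ((cmod (g a - rep_l2 (s i) a))\<^sup>2)"
        using rep_minus[of "abs_l2 g" "s i"] rep_abs_l2[OF g] by eventually_elim simp
    qed
    also have "\<dots> \<le> ennreal ((2 * (1 / 2) ^ i)\<^sup>2)" by (rule bound)
    finally have "(norm (abs_l2 g - s i))\<^sup>2 \<le> (2 * (1 / 2) ^ i)\<^sup>2" by simp
    then have "norm (abs_l2 g - s i) \<le> 2 * (1 / 2) ^ i"
      by (rule power2_le_imp_le) simp
    then show ?thesis by (simp add: norm_minus_commute)
  qed
  then have "\<forall>\<^sub>F i in sequentially. norm (s i - abs_l2 g) \<le> 2 * (1 / 2) ^ i"
    by (rule always_eventually[OF allI])
  moreover have "(\<lambda>i. 2 * (1 / 2 :: real) ^ i) \<longlonglongrightarrow> 0"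
    by (rule tendsto_mult_right_zero[OF LIMSEQ_power_zero]) simp
  ultimately have "(\<lambda>i. s i - abs_l2 g) \<longlonglongrightarrow> 0"
    by (rule Lim_null_comparison)
  then have "s \<longlonglongrightarrow> abs_l2 g"
    by (rule LIM_zero_cancel)
  then show ?thesis
    unfolding s_def by (rule convergentI)
qed

text \<open>
  A Cauchy sequence has a subsequence whose increments form a series as in the preceding lemma.
\<close>

instance l2 :: (finite) complete_space
proof
  fix X :: "nat \<Rightarrow> 'a l2"
  assume X: "Cauchy X"
  have "\<exists>M. \<forall>i\<ge>M. \<forall>j\<ge>M. norm (X i - X j) < (1 / 2) ^ m" for m
    using X unfolding Cauchy_iff by auto
  then obtain M where M: "\<And>m i j. i \<ge> M m \<Longrightarrow> j \<ge> M m \<Longrightarrow> norm (X i - X j) < (1 / 2) ^ m"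
    by metis
  define r where "r m = (\<Sum>i\<le>m. M i) + m" for m
  have r: "r m \<ge> M m" "r (Suc m) \<ge> M m" for m
    using member_le_sum[of m "{..m}" M] by (simp_all add: r_def)
  have "strict_mono r"
    by (rule strict_mono_Suc_iff[THEN iffD2]) (simp add: r_def)
  define u where "u m = X (r (Suc m)) - X (r m)" for m
  have "norm (u m) \<le> (1 / 2) ^ m" for m
    using M[OF r(2) r(1), of m] by (simp add: u_def)
  then have "convergent (\<lambda>i. \<Sum>m<i. u m)"
    by (rule l2_geometric_sum_converges)
  then obtain l where "(\<lambda>i. \<Sum>m<i. u m) \<longlonglongrightarrow> l"
    by (auto simp: convergent_def)
  then have "(\<lambda>i. X (r i) - X (r 0)) \<longlonglongrightarrow> l"
    by (simp add: u_def sum_lessThan_telescope[of "\<lambda>m. X (r m)"])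
  then have "(\<lambda>i. X (r i) - X (r 0) + X (r 0)) \<longlonglongrightarrow> l + X (r 0)"
    by (intro tendsto_intros)
  then have "(X \<circ> r) \<longlonglongrightarrow> l + X (r 0)"
    by (simp add: o_def)
  then have "X \<longlonglongrightarrow> l + X (r 0)"
    by (rule Cauchy_converges_subseq[OF X \<open>strict_mono r\<close>, rotated])
  then show "convergent X" by (rule convergentI)
qed


section \<open>Unitary operators from equal Gram matrices\<close>

lemma bounded_bilinear_l2_inner: "bounded_bilinear l2_inner"
proof
  show "\<exists>K. \<forall>a b. norm (l2_inner a b) \<le> norm a * norm b * K"
    by (rule exI[of _ 1]) (simp add: cmod_l2_inner_le)
qed (simp_all add: l2_inner_simps scaleR_l2_def scaleR_conv_of_real)

lemmas tendsto_l2_inner = bounded_bilinear.tendsto[OF bounded_bilinear_l2_inner]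

text \<open>
  A sequence in the subspace that minimises the distance to \<open>u\<close> is a Cauchy sequence,
  by the parallelogram law. The difference of \<open>u\<close> and its limit is orthogonal to the
  subspace, hence zero.
\<close>

lemma l2_dense_if_total:
  fixes M :: "'n::finite l2 set"
  assumes M: "l2.subspace M"
    and total: "\<And>w. (\<And>x. x \<in> M \<Longrightarrow> l2_inner x w = 0) \<Longrightarrow> w = 0"
  shows "u \<in> closure M"
proof -
  have M_minus: "x - y \<in> M" if "x \<in> M" "y \<in> M" for x y
    using l2.subspace_diff[OF M] that by auto
  have M_scaleR: "r *\<^sub>R x \<in> M" if "x \<in> M" for x r
    using l2.subspace_scale[OF M] that by (simp add: scaleR_l2_def)
  define d where "d = (INF y\<in>M. norm (u - y))"
  have d_le: "d \<le> norm (u - y)" if "y \<in> M" for y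
    unfolding d_def by (rule cINF_lower[OF bdd_belowI2[of _ 0]]) (use that in auto)
  have "d \<ge> 0"
    unfolding d_def by (rule cINF_greatest) (use l2.subspace_0[OF M] in auto)
  have "\<exists>y\<in>M. norm (u - y) < d + inverse (Suc m)" for m
  proof -
    have "(INF y\<in>M. norm (u - y)) < d + inverse (Suc m)"
      by (simp add: d_def)
    then show ?thesis
      by (subst (asm) cINF_less_iff) (use l2.subspace_0[OF M] in \<open>auto intro!: bdd_belowI2[of _ 0]\<close>)
  qed
  then obtain y where y: "\<And>m. y m \<in> M" "\<And>m. norm (u - y m) < d + inverse (Suc m)"
    by metis
  have near: "(norm (y i - y j))\<^sup>2 \<le> 2 * (norm (u - y i))\<^sup>2 + 2 * (norm (u - y j))\<^sup>2 - 4 * d\<^sup>2" for i j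
  proof -
    have "(1 / 2 :: real) *\<^sub>R (y i + y j) \<in> M"
      by (intro M_scaleR l2.subspace_add[OF M] y)
    then have "d\<^sup>2 \<le> (norm (u - (1 / 2 :: real) *\<^sub>R (y i + y j)))\<^sup>2"
      by (intro power_mono d_le \<open>d \<ge> 0\<close>)
    moreover have "(norm (y i - y j))\<^sup>2 = 2 * (norm (u - y i))\<^sup>2 + 2 * (norm (u - y j))\<^sup>2
        - 4 * (norm (u - (1 / 2 :: real) *\<^sub>R (y i + y j)))\<^sup>2"
      unfolding power2_norm_eq_inner
      by (simp add: inner_diff_left inner_diff_right inner_add_left inner_add_right inner_commute algebra_simps)
    ultimately show ?thesis by linarith
  qed
  have lim_d: "(\<lambda>m. norm (u - y m)) \<longlonglongrightarrow> d"
  proof (rule tendsto_sandwich)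
    show "\<forall>\<^sub>F m in sequentially. d \<le> norm (u - y m)"
      by (intro always_eventually allI d_le y)
    show "\<forall>\<^sub>F m in sequentially. norm (u - y m) \<le> d + inverse (Suc m)"
      by (intro always_eventually allI less_imp_le y)
    show "(\<lambda>m. d + inverse (Suc m)) \<longlonglongrightarrow> d"
      using tendsto_add[OF tendsto_const[of d] LIMSEQ_inverse_real_of_nat] by simp
  qed simp
  have "Cauchy y"
  proof (rule CauchyI')
    fix e :: real assume "e > 0"
    have "(\<lambda>m. (norm (u - y m))\<^sup>2) \<longlonglongrightarrow> d\<^sup>2"
      by (intro tendsto_intros lim_d)
    then have "\<forall>\<^sub>F m in sequentially. (norm (u - y m))\<^sup>2 < d\<^sup>2 + e\<^sup>2 / 4"
      by (rule order_tendstoD) (use \<open>e > 0\<close> in simp)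
    then obtain N where N: "\<And>m. m \<ge> N \<Longrightarrow> (norm (u - y m))\<^sup>2 < d\<^sup>2 + e\<^sup>2 / 4"
      by (auto simp: eventually_sequentially)
    have "norm (y i - y j) < e" if "i \<ge> N" "j \<ge> N" for i j
    proof (rule power2_less_imp_less)
      show "(norm (y i - y j))\<^sup>2 < e\<^sup>2"
        using near[of i j] N[OF that(1)] N[OF that(2)] by linarith
    qed (use \<open>e > 0\<close> in simp)
    then show "\<exists>N. \<forall>m\<ge>N. \<forall>n>m. dist (y m) (y n) < e"
      by (auto simp: dist_norm intro!: exI[of _ N])
  qed
  then obtain z where z: "y \<longlonglongrightarrow> z"
    by (auto simp: Cauchy_convergent_iff convergent_def)
  have "(\<lambda>m. norm (u - y m)) \<longlonglongrightarrow> norm (u - z)"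
    by (intro tendsto_intros z)
  with lim_d have norm_z: "norm (u - z) = d"
    by (metis LIMSEQ_unique)
  have z_min: "d\<^sup>2 \<le> (norm (u - z - x))\<^sup>2" if "x \<in> M" for x
  proof -
    have "(\<lambda>m. norm (u - (y m + x))) \<longlonglongrightarrow> norm (u - (z + x))"
      by (intro tendsto_intros z)
    then have "d \<le> norm (u - (z + x))"
      by (rule tendsto_lowerbound)
         (auto intro!: always_eventually d_le l2.subspace_add[OF M] y that)
    then show ?thesis
      using \<open>d \<ge> 0\<close> by (intro power_mono) (simp_all add: diff_diff_eq)
  qed
  have Re0: "inner x (u - z) = 0" if "x \<in> M" for x
  proof (cases "x = 0")
    case False
    \<comment> \<open>the minimiser of \<open>norm (u - z - t *\<^sub>R x)\<close>\<close>
    define t where "t = inner x (u - z) / inner x x"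
    have "d\<^sup>2 \<le> (norm (u - z - t *\<^sub>R x))\<^sup>2"
      by (intro z_min M_scaleR that)
    also have "\<dots> = (norm (u - z))\<^sup>2 - 2 * t * inner x (u - z) + t * (t * inner x x)"
      unfolding power2_norm_eq_inner
      by (simp add: inner_diff_left inner_diff_right inner_commute algebra_simps)
    also have "t * inner x x = inner x (u - z)"
      using False by (simp add: t_def)
    finally have "t * inner x (u - z) \<le> 0"
      by (simp add: norm_z)
    then have "(inner x (u - z))\<^sup>2 / inner x x \<le> 0"
      by (simp add: t_def power2_eq_square)
    moreover have "inner x x > 0" using False by simp
    ultimately show ?thesis
      by (simp add: divide_le_0_iff)
  qed simp
  have "u - z = 0"
  proof (rule total)
    fix x assume "x \<in> M"
    with Re0[of x] Re0[of "l2_scale \<i> x"] show "l2_inner x (u - z) = 0"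
      by (simp add: inner_l2_def l2_inner_simps complex_eq_iff l2.subspace_scale[OF M])
  qed
  with z y(1) show ?thesis
    by (auto simp: closure_sequential intro!: exI[of _ y])
qed

definition total :: "('i \<Rightarrow> 'n::finite l2) \<Rightarrow> bool" where
  "total x \<longleftrightarrow> (\<forall>w. (\<forall>i. l2_inner (x i) w = 0) \<longrightarrow> w = 0)"

definition unitary :: "('n::finite l2 \<Rightarrow> 'n l2) \<Rightarrow> bool" where
  "unitary U \<longleftrightarrow> l2_linear U \<and> bij U \<and> (\<forall>u v. l2_inner (U u) (U v) = l2_inner u v)"

text \<open>
  Finite combinations of the two families with the same coefficients. This is a relation because the
  members of the first family may be linearly dependent; that it is single-valued comes out of the
  equality of the Gram matrices.
\<close>

inductive matched_sums :: "('i \<Rightarrow> 'n::finite l2) \<Rightarrow> ('i \<Rightarrow> 'n l2) \<Rightarrow> 'n l2 \<Rightarrow> 'n l2 \<Rightarrow> bool" for x y where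
  zero: "matched_sums x y 0 0"
| add: "matched_sums x y u v \<Longrightarrow> matched_sums x y (u + l2_scale c (x i)) (v + l2_scale c (y i))"

lemma matched_sums_swap: "matched_sums x y u v \<Longrightarrow> matched_sums y x v u"
  by (induction rule: matched_sums.induct) (auto intro: matched_sums.intros)

lemma matched_sums_plus:
  "matched_sums x y u' v' \<Longrightarrow> matched_sums x y u v \<Longrightarrow> matched_sums x y (u + u') (v + v')"
  by (induction rule: matched_sums.induct) (auto simp: add.assoc[symmetric] intro: matched_sums.intros)

lemma matched_sums_scale:
  "matched_sums x y u v \<Longrightarrow> matched_sums x y (l2_scale c u) (l2_scale c v)"
  by (induction rule: matched_sums.induct)
     (auto simp: l2.scale_right_distrib intro: matched_sums.intros)

lemma matched_sums_base: "matched_sums x y (x i) (y i)"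
  using matched_sums.add[OF matched_sums.zero, of x y 1 i] by simp

lemma matched_sums_inner:
  assumes gram: "\<And>i j. l2_inner (x i) (x j) = l2_inner (y i) (y j)"
    and "matched_sums x y u v" "matched_sums x y u' v'"
  shows "l2_inner u u' = l2_inner v v'"
proof -
  have *: "l2_inner (x i) u' = l2_inner (y i) v'" for i
    using assms(3) by (induction rule: matched_sums.induct) (simp_all add: l2_inner_simps gram)
  show ?thesis
    using assms(2) by (induction rule: matched_sums.induct) (simp_all add: l2_inner_simps *)
qed

definition matched_limits :: "('i \<Rightarrow> 'n::finite l2) \<Rightarrow> ('i \<Rightarrow> 'n l2) \<Rightarrow> 'n l2 \<Rightarrow> 'n l2 \<Rightarrow> bool" where
  "matched_limits x y u v \<longleftrightarrow> (\<exists>U V. (\<forall>m. matched_sums x y (U m) (V m)) \<and> U \<longlonglongrightarrow> u \<and> V \<longlonglongrightarrow> v)"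

lemma matched_limits_swap: "matched_limits x y u v \<Longrightarrow> matched_limits y x v u"
  unfolding matched_limits_def using matched_sums_swap by metis

lemma matched_limits_plus:
  "matched_limits x y u v \<Longrightarrow> matched_limits x y u' v' \<Longrightarrow> matched_limits x y (u + u') (v + v')"
proof -
  assume "matched_limits x y u v" "matched_limits x y u' v'"
  then obtain U V U' V' where "\<And>m. matched_sums x y (U m) (V m)" "U \<longlonglongrightarrow> u" "V \<longlonglongrightarrow> v"
    "\<And>m. matched_sums x y (U' m) (V' m)" "U' \<longlonglongrightarrow> u'" "V' \<longlonglongrightarrow> v'"
    unfolding matched_limits_def by metis
  then show ?thesis
    unfolding matched_limits_def
    by (intro exI[of _ "\<lambda>m. U m + U' m"] exI[of _ "\<lambda>m. V m + V' m"])
       (auto intro: matched_sums_plus tendsto_add)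
qed

lemma matched_limits_scale:
  "matched_limits x y u v \<Longrightarrow> matched_limits x y (l2_scale c u) (l2_scale c v)"
proof -
  assume "matched_limits x y u v"
  then obtain U V where "\<And>m. matched_sums x y (U m) (V m)" "U \<longlonglongrightarrow> u" "V \<longlonglongrightarrow> v"
    unfolding matched_limits_def by metis
  then show ?thesis
    unfolding matched_limits_def
    by (intro exI[of _ "\<lambda>m. l2_scale c (U m)"] exI[of _ "\<lambda>m. l2_scale c (V m)"])
       (auto intro: matched_sums_scale tendsto_l2_scale)
qed

lemma matched_limits_base: "matched_limits x y (x i) (y i)"
  unfolding matched_limits_def
  by (rule exI[of _ "\<lambda>_. x i"], rule exI[of _ "\<lambda>_. y i"]) (simp add: matched_sums_base)

lemma matched_limits_inner:
  assumes gram: "\<And>i j. l2_inner (x i) (x j) = l2_inner (y i) (y j)"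
    and uv: "matched_limits x y u v" "matched_limits x y u' v'"
  shows "l2_inner u u' = l2_inner v v'"
proof -
  from uv(1) obtain U V where 1: "\<And>m. matched_sums x y (U m) (V m)" "U \<longlonglongrightarrow> u" "V \<longlonglongrightarrow> v"
    by (auto simp: matched_limits_def)
  from uv(2) obtain U' V' where 2: "\<And>m. matched_sums x y (U' m) (V' m)" "U' \<longlonglongrightarrow> u'" "V' \<longlonglongrightarrow> v'"
    by (auto simp: matched_limits_def)
  have "(\<lambda>m. l2_inner (U m) (U' m)) \<longlonglongrightarrow> l2_inner u u'"
    by (rule tendsto_l2_inner[OF 1(2) 2(2)])
  moreover have "(\<lambda>m. l2_inner (V m) (V' m)) \<longlonglongrightarrow> l2_inner v v'"
    by (rule tendsto_l2_inner[OF 1(3) 2(3)])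
  ultimately show ?thesis
    using matched_sums_inner[OF gram 1(1) 2(1)] by (simp add: LIMSEQ_unique)
qed

text \<open>
  A vector is a limit of combinations of the total family \<open>x\<close>. The matched combinations of \<open>y\<close> have
  the same mutual distances and so converge as well.
\<close>

lemma matched_limits_total:
  assumes gram: "\<And>i j. l2_inner (x i) (x j) = l2_inner (y i) (y j)"
    and total: "total x"
  shows "\<exists>v. matched_limits x y u v"
proof -
  let ?M = "{u. \<exists>v. matched_sums x y u v}"
  have M: "l2.subspace ?M"
    by (rule l2.subspaceI) (auto intro: matched_sums.zero matched_sums_scale matched_sums_plus)
  have "u \<in> closure ?M"
  proof (rule l2_dense_if_total[OF M])
    fix w assume "\<And>z. z \<in> ?M \<Longrightarrow> l2_inner z w = 0"
    then have "l2_inner (x i) w = 0" for i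
      using matched_sums_base[of x y i] by blast
    then show "w = 0" using total by (simp add: total_def)
  qed
  then obtain U where "\<And>m. U m \<in> ?M" and U: "U \<longlonglongrightarrow> u"
    by (auto simp: closure_sequential)
  then obtain V where UV: "\<And>m. matched_sums x y (U m) (V m)"
    by simp metis
  have d: "norm (V i - V j) = norm (U i - U j)" for i j
  proof -
    have "matched_sums x y (U i - U j) (V i - V j)"
      using matched_sums_plus[OF matched_sums_scale[OF UV[of j], of "-1"] UV[of i]] by simp
    from matched_sums_inner[OF gram this this] show ?thesis
      by (simp add: norm_eq_sqrt_inner inner_l2_def)
  qed
  have "Cauchy V"
    using LIMSEQ_imp_Cauchy[OF U] by (simp add: Cauchy_iff d)
  then obtain v where "V \<longlonglongrightarrow> v"
    by (auto simp: Cauchy_convergent_iff convergent_def)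
  with U UV show ?thesis
    by (auto simp: matched_limits_def)
qed

text \<open>
  With equal Gram matrices the correspondence of combinations preserves inner products in both
  directions. Its closure is the graph of the unitary: totality of the one family gives its
  domain, totality of the other its range.
\<close>

theorem unitary_of_equal_gram:
  fixes x y :: "'i \<Rightarrow> 'n::finite l2"
  assumes gram: "\<And>i j. l2_inner (x i) (x j) = l2_inner (y i) (y j)"
    and total: "total x" "total y"
  obtains U where "unitary U" "\<And>i. U (x i) = y i"
proof -
  have gram': "l2_inner (y i) (y j) = l2_inner (x i) (x j)" for i j
    by (simp add: gram)
  obtain U where U: "\<And>u. matched_limits x y u (U u)"
    using matched_limits_total[OF gram total(1)] by metis
  have unique: "v = v'" if "matched_limits x y u v" "matched_limits x y u v'" for u v v'
  proof -
    have "matched_limits x y 0 (v - v')"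
      using matched_limits_plus[OF that(1) matched_limits_scale[OF that(2), of "-1"]] by simp
    from matched_limits_inner[OF gram this this] show ?thesis
      by (simp add: l2_inner_self_eq_0)
  qed
  have unique': "u = u'" if "matched_limits x y u v" "matched_limits x y u' v" for u u' v
  proof -
    have "matched_limits x y (u - u') 0"
      using matched_limits_plus[OF that(1) matched_limits_scale[OF that(2), of "-1"]] by simp
    from matched_limits_inner[OF gram this this] show ?thesis
      by (simp add: l2_inner_self_eq_0)
  qed
  have "l2_linear U"
  proof
    show "U (u + v) = U u + U v" for u v
      by (rule unique[OF U matched_limits_plus[OF U U]])
    show "U (l2_scale c u) = l2_scale c (U u)" for c u
      by (rule unique[OF U matched_limits_scale[OF U]])
  qed
  moreover have "bij U"
  proof (rule bijI)
    show "inj U"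
      using unique' U by (metis injI)
    have "\<exists>u. matched_limits x y u v" for v
      using matched_limits_total[OF gram' total(2), of v] matched_limits_swap by metis
    then show "surj U"
      using unique U by (metis surjI)
  qed
  moreover have "l2_inner (U u) (U v) = l2_inner u v" for u v
    by (rule matched_limits_inner[OF gram U U, symmetric])
  ultimately have "unitary U"
    by (simp add: unitary_def)
  moreover have "U (x i) = y i" for i
    by (rule unique[OF U matched_limits_base])
  ultimately show ?thesis by (rule that)
qed


section \<open>Injectivity of the Fourier transform\<close>

text \<open>
  The positive and the negative part of \<open>h\<close> have the same integral \<open>c\<close>.
  Divided by \<open>c\<close> they are probability densities under which \<open>X\<close> has the
  same characteristic function, so that Levy's uniqueness theorem applies.
\<close>

lemma fourier_indicator_zero_real:
  fixes h :: "'a \<Rightarrow> real" and X :: "'a \<Rightarrow> real"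
  assumes h: "integrable M h" and [measurable]: "X \<in> borel_measurable M"
    and zero: "\<And>s. (\<integral>x. of_real (h x) * iexp (s * X x) \<partial>M) = 0"
    and B: "B \<in> sets borel"
  shows "(\<integral>x. indicator B (X x) * h x \<partial>M) = 0"
proof -
  define p where "p x = max 0 (h x)" for x
  define q where "q x = max 0 (- h x)" for x
  have [measurable]: "h \<in> borel_measurable M" using h by simp
  have [simp]: "p x \<ge> 0" "q x \<ge> 0" for x by (simp_all add: p_def q_def)
  have pq: "h x = p x - q x" for x by (simp add: p_def q_def)
  have p: "integrable M p" and q: "integrable M q"
    unfolding p_def q_def by (intro integrable_max integrable_zero h integrable_minus)+
  define c where "c = (\<integral>x. p x \<partial>M)"
  have "(\<integral>x. complex_of_real (h x) \<partial>M) = 0"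
    using zero[of 0] by simp
  then have "(\<integral>x. h x \<partial>M) = 0" by simp
  then have cq: "c = (\<integral>x. q x \<partial>M)"
    by (simp add: pq p q c_def)
  show ?thesis
  proof (cases "c = 0")
    case True
    then have "AE x in M. p x = 0" "AE x in M. q x = 0"
      using integral_nonneg_eq_0_iff_AE[OF p] integral_nonneg_eq_0_iff_AE[OF q] cq
      by (simp_all add: c_def)
    then have "AE x in M. indicator B (X x) * h x = 0"
      by eventually_elim (simp add: pq)
    then show ?thesis
      by (rule integral_eq_zero_AE)
  next
    case False
    then have c: "c > 0"
      by (simp add: c_def less_le integral_nonneg)
    define law where "law f = distr (density M (\<lambda>x. ennreal (f x / c))) borel X" for f
    have law: "real_distribution (law f)"
      if f: "integrable M f" "\<And>x. f x \<ge> 0" "(\<integral>x. f x \<partial>M) = c" for f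
    proof -
      have [measurable]: "f \<in> borel_measurable M" using f(1) by simp
      have "(\<integral>\<^sup>+ x. ennreal (f x / c) \<partial>M) = ennreal (\<integral>x. f x / c \<partial>M)"
        using f c by (intro nn_integral_eq_integral) auto
      also have "\<dots> = 1" using f(3) c by simp
      finally have "prob_space (density M (\<lambda>x. ennreal (f x / c)))"
        by (intro prob_spaceI) (simp add: emeasure_density cong: nn_integral_cong)
      then have "prob_space (law f)"
        unfolding law_def by (rule prob_space.prob_space_distr) measurable
      then show ?thesis
        by (simp add: real_distribution_def real_distribution_axioms_def law_def)
    qed
    have integral_law: "(\<integral>t. \<phi> t \<partial>law f) = (\<integral>x. (f x / c) *\<^sub>R \<phi> (X x) \<partial>M)"
      if f: "integrable M f" "\<And>x. f x \<ge> 0" and [measurable]: "\<phi> \<in> borel_measurable borel"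
      for f and \<phi> :: "real \<Rightarrow> complex"
    proof -
      have [measurable]: "f \<in> borel_measurable M" using f(1) by simp
      show ?thesis
        unfolding law_def using f c by (subst integral_distr, simp, simp, subst integral_density) auto
    qed
    have [measurable]: "(\<lambda>t. iexp (s * t)) \<in> borel_measurable borel" for s
      by (intro borel_measurable_continuous_onI continuous_intros)
    have iexp_int: "integrable M (\<lambda>x. (f x / c) *\<^sub>R iexp (s * X x))" if "integrable M f" for f s
    proof (rule Bochner_Integration.integrable_bound[where f = "\<lambda>x. f x / c"])
      show "(\<lambda>x. (f x / c) *\<^sub>R iexp (s * X x)) \<in> borel_measurable M"
        using borel_measurable_integrable[OF that] by measurable
    qed (use that in auto)
    have "char (law p) s = char (law q) s" for s
    proof -
      have "char (law p) s - char (law q) s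
          = (\<integral>x. (p x / c) *\<^sub>R iexp (s * X x) \<partial>M) - (\<integral>x. (q x / c) *\<^sub>R iexp (s * X x) \<partial>M)"
        unfolding char_def by (simp add: integral_law p q)
      also have "\<dots> = (\<integral>x. of_real (1 / c) * (of_real (h x) * iexp (s * X x)) \<partial>M)"
        unfolding Bochner_Integration.integral_diff[symmetric, OF iexp_int[OF p] iexp_int[OF q]]
        by (rule Bochner_Integration.integral_cong)
           (simp_all add: pq scaleR_conv_of_real diff_divide_distrib left_diff_distrib)
      also have "\<dots> = 0"
        unfolding integral_mult_right_zero zero by simp
      finally show ?thesis by simp
    qed
    then have "law p = law q"
      by (intro Levy_uniqueness law p q) (simp_all add: c_def[symmetric] cq[symmetric] fun_eq_iff)
    then have "(\<integral>t. complex_of_real (indicator B t) \<partial>law p) = (\<integral>t. complex_of_real (indicator B t) \<partial>law q)"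
      by simp
    then have "(\<integral>x. complex_of_real (p x / c * indicator B (X x)) \<partial>M)
        = (\<integral>x. complex_of_real (q x / c * indicator B (X x)) \<partial>M)"
      by (subst (asm) (1 2) integral_law) (use B in \<open>auto simp: p q scaleR_conv_of_real\<close>)
    then have "(\<integral>x. p x / c * indicator B (X x) \<partial>M) = (\<integral>x. q x / c * indicator B (X x) \<partial>M)"
      unfolding integral_complex_of_real of_real_eq_iff .
    then have eq: "(\<integral>x. indicator B (X x) * p x \<partial>M) = (\<integral>x. indicator B (X x) * q x \<partial>M)"
      using c by (simp add: mult.commute)
    have "integrable M (\<lambda>x. indicator B (X x) * f x)" if "integrable M f" for f :: "'a \<Rightarrow> real"
      by (rule Bochner_Integration.integrable_bound[OF that])
         (use borel_measurable_integrable[OF that] B in \<open>auto simp: indicator_def\<close>)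
    then show ?thesis
      using eq by (simp add: pq right_diff_distrib p q)
  qed
qed

text \<open>
  The Fourier integrals of \<open>cnj \<circ> h\<close> are conjugates of those of
  \<open>h\<close> at the opposite frequency, so the real part of \<open>h\<close> satisfies the
  hypothesis too.
\<close>

lemma fourier_indicator_zero_Re:
  fixes h :: "'a \<Rightarrow> complex" and X :: "'a \<Rightarrow> real"
  assumes h: "integrable M h" and [measurable]: "X \<in> borel_measurable M"
    and zero: "\<And>s. (\<integral>x. h x * iexp (s * X x) \<partial>M) = 0"
    and B: "B \<in> sets borel"
  shows "(\<integral>x. indicator B (X x) * Re (h x) \<partial>M) = 0"
proof (rule fourier_indicator_zero_real[OF _ _ _ B])
  have [measurable]: "(\<lambda>t. iexp (s * t)) \<in> borel_measurable borel" for s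
    by (intro borel_measurable_continuous_onI continuous_intros)
  have i: "integrable M (\<lambda>x. f x * iexp (s * X x))" if "integrable M f" for f :: "'a \<Rightarrow> complex" and s
  proof (rule Bochner_Integration.integrable_bound[OF that])
    show "(\<lambda>x. f x * iexp (s * X x)) \<in> borel_measurable M"
      using borel_measurable_integrable[OF that] by measurable
  qed (simp add: norm_mult)
  fix s
  have "(\<integral>x. cnj (h x) * iexp (s * X x) \<partial>M) = (\<integral>x. cnj (h x * iexp (- s * X x)) \<partial>M)"
    by (rule Bochner_Integration.integral_cong) (auto simp: exp_cnj)
  also have "\<dots> = 0"
    unfolding Bochner_Integration.integral_cnj zero by simp
  finally have cnj_zero: "(\<integral>x. cnj (h x) * iexp (s * X x) \<partial>M) = 0" .
  have "(\<integral>x. of_real (Re (h x)) * iexp (s * X x) \<partial>M)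
      = (\<integral>x. (h x * iexp (s * X x) + cnj (h x) * iexp (s * X x)) / 2 \<partial>M)"
    by (rule Bochner_Integration.integral_cong)
       (simp_all add: complex_add_cnj flip: distrib_right)
  also have "\<dots> = ((\<integral>x. h x * iexp (s * X x) \<partial>M) + (\<integral>x. cnj (h x) * iexp (s * X x) \<partial>M)) / 2"
    unfolding integral_divide_zero
    by (subst Bochner_Integration.integral_add) (intro i h, intro i integrable_cnj h, rule refl)
  also have "\<dots> = 0"
    unfolding zero cnj_zero by simp
  finally show "(\<integral>x. of_real (Re (h x)) * iexp (s * X x) \<partial>M) = 0" .
qed (use h in auto)

lemma fourier_indicator_zero:
  fixes h :: "'a \<Rightarrow> complex" and X :: "'a \<Rightarrow> real"
  assumes h: "integrable M h" and X [measurable]: "X \<in> borel_measurable M"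
    and zero: "\<And>s. (\<integral>x. h x * iexp (s * X x) \<partial>M) = 0"
    and B [measurable]: "B \<in> sets borel"
  shows "(\<integral>x. indicator B (X x) * h x \<partial>M) = 0"
proof -
  have [measurable]: "h \<in> borel_measurable M" using h by simp
  have "(\<integral>x. - \<i> * h x * iexp (s * X x) \<partial>M) = 0" for s
    unfolding mult.assoc integral_mult_right_zero zero by simp
  from fourier_indicator_zero_Re[OF _ X this B]
  have "(\<integral>x. indicator B (X x) * Im (h x) \<partial>M) = 0"
    using h by simp
  moreover have "(\<integral>x. indicator B (X x) * Re (h x) \<partial>M) = 0"
    by (rule fourier_indicator_zero_Re[OF h X zero B])
  moreover have "integrable M (\<lambda>x. indicator B (X x) * h x)"
    by (rule Bochner_Integration.integrable_bound[OF h]) (auto simp: indicator_def)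
  moreover have "Re (indicator B t * z) = indicator B t * Re z" "Im (indicator B t * z) = indicator B t * Im z"
    for t z by (simp_all add: indicator_def)
  ultimately show ?thesis
    by (simp only: complex_eq_iff flip: integral_Re integral_Im) simp
qed

text \<open>
  One coordinate is treated at a time: restricting \<open>h\<close> to an interval in that
  coordinate keeps all its Fourier integrals zero.
\<close>

lemma fourier_boxes_zero:
  fixes h :: "real^'n \<Rightarrow> complex"
  assumes h: "integrable lborel h"
    and zero: "\<And>b. (\<integral>a. h a * iexp (b \<bullet> a) \<partial>lborel) = 0"
  shows "(\<integral>a. indicator (box l u) a * h a \<partial>lborel) = 0"
proof -
  have [measurable]: "h \<in> borel_measurable borel"
    using h by auto
  define S where "S J = {a :: real^'n. \<forall>j\<in>J. a $ j \<in> {l $ j<..<u $ j}}" for J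
  have [measurable]: "S J \<in> sets borel" for J
  proof -
    have "S J = (\<Inter>j\<in>J. {a. l $ j < a $ j \<and> a $ j < u $ j})"
      by (auto simp: S_def)
    also have "\<dots> \<in> sets borel"
      by (intro borel_open open_INT ballI) (auto intro!: open_Collect_conj open_Collect_less continuous_intros)
    finally show ?thesis .
  qed
  have [measurable]: "(\<lambda>a :: real^'n. iexp (b \<bullet> a)) \<in> borel_measurable borel" for b
    by (intro borel_measurable_continuous_onI continuous_intros)
  have "(\<integral>a. (indicator (S J) a * h a) * iexp (b \<bullet> a) \<partial>lborel) = 0" if "finite J" for J b
    using that
  proof (induction J arbitrary: b)
    case empty
    then show ?case using zero by (simp add: S_def)
  next
    case (insert k J)
    define f where "f a = (indicator (S J) a * h a) * iexp (b \<bullet> a)" for a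
    have [measurable]: "f \<in> borel_measurable borel"
      unfolding f_def by measurable
    have "(\<integral>a. indicator {l $ k<..<u $ k} (a $ k) * f a \<partial>lborel) = 0"
    proof (rule fourier_indicator_zero)
      show "integrable lborel f"
        by (rule Bochner_Integration.integrable_bound[OF h])
           (auto simp: f_def norm_mult indicator_def)
      fix s
      have "(\<integral>a. f a * iexp (s * a $ k) \<partial>lborel)
          = (\<integral>a. (indicator (S J) a * h a) * iexp ((b + s *\<^sub>R axis k 1) \<bullet> a) \<partial>lborel)"
        by (rule Bochner_Integration.integral_cong)
           (simp_all add: f_def inner_add_left inner_axis' distrib_left exp_add)
      also have "\<dots> = 0" by (rule insert.IH)
      finally show "(\<integral>a. f a * iexp (s * a $ k) \<partial>lborel) = 0" .
    qed auto
    moreover have "indicator {l $ k<..<u $ k} (a $ k) * f a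
        = (indicator (S (insert k J)) a * h a) * iexp (b \<bullet> a)" for a
      by (simp add: f_def S_def indicator_def)
    ultimately show ?case by simp
  qed
  from this[of UNIV 0] show ?thesis
    by (simp add: S_def box_def) (simp add: Basis_vec_def inner_axis indicator_def box_def cong: if_cong)
qed

text \<open>
  The positive and the negative part of \<open>h\<close> are densities of finite measures that
  agree on boxes, which form a generator of the Borel sets closed under intersection.
\<close>

lemma AE_zero_if_integral_boxes_zero_real:
  fixes h :: "real^'n \<Rightarrow> real"
  assumes h: "integrable lborel h"
    and zero: "\<And>l u. (\<integral>a. indicator (box l u) a * h a \<partial>lborel) = 0"
  shows "AE a in lborel. h a = 0"
proof -
  have [measurable]: "h \<in> borel_measurable borel"
    using h by auto
  define p where "p x = max 0 (h x)" for x
  define q where "q x = max 0 (- h x)" for x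
  have p: "integrable lborel p" and q: "integrable lborel q"
    unfolding p_def q_def by (intro integrable_max integrable_zero h integrable_minus)+
  have pq: "h x = p x - q x" "p x \<ge> 0" "q x \<ge> 0" for x by (simp_all add: p_def q_def)
  have [measurable]: "p \<in> borel_measurable borel" "q \<in> borel_measurable borel"
    using p q by auto
  have part: "emeasure (density lborel (\<lambda>a. ennreal (f a))) A = ennreal (\<integral>a. indicator A a * f a \<partial>lborel)"
    if "integrable lborel f" "\<And>a. f a \<ge> 0" "A \<in> sets borel" for f :: "real^'n \<Rightarrow> real" and A
  proof -
    have i: "integrable lborel (\<lambda>a. indicator A a * f a)"
      by (rule Bochner_Integration.integrable_bound[OF that(1)])
         (use that borel_measurable_integrable[OF that(1)] in \<open>auto simp: indicator_def\<close>)
    have "emeasure (density lborel (\<lambda>a. ennreal (f a))) A = (\<integral>\<^sup>+a. ennreal (indicator A a * f a) \<partial>lborel)"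
      using that borel_measurable_integrable[OF that(1)]
      by (subst emeasure_density) (auto intro!: nn_integral_cong simp: indicator_def)
    also have "\<dots> = ennreal (\<integral>a. indicator A a * f a \<partial>lborel)"
      by (rule nn_integral_eq_integral[OF i]) (use that in auto)
    finally show ?thesis .
  qed
  have "density lborel (\<lambda>a. ennreal (p a)) = density lborel (\<lambda>a. ennreal (q a))" (is "?P = ?Q")
  proof (rule measure_eqI_generator_eq)
    let ?E = "range (\<lambda>(a, b). box a b :: (real^'n) set)"
    show "Int_stable ?E"
      by (auto simp: Int_stable_def box_Int_box)
    show "?E \<subseteq> Pow UNIV" "sets ?P = sigma_sets UNIV ?E" "sets ?Q = sigma_sets UNIV ?E"
      by (simp_all add: borel_eq_box)
    let ?A = "\<lambda>n::nat. box (- (real n *\<^sub>R One)) (real n *\<^sub>R One) :: (real^'n) set"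
    show "range ?A \<subseteq> ?E" "(\<Union>i. ?A i) = UNIV"
      unfolding UN_box_eq_UNIV by auto
    show "emeasure ?P (?A i) \<noteq> \<infinity>" for i
      by (subst part) (auto simp: p pq)
    fix X assume "X \<in> ?E"
    then obtain l u where X: "X = box l u" by auto
    have i: "integrable lborel (\<lambda>a. indicator (box l u) a * f a)" if "integrable lborel f"
      for f :: "real^'n \<Rightarrow> real"
      by (rule Bochner_Integration.integrable_bound[OF that])
         (use borel_measurable_integrable[OF that] in \<open>auto simp: indicator_def\<close>)
    have "(\<integral>a. indicator (box l u) a * p a \<partial>lborel) = (\<integral>a. indicator (box l u) a * q a \<partial>lborel)"
      using zero[of l u] by (simp add: pq right_diff_distrib i p q)
    then show "emeasure ?P X = emeasure ?Q X"
      by (simp add: X part p q pq)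
  qed
  then have "AE a in lborel. ennreal (p a) = ennreal (q a)"
    by (subst (asm) finite_density_unique) (use p in \<open>auto simp: nn_integral_eq_integral pq\<close>)
  then show ?thesis
    by eventually_elim (simp add: pq)
qed

theorem fourier_injective:
  fixes h :: "real^'n \<Rightarrow> complex"
  assumes h: "integrable lborel h"
    and zero: "\<And>b. (\<integral>a. h a * iexp (b \<bullet> a) \<partial>lborel) = 0"
  shows "AE a in lborel. h a = 0"
proof -
  have i: "integrable lborel (\<lambda>a. indicator (box l u) a * h a)" for l u
    by (rule Bochner_Integration.integrable_bound[OF h])
       (use borel_measurable_integrable[OF h] in \<open>auto simp: indicator_def\<close>)
  have "Re (\<integral>a. indicator (box l u) a * h a \<partial>lborel) = 0" "Im (\<integral>a. indicator (box l u) a * h a \<partial>lborel) = 0" for l u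
    using fourier_boxes_zero[OF assms, of l u] by simp_all
  then have "(\<integral>a. Re (indicator (box l u) a * h a) \<partial>lborel) = 0" "(\<integral>a. Im (indicator (box l u) a * h a) \<partial>lborel) = 0" for l u
    using i by (simp_all only: integral_Re integral_Im)
  moreover have "Re (indicator A a * h a) = indicator A a * Re (h a)"
      "Im (indicator A a * h a) = indicator A a * Im (h a)" for A a
    by (simp_all add: indicator_def)
  ultimately have "AE a in lborel. Re (h a) = 0" "AE a in lborel. Im (h a) = 0"
    using h by (auto intro!: AE_zero_if_integral_boxes_zero_real)
  then show ?thesis
    by eventually_elim (simp add: complex_eq_iff)
qed


section \<open>Integration along the fibres of a coordinate\<close>

lemma nn_integral_lborel_shift:
  fixes f :: "'a::euclidean_space \<Rightarrow> ennreal"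
  assumes [measurable]: "f \<in> borel_measurable borel"
  shows "(\<integral>\<^sup>+a. f (a + c) \<partial>lborel) = (\<integral>\<^sup>+a. f a \<partial>lborel)"
proof -
  have "(\<integral>\<^sup>+a. f a \<partial>lborel) = (\<integral>\<^sup>+a. f a \<partial>distr lborel borel ((+) c))"
    by (simp add: lborel_distr_plus)
  also have "\<dots> = (\<integral>\<^sup>+a. f (a + c) \<partial>lborel)"
    by (subst nn_integral_distr) (simp_all add: add.commute)
  finally show ?thesis by simp
qed

lemma measurable_vec_nth [measurable (raw)]:
  fixes f :: "'a \<Rightarrow> real^'n"
  assumes "f \<in> borel_measurable M"
  shows "(\<lambda>x. f x $ k) \<in> borel_measurable M"
  using measurable_compose[OF assms borel_measurable_continuous_onI[OF continuous_on_component[OF continuous_on_id]]]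
  by simp

lemma measurable_lborel_pair: "measurable (lborel \<Otimes>\<^sub>M lborel) N = measurable (borel \<Otimes>\<^sub>M borel) N"
  by (intro measurable_cong_sets sets_pair_measure_cong sets_lborel refl)

text \<open>
  Fubini's theorem for the lines parallel to the axis \<open>k\<close>, without a splitting of the
  space into a product: every line is run through from each of its points in the slab \<open>0
  \<le> a $ k < 1\<close>, and these points have total length 1.
\<close>

lemma nn_integral_fibres:
  fixes f :: "real^'n \<Rightarrow> ennreal"
  assumes f [measurable]: "f \<in> borel_measurable borel"
  shows "(\<integral>\<^sup>+a. indicator {0..<1} (a $ k) * (\<integral>\<^sup>+t. f (a + t *\<^sub>R axis k 1) \<partial>lborel) \<partial>lborel)
    = (\<integral>\<^sup>+a. f a \<partial>lborel)"
proof -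
  have "(\<integral>\<^sup>+a. indicator {0..<1} (a $ k) * (\<integral>\<^sup>+t. f (a + t *\<^sub>R axis k 1) \<partial>lborel) \<partial>lborel)
      = (\<integral>\<^sup>+a. (\<integral>\<^sup>+t. indicator {0..<1} (a $ k) * f (a + t *\<^sub>R axis k 1) \<partial>lborel) \<partial>lborel)"
    by (intro nn_integral_cong nn_integral_cmult[symmetric]) measurable
  also have "\<dots> = (\<integral>\<^sup>+t. (\<integral>\<^sup>+a. indicator {0..<1} (a $ k) * f (a + t *\<^sub>R axis k 1) \<partial>lborel) \<partial>lborel)"
    by (rule lborel_pair.Fubini') (unfold measurable_lborel_pair, measurable)
  also have "\<dots> = (\<integral>\<^sup>+t. (\<integral>\<^sup>+a. indicator {0..<1} (a $ k - t) * f a \<partial>lborel) \<partial>lborel)"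
  proof (rule nn_integral_cong)
    fix t
    have "(\<integral>\<^sup>+a. indicator {0..<1} ((a + t *\<^sub>R axis k 1) $ k - t) * f (a + t *\<^sub>R axis k 1) \<partial>lborel)
        = (\<integral>\<^sup>+a. indicator {0..<1} (a $ k - t) * f a \<partial>lborel)"
      by (rule nn_integral_lborel_shift) measurable
    then show "(\<integral>\<^sup>+a. indicator {0..<1} (a $ k) * f (a + t *\<^sub>R axis k 1) \<partial>lborel)
        = (\<integral>\<^sup>+a. indicator {0..<1} (a $ k - t) * f a \<partial>lborel)"
      by (simp add: axis_def)
  qed
  also have "\<dots> = (\<integral>\<^sup>+a. (\<integral>\<^sup>+t. indicator {0..<1} (a $ k - t) * f a \<partial>lborel) \<partial>lborel)"
    by (rule lborel_pair.Fubini'[symmetric]) (unfold measurable_lborel_pair, measurable)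
  also have "\<dots> = (\<integral>\<^sup>+a. f a \<partial>lborel)"
  proof (rule nn_integral_cong)
    fix a :: "real^'n"
    have "(\<integral>\<^sup>+t. indicator {0..<1} (a $ k - t) \<partial>lborel) = (\<integral>\<^sup>+t. indicator {a $ k - 1<..a $ k} t \<partial>lborel)"
      by (rule nn_integral_cong) (auto simp: indicator_def)
    also have "\<dots> = 1"
      by simp
    finally show "(\<integral>\<^sup>+t. indicator {0..<1} (a $ k - t) * f a \<partial>lborel) = f a"
      by (subst nn_integral_multc) simp_all
  qed
  finally show ?thesis .
qed

text \<open>
  A map that reflects each line parallel to an axis, about a point that may depend on the line,
  preserves the integral over each line.
\<close>

lemma distr_lborel_eq_if_fibres_preserved:
  fixes T :: "real^'n \<Rightarrow> real^'n"
  assumes [measurable]: "T \<in> borel_measurable borel"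
    and T: "\<And>a t. a $ k = 0 \<Longrightarrow> T (a + t *\<^sub>R axis k 1) = a + (s a - t) *\<^sub>R axis k 1"
  shows "distr lborel borel T = lborel"
proof (rule measure_eqI)
  fix A assume "A \<in> sets (distr lborel borel T)"
  then have [measurable]: "A \<in> sets borel" by simp
  have fibre: "(\<integral>\<^sup>+t. f (T (a + t *\<^sub>R axis k 1)) \<partial>lborel) = (\<integral>\<^sup>+t. f (a + t *\<^sub>R axis k 1) \<partial>lborel)"
    if [measurable]: "f \<in> borel_measurable borel" for f :: "real^'n \<Rightarrow> ennreal" and a
  proof -
    \<comment> \<open>the point of the same line in the hyperplane \<open>a $ k = 0\<close>\<close>
    define a0 where "a0 = a - (a $ k) *\<^sub>R axis k 1"
    have a0: "a0 $ k = 0"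
      by (simp add: a0_def axis_def)
    have a: "a + t *\<^sub>R axis k 1 = a0 + (a $ k + t) *\<^sub>R axis k 1" for t
      by (simp add: a0_def scaleR_add_left)
    have "T (a + t *\<^sub>R axis k 1) = a + ((s a0 - 2 * a $ k) + (- 1) * t) *\<^sub>R axis k 1" for t
      unfolding a T[OF a0] by (simp add: algebra_simps)
    then show ?thesis
      using nn_integral_real_affine[of "\<lambda>t. f (a + t *\<^sub>R axis k 1)" "- 1" "s a0 - 2 * a $ k"]
      by simp
  qed
  have "emeasure (distr lborel borel T) A = (\<integral>\<^sup>+a. indicator A (T a) \<partial>lborel)"
    by (subst nn_integral_distr[of T lborel borel "indicator A", symmetric]) simp_all
  also have "\<dots> = (\<integral>\<^sup>+a. indicator {0..<1} (a $ k) * (\<integral>\<^sup>+t. indicator A (T (a + t *\<^sub>R axis k 1)) \<partial>lborel) \<partial>lborel)"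
    by (rule nn_integral_fibres[symmetric]) measurable
  also have "\<dots> = (\<integral>\<^sup>+a. indicator {0..<1} (a $ k) * (\<integral>\<^sup>+t. indicator A (a + t *\<^sub>R axis k 1) \<partial>lborel) \<partial>lborel)"
    by (subst fibre) simp_all
  also have "\<dots> = (\<integral>\<^sup>+a. indicator A a \<partial>lborel)"
    by (rule nn_integral_fibres) measurable
  finally show "emeasure (distr lborel borel T) A = emeasure lborel A"
    by simp
qed simp

text \<open>
  The map \<open>(a, t) \<mapsto> a + t *\<^sub>R axis k 1\<close> takes the product measure on
  the slab times the line to the Lebesgue measure; for complex-valued functions this is the form
  in which the preceding identity can be used.
\<close>

lemma integral_fibres:
  fixes f :: "real^'n \<Rightarrow> complex"
  assumes f: "integrable lborel f"
  shows "(\<integral>a. (\<integral>t. indicator {0..<1} (a $ k) *\<^sub>R f (a + t *\<^sub>R axis k 1) \<partial>lborel) \<partial>lborel) = (\<integral>a. f a \<partial>lborel)"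
proof -
  have [measurable]: "f \<in> borel_measurable borel"
    using f by auto
  define m where "m = density (lborel \<Otimes>\<^sub>M lborel) (\<lambda>(a, t :: real). ennreal (indicator {0..<1} ((a :: real^'n) $ k)))"
  have [measurable_cong]: "sets m = sets (borel \<Otimes>\<^sub>M borel)"
    unfolding m_def sets_density by (intro sets_pair_measure_cong sets_lborel)
  have [measurable]: "fst \<in> measurable (lborel \<Otimes>\<^sub>M lborel) (borel :: (real^'n) measure)"
    "snd \<in> measurable ((lborel :: (real^'n) measure) \<Otimes>\<^sub>M lborel) (borel :: real measure)"
    unfolding measurable_lborel_pair by measurable
  have "distr m borel (\<lambda>(a, t). a + t *\<^sub>R axis k 1) = lborel"
  proof (rule measure_eqI)
    fix A assume "A \<in> sets (distr m borel (\<lambda>(a, t). a + t *\<^sub>R axis k 1))"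
    then have [measurable]: "A \<in> sets borel" by simp
    have "emeasure (distr m borel (\<lambda>(a, t). a + t *\<^sub>R axis k 1)) A
        = (\<integral>\<^sup>+x. indicator A (fst x + snd x *\<^sub>R axis k 1) \<partial>m)"
      by (subst nn_integral_distr[of "\<lambda>x. fst x + snd x *\<^sub>R axis k 1" m borel "indicator A", symmetric])
         (simp_all add: case_prod_unfold)
    also have "\<dots> = (\<integral>\<^sup>+x. indicator {0..<1} (fst x $ k) * indicator A (fst x + snd x *\<^sub>R axis k 1) \<partial>(lborel \<Otimes>\<^sub>M lborel))"
      unfolding m_def
      by (subst nn_integral_density) (simp_all add: case_prod_unfold ennreal_indicator)
    also have "\<dots> = (\<integral>\<^sup>+a. (\<integral>\<^sup>+t. indicator {0..<1} (a $ k) * indicator A (a + t *\<^sub>R axis k 1) \<partial>lborel) \<partial>lborel)"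
    proof (subst lborel.nn_integral_fst[symmetric])
      show "(\<lambda>x. indicator {0..<1} (fst x $ k) * indicator A (fst x + snd x *\<^sub>R axis k 1) :: ennreal)
          \<in> borel_measurable ((lborel :: (real^'n) measure) \<Otimes>\<^sub>M (lborel :: real measure))"
        by measurable
    qed simp
    also have "\<dots> = (\<integral>\<^sup>+a. indicator {0..<1} (a $ k) * (\<integral>\<^sup>+t. indicator A (a + t *\<^sub>R axis k 1) \<partial>lborel) \<partial>lborel)"
      by (intro nn_integral_cong nn_integral_cmult) measurable
    also have "\<dots> = (\<integral>\<^sup>+a. indicator A a \<partial>lborel)"
      by (rule nn_integral_fibres) measurable
    finally show "emeasure (distr m borel (\<lambda>(a, t). a + t *\<^sub>R axis k 1)) A = emeasure lborel A"
      by simp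
  qed simp
  then have m: "distr m borel (\<lambda>x. fst x + snd x *\<^sub>R axis k 1) = lborel"
    by (simp only: case_prod_unfold)
  have T [measurable]: "(\<lambda>x. fst x + snd x *\<^sub>R axis k 1) \<in> measurable m (borel :: (real^'n) measure)"
    by measurable
  have "integrable m (\<lambda>x. f (fst x + snd x *\<^sub>R axis k 1))"
    using f unfolding m[symmetric] by (subst (asm) integrable_distr_eq[OF T]) simp_all
  then have i: "integrable (lborel \<Otimes>\<^sub>M lborel)
      (\<lambda>(a, t). indicator {0..<1} (a $ k) *\<^sub>R f (a + t *\<^sub>R axis k 1))"
    unfolding m_def case_prod_unfold by (subst (asm) integrable_density) simp_all
  have "(\<integral>a. f a \<partial>lborel) = (\<integral>x. f (fst x + snd x *\<^sub>R axis k 1) \<partial>m)"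
    using integral_distr[OF T, of f] by (simp add: m)
  also have "\<dots> = (\<integral>x. (case x of (a, t) \<Rightarrow> indicator {0..<1} (a $ k) *\<^sub>R f (a + t *\<^sub>R axis k 1)) \<partial>(lborel \<Otimes>\<^sub>M lborel))"
    unfolding m_def case_prod_unfold by (subst integral_density) simp_all
  also have "\<dots> = (\<integral>a. (\<integral>t. indicator {0..<1} (a $ k) *\<^sub>R f (a + t *\<^sub>R axis k 1) \<partial>lborel) \<partial>lborel)"
    using lborel_pair.integral_fst'[OF i] by simp
  finally show ?thesis by (rule sym)
qed

text \<open>
  All computations with Gaussians below are reduced to one-dimensional integrals by this
  comparison.
\<close>

lemma integral_eq_if_fibres_eq:
  fixes f g :: "real^'n \<Rightarrow> complex"
  assumes f: "integrable lborel f" and g: "integrable lborel g"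
    and eq: "\<And>a. a $ k = 0 \<Longrightarrow> (\<integral>t. f (a + t *\<^sub>R axis k 1) \<partial>lborel) = (\<integral>t. g (a + t *\<^sub>R axis k 1) \<partial>lborel)"
  shows "(\<integral>a. f a \<partial>lborel) = (\<integral>a. g a \<partial>lborel)"
proof -
  have "(\<integral>t. f (a + t *\<^sub>R axis k 1) \<partial>lborel) = (\<integral>t. g (a + t *\<^sub>R axis k 1) \<partial>lborel)" for a
  proof -
    define a0 where "a0 = a - (a $ k) *\<^sub>R axis k 1"
    have a0: "a0 $ k = 0" by (simp add: a0_def axis_def)
    have a: "a + t *\<^sub>R axis k 1 = a0 + (a $ k + 1 * t) *\<^sub>R axis k 1" for t
      by (simp add: a0_def algebra_simps)
    show ?thesis
      using eq[OF a0]
        lborel_integral_real_affine[of 1 "\<lambda>t. f (a0 + t *\<^sub>R axis k 1)" "a $ k"]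
        lborel_integral_real_affine[of 1 "\<lambda>t. g (a0 + t *\<^sub>R axis k 1)" "a $ k"]
      unfolding a by simp
  qed
  then show ?thesis
    unfolding integral_fibres[OF f, of k, symmetric] integral_fibres[OF g, of k, symmetric]
    by simp
qed

section \<open>Functions of Gaussian decay\<close>

definition gauss_decay :: "('a::real_normed_vector \<Rightarrow> complex) \<Rightarrow> bool" where
  "gauss_decay f \<longleftrightarrow> (\<exists>C e. e > 0 \<and> (\<forall>a. cmod (f a) \<le> C * exp (- e * (norm a)\<^sup>2)))"

lemma gauss_decayI:
  "e > 0 \<Longrightarrow> (\<And>a. cmod (f a) \<le> C * exp (- e * (norm a)\<^sup>2)) \<Longrightarrow> gauss_decay f"
  by (auto simp: gauss_decay_def)

lemma gauss_decayE:
  assumes "gauss_decay f"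
  obtains C e where "C \<ge> 0" "e > 0" "\<And>a. cmod (f a) \<le> C * exp (- e * (norm a)\<^sup>2)"
proof -
  obtain C e where f: "e > 0" "\<And>a. cmod (f a) \<le> C * exp (- e * (norm a)\<^sup>2)"
    using assms unfolding gauss_decay_def by blast
  have "0 \<le> C"
    using order_trans[OF norm_ge_zero f(2)[of 0]] by simp
  with f show ?thesis by (rule that[rotated])
qed

lemma integrable_exp_neg_sq: "e > 0 \<Longrightarrow> integrable lborel (\<lambda>x::real. exp (- e * x\<^sup>2))"
proof -
  assume e: "e > 0"
  have "integrable lborel (\<lambda>x. sqrt (pi / e) * normal_density 0 (1 / sqrt (2 * e)) x)"
    by (intro integrable_mult_right integrable_normal_density) (use e in simp)
  also have "(\<lambda>x. sqrt (pi / e) * normal_density 0 (1 / sqrt (2 * e)) x) = (\<lambda>x. exp (- e * x\<^sup>2))"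
    using e by (simp add: normal_density_def fun_eq_iff power_divide real_sqrt_divide)
  finally show ?thesis .
qed

lemma integrable_exp_neg_norm_sq:
  assumes e: "e > 0"
  shows "integrable lborel (\<lambda>a::'a::euclidean_space. exp (- e * (norm a)\<^sup>2))"
proof (rule integrableI_nonneg)
  have "(\<integral>\<^sup>+(a::'a). ennreal (exp (- e * (norm a)\<^sup>2)) \<partial>lborel)
      = (\<integral>\<^sup>+(a::'a). (\<Prod>b\<in>Basis. ennreal (exp (- e * (a \<bullet> b)\<^sup>2))) \<partial>lborel)"
  proof (rule nn_integral_cong)
    fix a :: 'a
    have "(norm a)\<^sup>2 = (\<Sum>b\<in>Basis. (a \<bullet> b)\<^sup>2)"
      by (subst power2_norm_eq_inner, subst euclidean_inner) (simp add: power2_eq_square)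
    then show "ennreal (exp (- e * (norm a)\<^sup>2)) = (\<Prod>b\<in>Basis. ennreal (exp (- e * (a \<bullet> b)\<^sup>2)))"
      by (simp add: prod_ennreal sum_distrib_left exp_sum flip: sum_negf)
  qed
  also have "\<dots> = (\<Prod>b\<in>(Basis :: 'a set). (\<integral>\<^sup>+x. ennreal (exp (- e * x\<^sup>2)) \<partial>lborel))"
    by (rule nn_integral_lborel_prod) auto
  also have "\<dots> < \<infinity>"
    using integrable_exp_neg_sq[OF e]
    by (simp add: nn_integral_eq_integral ennreal_power)
  finally show "(\<integral>\<^sup>+a. ennreal (exp (- e * (norm (a::'a))\<^sup>2)) \<partial>lborel) < \<infinity>" .
qed auto

lemma gauss_decay_integrable:
  fixes f :: "'a::euclidean_space \<Rightarrow> complex"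
  assumes "gauss_decay f" "f \<in> borel_measurable borel"
  shows "integrable lborel f"
proof -
  obtain C e where C: "C \<ge> 0" "e > 0" "\<And>a. cmod (f a) \<le> C * exp (- e * (norm a)\<^sup>2)"
    using gauss_decayE[OF assms(1)] by metis
  show ?thesis
  proof (rule Bochner_Integration.integrable_bound)
    show "integrable lborel (\<lambda>a::'a. C * exp (- e * (norm a)\<^sup>2))"
      by (intro integrable_mult_right integrable_exp_neg_norm_sq C)
    show "AE a in lborel. norm (f a) \<le> norm (C * exp (- e * (norm a)\<^sup>2))"
      using C by (intro AE_I2) (simp add: abs_mult)
  qed (use assms(2) in simp)
qed

lemma gauss_decay_mult:
  assumes "gauss_decay f" "gauss_decay g" shows "gauss_decay (\<lambda>a. f a * g a)"
proof -
  obtain C e where f: "C \<ge> 0" "e > 0" "\<And>a. cmod (f a) \<le> C * exp (- e * (norm a)\<^sup>2)"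
    using gauss_decayE[OF assms(1)] by metis
  obtain D d where g: "D \<ge> 0" "d > 0" "\<And>a. cmod (g a) \<le> D * exp (- d * (norm a)\<^sup>2)"
    using gauss_decayE[OF assms(2)] by metis
  have "cmod (f a * g a) \<le> C * D * exp (- (e + d) * (norm a)\<^sup>2)" for a
  proof -
    have "cmod (f a * g a) \<le> (C * exp (- e * (norm a)\<^sup>2)) * (D * exp (- d * (norm a)\<^sup>2))"
      unfolding norm_mult by (intro mult_mono f g) (use f in auto)
    also have "\<dots> = C * D * exp (- (e + d) * (norm a)\<^sup>2)"
      by (simp add: exp_add[symmetric] algebra_simps)
    finally show ?thesis .
  qed
  then show ?thesis
    by (rule gauss_decayI[rotated]) (use f g in simp)
qed

lemma gauss_decay_cnj: "gauss_decay f \<Longrightarrow> gauss_decay (\<lambda>a. cnj (f a))"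
  by (simp add: gauss_decay_def)

lemma gauss_decay_scale: "gauss_decay f \<Longrightarrow> gauss_decay (\<lambda>a. c * f a)"
proof -
  assume f: "gauss_decay f"
  obtain C e where f: "C \<ge> 0" "e > 0" "\<And>a. cmod (f a) \<le> C * exp (- e * (norm a)\<^sup>2)"
    using gauss_decayE[OF f] by metis
  have "cmod (c * f a) \<le> (cmod c * C) * exp (- e * (norm a)\<^sup>2)" for a
    unfolding norm_mult mult.assoc by (intro mult_left_mono f norm_ge_zero)
  with f(2) show ?thesis by (rule gauss_decayI)
qed

lemma gauss_decay_add:
  assumes "gauss_decay f" "gauss_decay g" shows "gauss_decay (\<lambda>a. f a + g a)"
proof -
  obtain C e where f: "C \<ge> 0" "e > 0" "\<And>a. cmod (f a) \<le> C * exp (- e * (norm a)\<^sup>2)"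
    using gauss_decayE[OF assms(1)] by metis
  obtain D d where g: "D \<ge> 0" "d > 0" "\<And>a. cmod (g a) \<le> D * exp (- d * (norm a)\<^sup>2)"
    using gauss_decayE[OF assms(2)] by metis
  have "cmod (f a + g a) \<le> (C + D) * exp (- min e d * (norm a)\<^sup>2)" for a
  proof -
    have "cmod (f a + g a) \<le> C * exp (- e * (norm a)\<^sup>2) + D * exp (- d * (norm a)\<^sup>2)"
      by (rule order_trans[OF norm_triangle_ineq]) (intro add_mono f g)
    also have "\<dots> \<le> C * exp (- min e d * (norm a)\<^sup>2) + D * exp (- min e d * (norm a)\<^sup>2)"
      by (intro add_mono mult_left_mono f g) (auto intro!: mult_right_mono)
    finally show ?thesis by (simp add: distrib_right)
  qed
  then show ?thesis
    by (rule gauss_decayI[rotated]) (use f g in simp)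
qed

lemma gauss_decay_sq_integrable:
  fixes f :: "real^'n \<Rightarrow> complex"
  assumes "gauss_decay f" "f \<in> borel_measurable borel"
  shows "sq_integrable f"
proof -
  have "integrable lborel (\<lambda>a. f a * cnj (f a))"
    using assms by (intro gauss_decay_integrable gauss_decay_mult gauss_decay_cnj) auto
  then have "integrable lborel (\<lambda>a. complex_of_real ((cmod (f a))\<^sup>2))"
    by (simp only: complex_norm_square)
  then show ?thesis
    using assms(2) by (simp add: sq_integrable_def complex_of_real_integrable_eq del: of_real_power)
qed

text \<open>A function of subgaussian growth does not spoil the Gaussian decay of a factor.\<close>

definition subgauss_growth :: "('a::real_normed_vector \<Rightarrow> complex) \<Rightarrow> bool" where
  "subgauss_growth f \<longleftrightarrow> (\<forall>e>0. \<exists>C. \<forall>a. cmod (f a) \<le> C * exp (e * (norm a)\<^sup>2))"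

lemma subgauss_growth_mult:
  assumes "subgauss_growth f" "subgauss_growth g"
  shows "subgauss_growth (\<lambda>a. f a * g a)"
  unfolding subgauss_growth_def
proof (intro allI impI)
  fix e :: real assume "e > 0"
  then obtain C D where C: "\<And>a. cmod (f a) \<le> C * exp (e / 2 * (norm a)\<^sup>2)"
    and D: "\<And>a. cmod (g a) \<le> D * exp (e / 2 * (norm a)\<^sup>2)"
    using assms unfolding subgauss_growth_def by (meson half_gt_zero)
  have C0: "C \<ge> 0"
    using order_trans[OF norm_ge_zero C[of 0]] by simp
  have "cmod (f a * g a) \<le> C * D * exp (e * (norm a)\<^sup>2)" for a
  proof -
    have "cmod (f a * g a) \<le> (C * exp (e / 2 * (norm a)\<^sup>2)) * (D * exp (e / 2 * (norm a)\<^sup>2))"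
      unfolding norm_mult by (intro mult_mono C D) (use C0 in auto)
    also have "\<dots> = C * D * exp (e * (norm a)\<^sup>2)"
      by (simp add: exp_add[symmetric] mult_ac flip: mult_2_right)
    finally show ?thesis .
  qed
  then show "\<exists>C. \<forall>a. cmod (f a * g a) \<le> C * exp (e * (norm a)\<^sup>2)" by blast
qed

lemma subgauss_growth_add:
  assumes "subgauss_growth f" "subgauss_growth g"
  shows "subgauss_growth (\<lambda>a. f a + g a)"
  unfolding subgauss_growth_def
proof (intro allI impI)
  fix e :: real assume "e > 0"
  then obtain C D where C: "\<And>a. cmod (f a) \<le> C * exp (e * (norm a)\<^sup>2)"
    and D: "\<And>a. cmod (g a) \<le> D * exp (e * (norm a)\<^sup>2)"
    using assms unfolding subgauss_growth_def by meson
  have "cmod (f a + g a) \<le> (C + D) * exp (e * (norm a)\<^sup>2)" for a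
    unfolding distrib_right by (rule order_trans[OF norm_triangle_ineq]) (intro add_mono C D)
  then show "\<exists>C. \<forall>a. cmod (f a + g a) \<le> C * exp (e * (norm a)\<^sup>2)" by blast
qed

lemma subgauss_growth_exp_linear:
  assumes l: "\<And>a. cmod (f a) \<le> exp (K * norm a)"
  shows "subgauss_growth f"
  unfolding subgauss_growth_def
proof (intro allI impI)
  fix e :: real assume e: "e > 0"
  have "cmod (f a) \<le> exp (K\<^sup>2 / (4 * e)) * exp (e * (norm a)\<^sup>2)" for a
  proof -
    \<comment> \<open>completing the square in \<open>e * (norm a)\<^sup>2 - K * norm a\<close>\<close>
    have "0 \<le> (K - 2 * e * norm a)\<^sup>2 / (4 * e)"
      using e by simp
    also have "\<dots> = K\<^sup>2 / (4 * e) + e * (norm a)\<^sup>2 - K * norm a"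
      using e by (simp add: power2_eq_square field_simps)
    finally have "exp (K * norm a) \<le> exp (K\<^sup>2 / (4 * e) + e * (norm a)\<^sup>2)"
      by simp
    with l[of a] show ?thesis
      unfolding exp_add by (rule order_trans)
  qed
  then show "\<exists>C. \<forall>a. cmod (f a) \<le> C * exp (e * (norm a)\<^sup>2)" by blast
qed

lemma subgauss_growth_const: "subgauss_growth (\<lambda>a :: 'a :: real_normed_vector. c)"
  unfolding subgauss_growth_def
proof (intro allI impI exI[of _ "cmod c"])
  fix e :: real and a :: 'a assume "e > 0"
  then show "cmod c \<le> cmod c * exp (e * (norm a)\<^sup>2)"
    using mult_left_mono[of 1 "exp (e * (norm a)\<^sup>2)" "cmod c"] by simp
qed

lemma subgauss_growth_linear:
  assumes l: "\<And>a. cmod (f a) \<le> K * norm a"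
  shows "subgauss_growth f"
proof (rule subgauss_growth_exp_linear)
  show "cmod (f a) \<le> exp (K * norm a)" for a
    using exp_ge_add_one_self[of "K * norm a"] l[of a] by linarith
qed

lemma gauss_decay_subgauss:
  assumes "gauss_decay f" "subgauss_growth g" shows "gauss_decay (\<lambda>a. f a * g a)"
proof -
  obtain C e where f: "C \<ge> 0" "e > 0" "\<And>a. cmod (f a) \<le> C * exp (- e * (norm a)\<^sup>2)"
    using gauss_decayE[OF assms(1)] by metis
  obtain D where D: "\<And>a. cmod (g a) \<le> D * exp (e / 2 * (norm a)\<^sup>2)"
    using assms(2) f(2) unfolding subgauss_growth_def by (meson half_gt_zero)
  have "cmod (f a * g a) \<le> C * D * exp (- (e / 2) * (norm a)\<^sup>2)" for a
  proof -
    have "cmod (f a * g a) \<le> (C * exp (- e * (norm a)\<^sup>2)) * (D * exp (e / 2 * (norm a)\<^sup>2))"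
      unfolding norm_mult by (intro mult_mono f D) (use f in auto)
    also have "\<dots> = C * D * exp (- (e / 2) * (norm a)\<^sup>2)"
      by (simp add: exp_add[symmetric] field_simps)
    finally show ?thesis .
  qed
  then show ?thesis
    by (rule gauss_decayI[rotated]) (use f in simp)
qed


section \<open>Multiplication and composition operators\<close>

definition bounded_borel :: "('a::topological_space \<Rightarrow> complex) \<Rightarrow> bool" where
  "bounded_borel \<phi> \<longleftrightarrow> \<phi> \<in> borel_measurable borel \<and> (\<exists>C. \<forall>a. cmod (\<phi> a) \<le> C)"

definition mult_op :: "(real^'n \<Rightarrow> complex) \<Rightarrow> 'n l2 \<Rightarrow> 'n::finite l2" where
  "mult_op \<phi> u = abs_l2 (\<lambda>a. \<phi> a * rep_l2 u a)"

lemma bounded_borelI: "\<phi> \<in> borel_measurable borel \<Longrightarrow> (\<And>a. cmod (\<phi> a) \<le> C) \<Longrightarrow> bounded_borel \<phi>"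
  by (auto simp: bounded_borel_def)

lemma bounded_borel_measurable: "bounded_borel \<phi> \<Longrightarrow> \<phi> \<in> borel_measurable borel"
  by (simp add: bounded_borel_def)

lemma sq_integrable_mult:
  assumes "bounded_borel \<phi>" "sq_integrable f"
  shows "sq_integrable (\<lambda>a. \<phi> a * f a)"
proof -
  obtain C where C: "\<And>a. cmod (\<phi> a) \<le> C" and [measurable]: "\<phi> \<in> borel_measurable borel"
    using assms(1) by (auto simp: bounded_borel_def)
  have [measurable]: "f \<in> borel_measurable borel" and f: "integrable lborel (\<lambda>a. (cmod (f a))\<^sup>2)"
    using assms(2) by (auto simp: sq_integrable_def)
  have "integrable lborel (\<lambda>a. (cmod (\<phi> a * f a))\<^sup>2)"
  proof (rule Bochner_Integration.integrable_bound)
    show "integrable lborel (\<lambda>a. C\<^sup>2 * (cmod (f a))\<^sup>2)" using f by simp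
    have "(cmod (\<phi> a))\<^sup>2 * (cmod (f a))\<^sup>2 \<le> C\<^sup>2 * (cmod (f a))\<^sup>2" for a
      by (intro mult_right_mono power_mono C) auto
    then show "AE a in lborel. norm ((cmod (\<phi> a * f a))\<^sup>2) \<le> norm (C\<^sup>2 * (cmod (f a))\<^sup>2)"
      by (simp add: norm_mult power_mult_distrib)
  qed simp
  then show ?thesis by (simp add: sq_integrable_def)
qed

lemma rep_mult_op: "bounded_borel \<phi> \<Longrightarrow> AE a in lborel. rep_l2 (mult_op \<phi> u) a = \<phi> a * rep_l2 u a"
  unfolding mult_op_def by (intro rep_abs_l2 sq_integrable_mult) simp_all

lemma bounded_borel_mult:
  assumes "bounded_borel \<phi>" "bounded_borel \<psi>" shows "bounded_borel (\<lambda>a. \<phi> a * \<psi> a)"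
proof -
  obtain C D where "\<And>a. cmod (\<phi> a) \<le> C" "\<And>a. cmod (\<psi> a) \<le> D"
    using assms by (auto simp: bounded_borel_def)
  then have "cmod (\<phi> a * \<psi> a) \<le> C * D" for a
    unfolding norm_mult by (intro mult_mono) (auto intro: order_trans[OF norm_ge_zero])
  then show ?thesis
    using assms by (intro bounded_borelI) (auto simp: bounded_borel_def)
qed

lemma bounded_borel_indicator: "A \<in> sets borel \<Longrightarrow> bounded_borel (indicator A)"
  by (rule bounded_borelI[where C = 1]) (auto simp: indicator_def)

lemma bounded_borel_compose:
  "bounded_borel \<phi> \<Longrightarrow> l \<in> borel_measurable borel \<Longrightarrow> bounded_borel (\<lambda>a. \<phi> (l a))"
  unfolding bounded_borel_def by (auto intro: measurable_compose)

lemma mult_op_mult_op: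
  assumes "bounded_borel \<phi>" "bounded_borel \<psi>"
  shows "mult_op \<phi> (mult_op \<psi> u) = mult_op (\<lambda>a. \<phi> a * \<psi> a) u"
  unfolding l2_eq_iff
  using rep_mult_op[OF assms(1), of "mult_op \<psi> u"] rep_mult_op[OF assms(2), of u]
    rep_mult_op[OF bounded_borel_mult[OF assms], of u]
  by eventually_elim simp

lemma mult_op_one: "mult_op (\<lambda>a. 1) u = u"
  by (simp add: mult_op_def)

lemma mult_op_linear:
  assumes "bounded_borel \<phi>"
  shows "mult_op \<phi> (u + v) = mult_op \<phi> u + mult_op \<phi> v" "mult_op \<phi> (l2_scale c u) = l2_scale c (mult_op \<phi> u)"
proof -
  show "mult_op \<phi> (u + v) = mult_op \<phi> u + mult_op \<phi> v"
    unfolding l2_eq_iff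
    using rep_mult_op[OF assms, of "u + v"] rep_mult_op[OF assms, of u] rep_mult_op[OF assms, of v]
      rep_plus[of u v] rep_plus[of "mult_op \<phi> u" "mult_op \<phi> v"]
    by eventually_elim (simp add: distrib_left)
  show "mult_op \<phi> (l2_scale c u) = l2_scale c (mult_op \<phi> u)"
    unfolding l2_eq_iff
    using rep_mult_op[OF assms, of "l2_scale c u"] rep_mult_op[OF assms, of u]
      rep_scale[of c u] rep_scale[of c "mult_op \<phi> u"]
    by eventually_elim simp
qed

lemma inner_mult_op:
  assumes "bounded_borel \<phi>"
  shows "l2_inner u (mult_op \<phi> v) = (\<integral>a. cnj (rep_l2 u a) * (\<phi> a * rep_l2 v a) \<partial>lborel)"
  unfolding l2_inner_eq
proof (rule integral_cong_AE)
  show "AE a in lborel. cnj (rep_l2 u a) * rep_l2 (mult_op \<phi> v) a = cnj (rep_l2 u a) * (\<phi> a * rep_l2 v a)"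
    using rep_mult_op[OF assms, of v] by eventually_elim simp
qed (use bounded_borel_measurable[OF assms] in simp_all)

lemma inner_mult_op_adjoint:
  assumes "bounded_borel \<phi>"
  shows "l2_inner (mult_op (\<lambda>a. cnj (\<phi> a)) u) v = l2_inner u (mult_op \<phi> v)"
proof -
  have b: "bounded_borel (\<lambda>a. cnj (\<phi> a))"
    using assms by (auto simp: bounded_borel_def)
  show ?thesis
    unfolding inner_mult_op[OF assms] unfolding l2_inner_eq
  proof (rule integral_cong_AE)
    show "AE a in lborel. cnj (rep_l2 (mult_op (\<lambda>a. cnj (\<phi> a)) u) a) * rep_l2 v a
        = cnj (rep_l2 u a) * (\<phi> a * rep_l2 v a)"
      using rep_mult_op[OF b, of u] by eventually_elim simp
  qed (use bounded_borel_measurable[OF assms] in simp_all)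
qed

definition measure_preserving :: "(real^'n \<Rightarrow> real^'n) \<Rightarrow> bool" where
  "measure_preserving T \<longleftrightarrow> T \<in> borel_measurable borel \<and> distr lborel borel T = lborel"

definition comp_op :: "(real^'n \<Rightarrow> real^'n) \<Rightarrow> 'n l2 \<Rightarrow> 'n::finite l2" where
  "comp_op T u = abs_l2 (\<lambda>a. rep_l2 u (T a))"

lemma AE_compose:
  assumes "measure_preserving T" "AE a in lborel. P a"
  shows "AE a in lborel. P (T a)"
proof -
  have T: "T \<in> measurable lborel borel" and d: "distr lborel borel T = lborel"
    using assms(1) by (auto simp: measure_preserving_def)
  have "AE a in distr lborel borel T. P a"
    unfolding d by (rule assms(2))
  with T show ?thesis by (rule AE_distrD)
qed

lemma sq_integrable_compose:
  assumes "measure_preserving T" "sq_integrable f"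
  shows "sq_integrable (\<lambda>a. f (T a))"
proof -
  have T [measurable]: "T \<in> measurable lborel borel" and d: "distr lborel borel T = lborel"
    using assms(1) by (auto simp: measure_preserving_def)
  have [measurable]: "f \<in> borel_measurable borel" and f: "integrable lborel (\<lambda>a. (cmod (f a))\<^sup>2)"
    using assms(2) by (auto simp: sq_integrable_def)
  have "integrable (distr lborel borel T) (\<lambda>a. (cmod (f a))\<^sup>2)"
    unfolding d by (rule f)
  then have "integrable lborel (\<lambda>a. (cmod (f (T a)))\<^sup>2)"
    by (subst (asm) integrable_distr_eq[OF T]) simp_all
  moreover have "(\<lambda>a. f (T a)) \<in> borel_measurable lborel"
    by measurable
  ultimately show ?thesis
    by (simp add: sq_integrable_def)
qed

lemma rep_comp_op:
  "measure_preserving T \<Longrightarrow> AE a in lborel. rep_l2 (comp_op T u) a = rep_l2 u (T a)"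
  unfolding comp_op_def by (rule rep_abs_l2[OF sq_integrable_compose[OF _ sq_integrable_rep]])

lemma comp_op_abs:
  assumes T: "measure_preserving T" and f: "sq_integrable f"
  shows "comp_op T (abs_l2 f) = abs_l2 (\<lambda>a. f (T a))"
proof (rule abs_l2_eqI[symmetric])
  show "AE a in lborel. rep_l2 (comp_op T (abs_l2 f)) a = f (T a)"
    using rep_comp_op[OF T, of "abs_l2 f"] AE_compose[OF T rep_abs_l2[OF f]] by eventually_elim simp
qed (rule sq_integrable_compose[OF T f])

lemma comp_op_linear:
  assumes T: "measure_preserving T"
  shows "comp_op T (u + v) = comp_op T u + comp_op T v" "comp_op T (l2_scale c u) = l2_scale c (comp_op T u)"
proof -
  show "comp_op T (u + v) = comp_op T u + comp_op T v"
    unfolding l2_eq_iff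
    using rep_comp_op[OF T, of "u + v"] rep_comp_op[OF T, of u] rep_comp_op[OF T, of v]
      AE_compose[OF T rep_plus[of u v]] rep_plus[of "comp_op T u" "comp_op T v"]
    by eventually_elim simp
  show "comp_op T (l2_scale c u) = l2_scale c (comp_op T u)"
    unfolding l2_eq_iff
    using rep_comp_op[OF T, of "l2_scale c u"] rep_comp_op[OF T, of u]
      AE_compose[OF T rep_scale[of c u]] rep_scale[of c "comp_op T u"]
    by eventually_elim simp
qed

lemma comp_op_comp_op:
  assumes T: "measure_preserving T" and S: "measure_preserving S"
  shows "comp_op T (comp_op S u) = comp_op (\<lambda>a. S (T a)) u"
  unfolding comp_op_def[of S] comp_op_def[of "\<lambda>a. S (T a)"]
  by (rule comp_op_abs[OF T sq_integrable_compose[OF S]]) simp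

lemma comp_op_mult_op:
  assumes T: "measure_preserving T" and b: "bounded_borel \<phi>"
  shows "comp_op T (mult_op \<phi> u) = mult_op (\<lambda>a. \<phi> (T a)) (comp_op T u)"
proof -
  have b': "bounded_borel (\<lambda>a. \<phi> (T a))"
    using b T unfolding bounded_borel_def measure_preserving_def by (auto intro: measurable_compose)
  show ?thesis
    unfolding l2_eq_iff
    using rep_comp_op[OF T, of "mult_op \<phi> u"] rep_comp_op[OF T, of u]
      AE_compose[OF T rep_mult_op[OF b, of u]] rep_mult_op[OF b', of "comp_op T u"]
    by eventually_elim simp
qed

lemma inner_comp_op:
  assumes T: "measure_preserving T"
  shows "l2_inner (comp_op T u) (comp_op T v) = l2_inner u v"
proof -
  have [measurable]: "T \<in> measurable lborel borel" and d: "distr lborel borel T = lborel"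
    using T by (auto simp: measure_preserving_def)
  have "l2_inner (comp_op T u) (comp_op T v) = (\<integral>a. cnj (rep_l2 u (T a)) * rep_l2 v (T a) \<partial>lborel)"
    unfolding l2_inner_eq
  proof (rule integral_cong_AE)
    show "AE a in lborel. cnj (rep_l2 (comp_op T u) a) * rep_l2 (comp_op T v) a = cnj (rep_l2 u (T a)) * rep_l2 v (T a)"
      using rep_comp_op[OF T, of u] rep_comp_op[OF T, of v] by eventually_elim simp
  qed simp_all
  also have "\<dots> = (\<integral>a. cnj (rep_l2 u a) * rep_l2 v a \<partial>distr lborel borel T)"
    by (subst integral_distr) simp_all
  finally show ?thesis
    unfolding d l2_inner_eq .
qed

section \<open>Operators diagonalised by a unitary\<close>

lemma unitary_inner: "unitary U \<Longrightarrow> l2_inner (U u) (U v) = l2_inner u v"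
  by (simp add: unitary_def)

lemma unitary_linear:
  assumes "unitary U"
  shows "U (u + v) = U u + U v" "U (l2_scale c u) = l2_scale c (U u)" "U (u - v) = U u - U v" "U 0 = 0"
proof -
  have "module_hom l2_scale l2_scale U"
    using assms by (simp add: unitary_def module_hom_iff_linear)
  then show "U (u + v) = U u + U v" "U (l2_scale c u) = l2_scale c (U u)" "U (u - v) = U u - U v" "U 0 = 0"
    by (simp_all add: module_hom.add module_hom.scale module_hom.diff module_hom.zero)
qed

lemma unitary_inv: "unitary U \<Longrightarrow> U (inv U u) = u" "unitary U \<Longrightarrow> inv U (U u) = u"
  by (simp_all add: unitary_def bij_is_surj surj_f_inv_f bij_is_inj)

lemma unitary_eq_iff: "unitary U \<Longrightarrow> U u = U v \<longleftrightarrow> u = v"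
  by (metis unitary_inv(2))

lemma unitary_norm: "unitary U \<Longrightarrow> norm (U u) = norm u"
  by (simp add: norm_eq_sqrt_inner inner_l2_def unitary_inner)

text \<open>
  The self-adjoint operator that \<open>U\<close> turns into multiplication by \<open>l\<close> on its maximal domain, and its
  bounded functions.
\<close>

definition spectral_graph :: "('n::finite l2 \<Rightarrow> 'n l2) \<Rightarrow> (real^'n \<Rightarrow> real) \<Rightarrow> ('n l2 \<times> 'n l2) set" where
  "spectral_graph U l = {(u, v). AE a in lborel. rep_l2 (U v) a = of_real (l a) * rep_l2 (U u) a}"

definition spectral_op :: "('n::finite l2 \<Rightarrow> 'n l2) \<Rightarrow> (real^'n \<Rightarrow> real) \<Rightarrow> (real \<Rightarrow> complex) \<Rightarrow> 'n l2 \<Rightarrow> 'n l2" where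
  "spectral_op U l \<phi> u = inv U (mult_op (\<lambda>a. \<phi> (l a)) (U u))"

context
  fixes U :: "'n::finite l2 \<Rightarrow> 'n l2" and l :: "real^'n \<Rightarrow> real"
  assumes U: "unitary U" and l [measurable]: "l \<in> borel_measurable borel"
begin

lemma spectral_graph_add:
  assumes "(u, v) \<in> spectral_graph U l" "(u', v') \<in> spectral_graph U l"
  shows "(u + u', v + v') \<in> spectral_graph U l"
  using assms rep_plus[of "U u" "U u'"] rep_plus[of "U v" "U v'"]
  unfolding spectral_graph_def mem_Collect_eq case_prod_conv unitary_linear[OF U]
  by eventually_elim (simp add: distrib_left)

lemma spectral_graph_scale:
  assumes "(u, v) \<in> spectral_graph U l"
  shows "(l2_scale c u, l2_scale c v) \<in> spectral_graph U l"
  using assms rep_scale[of c "U u"] rep_scale[of c "U v"]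
  unfolding spectral_graph_def mem_Collect_eq case_prod_conv unitary_linear[OF U]
  by eventually_elim simp

lemma spectral_graph_diff:
  assumes "(u, v) \<in> spectral_graph U l" "(u', v') \<in> spectral_graph U l"
  shows "(u - u', v - v') \<in> spectral_graph U l"
  using assms rep_minus[of "U u" "U u'"] rep_minus[of "U v" "U v'"]
  unfolding spectral_graph_def mem_Collect_eq case_prod_conv unitary_linear[OF U]
  by eventually_elim (simp add: right_diff_distrib)

lemma single_valued_spectral_graph: "single_valued (spectral_graph U l)"
proof (rule single_valuedI)
  fix u v w assume "(u, v) \<in> spectral_graph U l" "(u, w) \<in> spectral_graph U l"
  then have "U v = U w"
    unfolding l2_eq_iff[of "U v"] spectral_graph_def mem_Collect_eq case_prod_conv
    by eventually_elim simp
  then show "v = w" by (simp add: unitary_eq_iff[OF U])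
qed

lemma in_spectral_graphI:
  assumes "sq_integrable (\<lambda>a. of_real (l a) * rep_l2 (U u) a)"
  shows "(u, inv U (abs_l2 (\<lambda>a. of_real (l a) * rep_l2 (U u) a))) \<in> spectral_graph U l"
  using rep_abs_l2[OF assms] by (simp add: spectral_graph_def unitary_inv[OF U])

lemma spectral_graph_symmetric:
  assumes "(u, v) \<in> spectral_graph U l" "(f, g) \<in> spectral_graph U l"
  shows "l2_inner u g = l2_inner v f"
proof -
  have "l2_inner (U u) (U g) = l2_inner (U v) (U f)"
    unfolding l2_inner_eq
  proof (rule integral_cong_AE)
    show "AE a in lborel. cnj (rep_l2 (U u) a) * rep_l2 (U g) a = cnj (rep_l2 (U v) a) * rep_l2 (U f) a"
      using assms unfolding spectral_graph_def mem_Collect_eq case_prod_conv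
      by eventually_elim simp
  qed simp_all
  then show ?thesis by (simp add: unitary_inner[OF U])
qed

text \<open>
  Where \<open>\<bar>l\<bar> \<le> N\<close>, multiplication by \<open>l\<close> is bounded.
  Testing an element of the adjoint graph against vectors supported there shows that it satisfies
  the defining equation there, and these regions exhaust the space.
\<close>

lemma self_adjoint_spectral_graph: "self_adjoint (spectral_graph U l)"
  unfolding self_adjoint_def
proof (intro conjI single_valued_spectral_graph subset_antisym subrelI)
  fix u v assume "(u, v) \<in> spectral_graph U l"
  then show "(u, v) \<in> adjoint_graph (spectral_graph U l)"
    unfolding adjoint_graph_def by (auto simp: spectral_graph_symmetric)
next
  fix u v assume uv: "(u, v) \<in> adjoint_graph (spectral_graph U l)"
  define cut where "cut N a = (indicator {a. \<bar>l a\<bar> \<le> real N} a :: complex)" for N a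
  have cut: "bounded_borel (cut N)" "bounded_borel (\<lambda>a. of_real (l a) * cut N a)" for N
  proof -
    have [measurable]: "cut N \<in> borel_measurable borel"
      unfolding cut_def by measurable
    show "bounded_borel (cut N)"
      by (rule bounded_borelI[where C = 1]) (auto simp: cut_def indicator_def)
    show "bounded_borel (\<lambda>a. of_real (l a) * cut N a)"
      by (rule bounded_borelI[where C = "real N"]) (auto simp: cut_def indicator_def)
  qed
  have cut_cnj: "cnj (cut N a) = cut N a" for N a
    by (simp add: cut_def indicator_def)
  have "AE a in lborel. of_real (l a) * cut N a * rep_l2 (U u) a = cut N a * rep_l2 (U v) a" for N
  proof -
    have eq: "mult_op (\<lambda>a. of_real (l a) * cut N a) (U u) = mult_op (cut N) (U v)"
    proof (rule l2_inner_eqI)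
      fix h
      define f where "f = inv U (mult_op (cut N) h)"
      define g where "g = inv U (mult_op (\<lambda>a. of_real (l a) * cut N a) h)"
      have "(f, g) \<in> spectral_graph U l"
        using rep_mult_op[OF cut(1)[of N], of h] rep_mult_op[OF cut(2)[of N], of h]
        unfolding spectral_graph_def mem_Collect_eq case_prod_conv f_def g_def unitary_inv[OF U]
        by eventually_elim simp
      with uv have "l2_inner (U u) (U g) = l2_inner (U v) (U f)"
        by (auto simp: adjoint_graph_def unitary_inner[OF U])
      then have "l2_inner (mult_op (\<lambda>a. of_real (l a) * cut N a) (U u)) h = l2_inner (mult_op (cut N) (U v)) h"
        using inner_mult_op_adjoint[OF cut(1)[of N], of "U v" h] inner_mult_op_adjoint[OF cut(2)[of N], of "U u" h]
        by (simp add: f_def g_def unitary_inv[OF U] cut_cnj)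
      then show "l2_inner h (mult_op (\<lambda>a. of_real (l a) * cut N a) (U u)) = l2_inner h (mult_op (cut N) (U v))"
        using l2_inner_commute[of h] by simp
    qed
    show ?thesis
      using rep_mult_op[OF cut(1)[of N], of "U v"] rep_mult_op[OF cut(2)[of N], of "U u"]
      unfolding eq by eventually_elim simp
  qed
  then have "AE a in lborel. \<forall>N. of_real (l a) * cut N a * rep_l2 (U u) a = cut N a * rep_l2 (U v) a"
    unfolding AE_all_countable by blast
  then have "AE a in lborel. rep_l2 (U v) a = of_real (l a) * rep_l2 (U u) a"
  proof eventually_elim
    case (elim a)
    obtain N :: nat where "\<bar>l a\<bar> \<le> real N" using real_arch_simple by blast
    with elim[rule_format, of N] show ?case by (simp add: cut_def)
  qed
  then show "(u, v) \<in> spectral_graph U l"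
    by (simp add: spectral_graph_def)
qed

lemma spectral_op_linear:
  assumes "bounded_borel \<phi>"
  shows "l2_linear (spectral_op U l \<phi>)"
proof -
  have b: "bounded_borel (\<lambda>a. \<phi> (l a))"
    by (rule bounded_borel_compose[OF assms l])
  show ?thesis
  proof
    show "spectral_op U l \<phi> (u + v) = spectral_op U l \<phi> u + spectral_op U l \<phi> v" for u v
      by (rule unitary_eq_iff[OF U, THEN iffD1])
         (simp add: spectral_op_def unitary_inv[OF U] unitary_linear[OF U] mult_op_linear[OF b])
    show "spectral_op U l \<phi> (l2_scale c u) = l2_scale c (spectral_op U l \<phi> u)" for c u
      by (rule unitary_eq_iff[OF U, THEN iffD1])
         (simp add: spectral_op_def unitary_inv[OF U] unitary_linear[OF U] mult_op_linear[OF b])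
  qed
qed

lemma U_spectral_op: "U (spectral_op U l \<phi> u) = mult_op (\<lambda>a. \<phi> (l a)) (U u)"
  by (simp add: spectral_op_def unitary_inv[OF U])

lemma spectral_op_mult:
  assumes "bounded_borel \<phi>" "bounded_borel \<psi>"
  shows "spectral_op U l \<phi> (spectral_op U l \<psi> u) = spectral_op U l (\<lambda>t. \<phi> t * \<psi> t) u"
  by (rule unitary_eq_iff[OF U, THEN iffD1])
     (simp add: U_spectral_op mult_op_mult_op bounded_borel_compose[OF _ l] assms)

lemma inner_spectral_op:
  assumes "bounded_borel \<phi>"
  shows "l2_inner u (spectral_op U l \<phi> v) = (\<integral>a. cnj (rep_l2 (U u) a) * (\<phi> (l a) * rep_l2 (U v) a) \<partial>lborel)"
proof -
  have "l2_inner u (spectral_op U l \<phi> v) = l2_inner (U u) (mult_op (\<lambda>a. \<phi> (l a)) (U v))"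
    unfolding unitary_inner[OF U, of u, symmetric] U_spectral_op ..
  then show ?thesis
    unfolding inner_mult_op[OF bounded_borel_compose[OF assms l]] .
qed

definition spectral_law :: "'n l2 \<Rightarrow> real measure" where
  "spectral_law u = distr (density lborel (\<lambda>a. ennreal ((cmod (rep_l2 (U u) a))\<^sup>2))) borel l"

lemma integrable_spectral_law:
  fixes f :: "real \<Rightarrow> 'b::{banach, second_countable_topology}"
  assumes [measurable]: "f \<in> borel_measurable borel"
  shows "integrable (spectral_law u) f \<longleftrightarrow> integrable lborel (\<lambda>a. (cmod (rep_l2 (U u) a))\<^sup>2 *\<^sub>R f (l a))"
  unfolding spectral_law_def by (subst integrable_distr_eq; simp?) (subst integrable_density; simp)

lemma integral_spectral_law:
  fixes f :: "real \<Rightarrow> 'b::{banach, second_countable_topology}"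
  assumes [measurable]: "f \<in> borel_measurable borel"
  shows "(\<integral>t. f t \<partial>spectral_law u) = (\<integral>a. (cmod (rep_l2 (U u) a))\<^sup>2 *\<^sub>R f (l a) \<partial>lborel)"
  unfolding spectral_law_def by (subst integral_distr; simp?) (subst integral_density; simp)

lemma inner_spectral_op_law:
  assumes \<phi>: "bounded_borel \<phi>"
  shows "l2_inner u (spectral_op U l \<phi> u) = (\<integral>t. \<phi> t \<partial>spectral_law u)"
  unfolding inner_spectral_op[OF \<phi>] integral_spectral_law[OF bounded_borel_measurable[OF \<phi>]]
  by (rule Bochner_Integration.integral_cong)
     (simp_all add: scaleR_conv_of_real complex_norm_square mult_ac del: of_real_power)

lemma spectral_distr_spectral_op:
  "spectral_distr (\<lambda>A. spectral_op U l (indicator A)) u = spectral_law u"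
proof -
  have law: "spectral_law u = measure_of UNIV (sets borel) (emeasure (spectral_law u))"
    using measure_of_of_measure[of "spectral_law u"] by (simp add: spectral_law_def)
  have "ennreal (Re (l2_inner u (spectral_op U l (indicator A) u))) = emeasure (spectral_law u) A"
    if A [measurable]: "A \<in> sets borel" for A
  proof -
    have i: "integrable lborel (\<lambda>a. (cmod (rep_l2 (U u) a))\<^sup>2 * indicator A (l a))"
      by (rule Bochner_Integration.integrable_bound[OF integrable_rep_sq[of "U u"]]) (auto simp: indicator_def)
    have "l2_inner u (spectral_op U l (indicator A) u)
        = (\<integral>a. of_real ((cmod (rep_l2 (U u) a))\<^sup>2 * indicator A (l a)) \<partial>lborel)"
      unfolding inner_spectral_op[OF bounded_borel_indicator[OF A]]
      by (rule Bochner_Integration.integral_cong)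
         (simp_all add: complex_norm_square mult_ac indicator_def del: of_real_power)
    then have "ennreal (Re (l2_inner u (spectral_op U l (indicator A) u)))
        = ennreal (\<integral>a. (cmod (rep_l2 (U u) a))\<^sup>2 * indicator A (l a) \<partial>lborel)"
      by (simp only: integral_complex_of_real Re_complex_of_real)
    also have "\<dots> = (\<integral>\<^sup>+a. ennreal ((cmod (rep_l2 (U u) a))\<^sup>2 * indicator A (l a)) \<partial>lborel)"
      by (rule nn_integral_eq_integral[OF i, symmetric]) simp
    also have "\<dots> = emeasure (spectral_law u) A"
    proof -
      have [measurable]: "l -` A \<in> sets borel"
        by (rule measurable_sets_borel[OF l A])
      have "emeasure (spectral_law u) A = (\<integral>\<^sup>+a. ennreal ((cmod (rep_l2 (U u) a))\<^sup>2) * indicator (l -` A) a \<partial>lborel)"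
        unfolding spectral_law_def by (subst emeasure_distr) (simp_all add: emeasure_density)
      then show ?thesis
        by (auto intro!: nn_integral_cong simp: indicator_def)
    qed
    finally show ?thesis .
  qed
  then show ?thesis
    unfolding spectral_distr_def using sets.sigma_sets_eq[of "borel :: real measure"]
    by (subst law) (rule measure_of_eq, auto)
qed

text \<open>
  The spectral projections are the multiplications by \<open>indicator A \<circ> l\<close>; their
  countable additivity is dominated convergence.
\<close>

lemma spectral_measure_exists:
  "spectral_measure (spectral_graph U l) (\<lambda>A. spectral_op U l (indicator A))"
  unfolding spectral_measure_def spectral_distr_spectral_op
proof (intro conjI self_adjoint_spectral_graph)
  show "projection_valued_measure (\<lambda>A. spectral_op U l (indicator A))"
    unfolding projection_valued_measure_def
  proof (intro conjI ballI allI impI)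
    fix A :: "real set" assume A [measurable]: "A \<in> sets borel"
    have b: "bounded_borel (indicator A)"
      by (rule bounded_borel_indicator[OF A])
    show "l2_linear (spectral_op U l (indicator A))"
      by (rule spectral_op_linear[OF b])
    show "spectral_op U l (indicator A) \<circ> spectral_op U l (indicator A) = spectral_op U l (indicator A)"
    proof -
      have "(\<lambda>t. indicator A t * indicator A t :: complex) = indicator A"
        by (auto simp: fun_eq_iff indicator_def)
      then show ?thesis
        unfolding comp_def spectral_op_mult[OF b b] by simp
    qed
    fix u v
    have "l2_inner (spectral_op U l (indicator A) u) v = cnj (l2_inner v (spectral_op U l (indicator A) u))"
      by (rule l2_inner_commute)
    also have "\<dots> = (\<integral>a. cnj (cnj (rep_l2 (U v) a) * (indicator A (l a) * rep_l2 (U u) a)) \<partial>lborel)"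
      unfolding inner_spectral_op[OF b] Bochner_Integration.integral_cnj ..
    also have "\<dots> = l2_inner u (spectral_op U l (indicator A) v)"
      unfolding inner_spectral_op[OF b]
      by (rule Bochner_Integration.integral_cong) (simp_all add: indicator_def)
    finally show "l2_inner (spectral_op U l (indicator A) u) v = l2_inner u (spectral_op U l (indicator A) v)" .
  next
    show "spectral_op U l (indicator UNIV) = id"
      by (simp add: fun_eq_iff spectral_op_def mult_op_one unitary_inv[OF U])
  next
    fix A :: "nat \<Rightarrow> real set" and u v
    assume "range A \<subseteq> sets borel" and disj: "disjoint_family A"
    then have A [measurable]: "A m \<in> sets borel" for m by auto
    define f where "f a = cnj (rep_l2 (U u) a) * rep_l2 (U v) a" for a
    have f: "integrable lborel f"
      unfolding f_def by (rule integrable_inner)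
    have f' [measurable]: "f \<in> borel_measurable borel"
      unfolding f_def by measurable
    have form: "l2_inner u (spectral_op U l (indicator B) v) = (\<integral>a. indicator (l -` B) a *\<^sub>R f a \<partial>lborel)"
      if "B \<in> sets borel" for B
      unfolding inner_spectral_op[OF bounded_borel_indicator[OF that]] f_def
      by (rule Bochner_Integration.integral_cong) (simp_all add: indicator_def)
    have [measurable]: "l -` A m \<in> sets borel" "l -` (\<Union>m. A m) \<in> sets borel" for m
      by (intro measurable_sets_borel[OF l] A sets.countable_UN; force)+
    have ind: "(\<lambda>m. indicator (l -` A m) a :: real) sums indicator (l -` (\<Union>m. A m)) a" for a
      unfolding vimage_UN
      by (rule indicator_sums) (use disj in \<open>auto simp: disjoint_family_on_def\<close>)
    have lim: "(\<lambda>N. \<integral>a. (\<Sum>m<N. indicator (l -` A m) a *\<^sub>R f a) \<partial>lborel)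
        \<longlonglongrightarrow> (\<integral>a. indicator (l -` (\<Union>m. A m)) a *\<^sub>R f a \<partial>lborel)"
    proof (rule integral_dominated_convergence[where w = "\<lambda>a. norm (f a)"])
      show "AE a in lborel. (\<lambda>N. \<Sum>m<N. indicator (l -` A m) a *\<^sub>R f a) \<longlonglongrightarrow> indicator (l -` (\<Union>m. A m)) a *\<^sub>R f a"
        unfolding scaleR_left.sum[symmetric] using ind
        by (intro AE_I2 tendsto_scaleR tendsto_const) (simp add: sums_def)
      show "AE a in lborel. norm (\<Sum>m<N. indicator (l -` A m) a *\<^sub>R f a) \<le> norm (f a)" for N
      proof (rule AE_I2)
        fix a
        have "(\<Sum>m<N. indicator (l -` A m) a :: real) \<le> indicator (l -` (\<Union>m. A m)) a"
          unfolding sums_unique[OF ind] using ind by (intro sum_le_suminf) (auto simp: sums_iff)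
        also have "\<dots> \<le> 1" by (simp add: indicator_def)
        finally show "norm (\<Sum>m<N. indicator (l -` A m) a *\<^sub>R f a) \<le> norm (f a)"
          unfolding scaleR_left.sum[symmetric] norm_scaleR
          by (intro mult_left_le_one_le) (auto simp: sum_nonneg)
      qed
    qed (use f in \<open>simp_all\<close>)
    have "integrable lborel (\<lambda>a. indicator (l -` A m) a *\<^sub>R f a)" for m
      by (rule Bochner_Integration.integrable_bound[OF f]) (auto simp: indicator_def)
    then have sum: "(\<Sum>m<N. l2_inner u (spectral_op U l (indicator (A m)) v))
        = (\<integral>a. (\<Sum>m<N. indicator (l -` A m) a *\<^sub>R f a) \<partial>lborel)" for N
      unfolding form[OF A] by (intro Bochner_Integration.integral_sum[symmetric])
    have "(\<Union>m. A m) \<in> sets borel"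
      by (intro sets.countable_UN) (use A in auto)
    from lim show "(\<lambda>m. l2_inner u (spectral_op U l (indicator (A m)) v)) sums
        l2_inner u (spectral_op U l (indicator (\<Union>m. A m)) v)"
      unfolding sums_def sum form[OF \<open>(\<Union>m. A m) \<in> sets borel\<close>] .
  qed
next
  show "Domain (spectral_graph U l) = {u. integrable (spectral_law u) (\<lambda>t. t\<^sup>2)}"
  proof (intro subset_antisym subsetI)
    fix u assume "u \<in> Domain (spectral_graph U l)"
    then obtain v where "AE a in lborel. rep_l2 (U v) a = of_real (l a) * rep_l2 (U u) a"
      by (auto simp: spectral_graph_def)
    then have "AE a in lborel. (cmod (rep_l2 (U v) a))\<^sup>2 = (cmod (rep_l2 (U u) a))\<^sup>2 *\<^sub>R (l a)\<^sup>2"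
      by eventually_elim (simp add: norm_mult power_mult_distrib)
    then have "integrable lborel (\<lambda>a. (cmod (rep_l2 (U u) a))\<^sup>2 *\<^sub>R (l a)\<^sup>2)"
      using integrable_rep_sq[of "U v"] by (subst (asm) integrable_cong_AE) auto
    then show "u \<in> {u. integrable (spectral_law u) (\<lambda>t. t\<^sup>2)}"
      by (simp add: integrable_spectral_law)
  next
    fix u assume "u \<in> {u. integrable (spectral_law u) (\<lambda>t. t\<^sup>2)}"
    then have "sq_integrable (\<lambda>a. of_real (l a) * rep_l2 (U u) a)"
      by (simp add: integrable_spectral_law sq_integrable_def norm_mult power_mult_distrib mult.commute)
    from in_spectral_graphI[OF this] show "u \<in> Domain (spectral_graph U l)"
      by blast
  qed
next
  have "l2_inner u v = of_real (\<integral>t. t \<partial>spectral_law u)" if "(u, v) \<in> spectral_graph U l" for u v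
  proof -
    have "l2_inner u v = l2_inner (U u) (U v)" by (simp add: unitary_inner[OF U])
    also have "\<dots> = (\<integral>a. of_real ((cmod (rep_l2 (U u) a))\<^sup>2 *\<^sub>R l a) \<partial>lborel)"
      unfolding l2_inner_eq
    proof (rule integral_cong_AE)
      have "AE a in lborel. rep_l2 (U v) a = of_real (l a) * rep_l2 (U u) a"
        using that by (simp add: spectral_graph_def)
      then show "AE a in lborel. cnj (rep_l2 (U u) a) * rep_l2 (U v) a = of_real ((cmod (rep_l2 (U u) a))\<^sup>2 *\<^sub>R l a)"
        by eventually_elim (simp add: complex_norm_square mult_ac del: of_real_power)
    qed simp_all
    finally show ?thesis
      unfolding integral_complex_of_real by (simp add: integral_spectral_law)
  qed
  then show "\<forall>(u, v)\<in>spectral_graph U l. l2_inner u v = of_real (\<integral>t. t \<partial>spectral_law u)"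
    by auto
qed

end


section \<open>Projection-valued measures\<close>

lemma l2_linear_simps:
  assumes "l2_linear S"
  shows "S (u + v) = S u + S v" "S (l2_scale c u) = l2_scale c (S u)" "S (u - v) = S u - S v"
proof -
  have "module_hom l2_scale l2_scale S"
    using assms by (simp add: module_hom_iff_linear)
  then show "S (u + v) = S u + S v" "S (l2_scale c u) = l2_scale c (S u)" "S (u - v) = S u - S v"
    by (simp_all add: module_hom.add module_hom.scale module_hom.diff)
qed

text \<open>By polarization.\<close>

lemma form_determines_operator:
  fixes S S' :: "'n::finite l2 \<Rightarrow> 'n l2"
  assumes S: "l2_linear S" and S': "l2_linear S'"
    and eq: "\<And>u. l2_inner u (S u) = l2_inner u (S' u)"
  shows "S = S'"
proof (rule ext, rule l2_inner_eqI)
  fix v u :: "'n l2"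
  have polar: "4 * l2_inner u (R v) = l2_inner (u + v) (R (u + v)) - l2_inner (u - v) (R (u - v))
      - \<i> * (l2_inner (u + l2_scale \<i> v) (R (u + l2_scale \<i> v)) - l2_inner (u - l2_scale \<i> v) (R (u - l2_scale \<i> v)))"
    if "l2_linear R" for R :: "'n l2 \<Rightarrow> 'n l2"
    by (simp add: l2_linear_simps[OF that] l2_inner_simps algebra_simps)
  have "4 * l2_inner u (S v) = 4 * l2_inner u (S' v)"
    unfolding polar[OF S] polar[OF S'] eq ..
  then show "l2_inner u (S v) = l2_inner u (S' v)" by simp
qed

context
  fixes E :: "real set \<Rightarrow> 'n::finite l2 \<Rightarrow> 'n l2"
  assumes E: "projection_valued_measure E"
begin

lemma pvm_linear: "A \<in> sets borel \<Longrightarrow> l2_linear (E A)"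
  and pvm_idem: "A \<in> sets borel \<Longrightarrow> E A (E A u) = E A u"
  and pvm_adjoint: "A \<in> sets borel \<Longrightarrow> l2_inner (E A u) v = l2_inner u (E A v)"
  and pvm_UNIV: "E UNIV u = u"
  using E unfolding projection_valued_measure_def by (auto simp: fun_eq_iff)

lemma pvm_sums:
  "range A \<subseteq> sets borel \<Longrightarrow> disjoint_family A \<Longrightarrow>
    (\<lambda>m. l2_inner u (E (A m) v)) sums l2_inner u (E (\<Union>m. A m) v)" for A :: "nat \<Rightarrow> real set"
  using E unfolding projection_valued_measure_def by blast

lemma pvm_form: "A \<in> sets borel \<Longrightarrow> l2_inner u (E A u) = of_real ((norm (E A u))\<^sup>2)"
  by (metis pvm_adjoint pvm_idem l2_inner_self_norm)

lemma pvm_empty: "E {} u = 0"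
proof -
  have "(\<lambda>m::nat. l2_inner (E {} u) (E {} u)) sums l2_inner (E {} u) (E {} u)"
    using pvm_sums[of "\<lambda>m. {}" "E {} u" u] by (simp add: disjoint_family_on_def)
  then have "l2_inner (E {} u) (E {} u) = 0"
    using sums_summable summable_const_iff by blast
  then show ?thesis by (simp add: l2_inner_self_eq_0)
qed

lemma pvm_Un:
  assumes "A \<in> sets borel" "B \<in> sets borel" "A \<inter> B = {}"
  shows "E (A \<union> B) u = E A u + E B u"
proof (rule l2_inner_eqI)
  fix v
  have "(\<lambda>m. l2_inner v (E (binaryset A B m) u)) sums l2_inner v (E (\<Union>m. binaryset A B m) u)"
    by (rule pvm_sums) (use assms in \<open>auto simp: disjoint_family_on_def binaryset_def\<close>)
  moreover have "(\<lambda>m. l2_inner v (E (binaryset A B m) u)) sums (l2_inner v (E A u) + l2_inner v (E B u))"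
    by (rule binaryset_sums) (simp add: pvm_empty)
  ultimately show "l2_inner v (E (A \<union> B) u) = l2_inner v (E A u + E B u)"
    by (metis UN_binaryset_eq l2_inner_add_right sums_unique2)
qed

lemma pvm_Compl: "A \<in> sets borel \<Longrightarrow> E (- A) u = u - E A u"
  using pvm_Un[of A "- A" u] by (simp add: pvm_UNIV borel_comp eq_diff_eq add.commute)

lemma pvm_mono_zero:
  assumes A: "A \<in> sets borel" and B: "B \<in> sets borel" and AB: "A \<subseteq> B" and zero: "E B u = 0"
  shows "E A u = 0"
proof -
  have "l2_inner u (E B u) = l2_inner u (E A u) + l2_inner u (E (B - A) u)"
    using pvm_Un[of A "B - A" u] A B AB by (simp add: Un_absorb1 l2_inner_add_right)
  then have "complex_of_real ((norm (E A u))\<^sup>2 + (norm (E (B - A) u))\<^sup>2) = 0"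
    using A B zero by (simp add: pvm_form del: of_real_power)
  then have "(norm (E A u))\<^sup>2 + (norm (E (B - A) u))\<^sup>2 = 0"
    by (simp only: of_real_eq_0_iff)
  then show ?thesis
    by (simp add: add_nonneg_eq_0_iff)
qed

text \<open>
  The projections of a projection-valued measure multiply: \<open>E I u\<close> has no component
  outside \<open>I\<close>, and \<open>u - E I u\<close> has none inside.
\<close>

lemma pvm_Int:
  assumes A: "A \<in> sets borel" and I: "I \<in> sets borel"
  shows "E A (E I u) = E (A \<inter> I) u"
proof -
  have "E (- I) (E I u) = 0"
    using I by (simp add: pvm_Compl pvm_idem)
  then have 1: "E (A - I) (E I u) = 0"
    by (rule pvm_mono_zero[rotated 3]) (use A I in \<open>auto simp: borel_comp\<close>)
  have "E I (u - E I u) = 0"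
    using I by (simp add: l2_linear_simps[OF pvm_linear] pvm_idem)
  then have 2: "E (A \<inter> I) (u - E I u) = 0"
    by (rule pvm_mono_zero[rotated 3]) (use A I in auto)
  have "E A (E I u) = E (A \<inter> I) (E I u) + E (A - I) (E I u)"
  proof -
    have "A \<inter> I \<inter> (A - I) = {}" by auto
    then show ?thesis
      using pvm_Un[of "A \<inter> I" "A - I" "E I u"] A I by (simp add: Int_Diff_Un)
  qed
  also have "\<dots> = E (A \<inter> I) u"
    using 1 2 A I by (simp add: l2_linear_simps[OF pvm_linear])
  finally show ?thesis .
qed

lemma sets_spectral_distr [simp, measurable_cong]: "sets (spectral_distr E u) = sets borel"
  unfolding spectral_distr_def by (simp add: sets.sigma_sets_eq[of borel, simplified])

lemma space_spectral_distr [simp]: "space (spectral_distr E u) = UNIV"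
  unfolding spectral_distr_def by simp

lemma emeasure_spectral_distr:
  assumes A: "A \<in> sets borel"
  shows "emeasure (spectral_distr E u) A = ennreal ((norm (E A u))\<^sup>2)"
proof -
  have Re: "Re (l2_inner u (E A u)) = (norm (E A u))\<^sup>2" if "A \<in> sets borel" for A
    unfolding pvm_form[OF that] Re_complex_of_real ..
  have sigma: "sigma_sets UNIV (sets borel) = (sets borel :: real set set)"
    using sets.sigma_sets_eq[of "borel :: real measure"] by simp
  have "emeasure (spectral_distr E u) A = ennreal (Re (l2_inner u (E A u)))"
  proof (rule emeasure_measure_of[OF spectral_distr_def])
    show "positive (sets (spectral_distr E u)) (\<lambda>A. ennreal (Re (l2_inner u (E A u))))"
      by (simp add: positive_def pvm_empty)
    show "countably_additive (sets (spectral_distr E u)) (\<lambda>A. ennreal (Re (l2_inner u (E A u))))"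
      unfolding sets_spectral_distr
    proof (rule countably_additiveI)
      fix A :: "nat \<Rightarrow> real set"
      assume A: "range A \<subseteq> sets borel" "disjoint_family A"
      have "(\<lambda>m. Re (l2_inner u (E (A m) u))) sums Re (l2_inner u (E (\<Union>m. A m) u))"
        by (rule sums_Re[OF pvm_sums[OF A]])
      then show "(\<Sum>m. ennreal (Re (l2_inner u (E (A m) u)))) = ennreal (Re (l2_inner u (E (\<Union>m. A m) u)))"
        using A(1) by (intro suminf_ennreal_eq) (auto simp: Re)
    qed
  qed (use A in auto)
  then show ?thesis
    using A by (simp add: Re)
qed

lemma finite_spectral_distr: "finite_measure (spectral_distr E u)"
  by (rule finite_measureI) (simp add: emeasure_spectral_distr)

lemma spectral_distr_restrict:
  assumes I: "I \<in> sets borel"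
  shows "spectral_distr E (E I u) = density (spectral_distr E u) (indicator I)"
proof (rule measure_eqI)
  fix A assume "A \<in> sets (spectral_distr E (E I u))"
  then have A: "A \<in> sets borel" by simp
  have "emeasure (density (spectral_distr E u) (indicator I)) A
      = emeasure (spectral_distr E u) (A \<inter> I)"
    using A I by (subst emeasure_restricted) (simp_all add: Int_commute)
  also have "\<dots> = ennreal ((norm (E (A \<inter> I) u))\<^sup>2)"
    using A I by (simp add: emeasure_spectral_distr)
  finally show "emeasure (spectral_distr E (E I u)) A = emeasure (density (spectral_distr E u) (indicator I)) A"
    using A I by (simp add: emeasure_spectral_distr pvm_Int)
qed simp

lemma integral_spectral_distr_restrict:
  fixes f :: "real \<Rightarrow> real"
  assumes I: "I \<in> sets borel" and f: "f \<in> borel_measurable borel"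
  shows "(\<integral>t. f t \<partial>spectral_distr E (E I u)) = (\<integral>t. indicator I t * f t \<partial>spectral_distr E u)"
proof -
  have d: "density (spectral_distr E u) (indicator I) = density (spectral_distr E u) (\<lambda>t. ennreal (indicator I t))"
    by (simp add: ennreal_indicator)
  show ?thesis
    unfolding spectral_distr_restrict[OF I] d
    by (subst integral_density) (use I f in auto)
qed

end

text \<open>
  A bound of the quadratic form of a symmetric operator bounds the operator: polarize with the
  multiple \<open>y\<close> of \<open>S w\<close> that has the same norm as \<open>w\<close>, and use the parallelogram law. The operator
  is only required to act on a subspace because the lemma is applied to the part of an unbounded
  operator in a spectral subspace.
\<close>

lemma symmetric_norm_le_form:
  fixes w :: "'n::finite l2"
  assumes R: "l2.subspace R" and S: "\<And>w. w \<in> R \<Longrightarrow> S w \<in> R"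
    and lin: "\<And>v w. v \<in> R \<Longrightarrow> w \<in> R \<Longrightarrow> S (v + w) = S v + S w"
      "\<And>c w. w \<in> R \<Longrightarrow> S (l2_scale c w) = l2_scale c (S w)"
    and sym: "\<And>v w. v \<in> R \<Longrightarrow> w \<in> R \<Longrightarrow> l2_inner v (S w) = l2_inner (S v) w"
    and form: "\<And>w. w \<in> R \<Longrightarrow> cmod (l2_inner w (S w)) \<le> d * (norm w)\<^sup>2"
    and w: "w \<in> R"
  shows "norm (S w) \<le> d * norm w"
proof (cases "w = 0 \<or> S w = 0")
  case True
  have d: "d \<ge> 0" if "w \<noteq> 0"
    using order_trans[OF norm_ge_zero form[OF w]] that by (simp add: zero_le_mult_iff)
  have "S 0 = 0"
    using lin(2)[OF l2.subspace_0[OF R], of 0] by simp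
  with True d show ?thesis by (cases "w = 0") auto
next
  case False
  define r where "r = norm w / norm (S w)"
  define y where "y = l2_scale (of_real r) (S w)"
  have y: "y \<in> R"
    by (simp add: y_def l2.subspace_scale[OF R] S w)
  have norm_y: "norm y = norm w"
    using False by (simp add: y_def r_def norm_divide)
  define z where "z = - y"
  have z: "z \<in> R" by (simp add: z_def l2.subspace_neg[OF R] y)
  have Sz: "S z = - S y"
    using lin(2)[OF y, of "-1"] by (simp add: z_def)
  have cross: "l2_inner y (S w) = of_real (norm w * norm (S w))" "l2_inner w (S y) = of_real (norm w * norm (S w))"
  proof -
    show "l2_inner y (S w) = of_real (norm w * norm (S w))"
      using False by (simp add: y_def l2_inner_simps l2_inner_self_norm r_def power2_eq_square)
    then show "l2_inner w (S y) = of_real (norm w * norm (S w))"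
      unfolding sym[OF w y] l2_inner_commute[of "S w" y] by simp
  qed
  have "l2_inner (w + y) (S (w + y)) - l2_inner (w + z) (S (w + z)) = of_real (4 * (norm w * norm (S w)))"
    unfolding lin(1)[OF w y] lin(1)[OF w z] Sz using cross
    by (simp add: z_def l2_inner_simps)
  then have "4 * (norm w * norm (S w)) = cmod (l2_inner (w + y) (S (w + y)) - l2_inner (w + z) (S (w + z)))"
    by (simp add: norm_mult)
  also have "\<dots> \<le> d * (norm (w + y))\<^sup>2 + d * (norm (w + z))\<^sup>2"
    by (rule order_trans[OF norm_triangle_ineq4]) (intro add_mono form l2.subspace_add[OF R] w y z)
  also have "\<dots> = d * (2 * (norm w)\<^sup>2 + 2 * (norm y)\<^sup>2)"
    by (simp add: z_def power2_norm_eq_inner inner_add_left inner_add_right inner_diff_left inner_diff_right algebra_simps)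
  finally have "norm w * norm (S w) \<le> norm w * (d * norm w)"
    unfolding norm_y by (simp add: power2_eq_square mult_ac)
  then show ?thesis using False by simp
qed

section \<open>Functional calculus of a diagonalised operator\<close>

context
  fixes U :: "'n::finite l2 \<Rightarrow> 'n l2" and l :: "real^'n \<Rightarrow> real" and E :: "real set \<Rightarrow> 'n l2 \<Rightarrow> 'n l2"
  assumes U: "unitary U" and l [measurable]: "l \<in> borel_measurable borel"
    and spec: "spectral_measure (spectral_graph U l) E"
begin

lemma pvm: "projection_valued_measure E"
  using spec by (simp add: spectral_measure_def)

lemma domain_iff: "u \<in> Domain (spectral_graph U l) \<longleftrightarrow> integrable (spectral_distr E u) (\<lambda>t. t\<^sup>2)"
  using spec by (auto simp: spectral_measure_def)

lemma form_eq: "(u, v) \<in> spectral_graph U l \<Longrightarrow> l2_inner u v = of_real (\<integral>t. t \<partial>spectral_distr E u)"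
  using spec by (auto simp: spectral_measure_def)

lemma integrable_id:
  assumes "integrable (spectral_distr E u) (\<lambda>t. t\<^sup>2)"
  shows "integrable (spectral_distr E u) (\<lambda>t. t)"
proof -
  interpret finite_measure "spectral_distr E u"
    by (rule finite_spectral_distr[OF pvm])
  show ?thesis
  proof (rule Bochner_Integration.integrable_bound)
    show "integrable (spectral_distr E u) (\<lambda>t. 1 + t\<^sup>2)"
      using assms by simp
    have "\<bar>t\<bar> \<le> 1 + t\<^sup>2" for t :: real
      using sum_squares_bound[of 1 "\<bar>t\<bar>"] by simp
    then show "AE t in spectral_distr E u. norm t \<le> norm (1 + t\<^sup>2)"
      by (intro AE_I2) (simp add: abs_of_nonneg add_nonneg_nonneg)
  qed (simp add: measurable_cong_sets[OF sets_spectral_distr[OF pvm]])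
qed

text \<open>
  The spectral distribution of \<open>v + w\<close> is the sum of those of \<open>v\<close> and
  \<open>w\<close>, as they live on disjoint sets, so the quadratic form has no cross term.
\<close>

lemma form_splits:
  assumes I: "I \<in> sets borel" and w: "(w, Tw) \<in> spectral_graph U l" "E I w = w"
    and v: "(v, Tv) \<in> spectral_graph U l" "E I v = 0"
  shows "Re (l2_inner v Tw) = 0"
proof -
  have B: "- I \<in> sets borel" using I by (rule borel_comp)
  have sum: "(v + w, Tv + Tw) \<in> spectral_graph U l"
    by (rule spectral_graph_add[OF U l v(1) w(1)])
  then have i: "integrable (spectral_distr E (v + w)) (\<lambda>t. t)"
    by (intro integrable_id) (auto simp: domain_iff[symmetric])
  have EI: "E I (v + w) = w" "E (- I) (v + w) = v"
    using w v by (simp_all add: pvm_Compl[OF pvm I] l2_linear_simps[OF pvm_linear[OF pvm I]])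
  have ii: "integrable (spectral_distr E (v + w)) (\<lambda>t. indicator A t * t)" if "A \<in> sets borel" for A
    by (rule Bochner_Integration.integrable_bound[OF i])
       (use that in \<open>auto simp: indicator_def measurable_cong_sets[OF sets_spectral_distr[OF pvm]]\<close>)
  have "(\<integral>t. t \<partial>spectral_distr E (v + w))
      = (\<integral>t. indicator I t * t + indicator (- I) t * t \<partial>spectral_distr E (v + w))"
    by (rule Bochner_Integration.integral_cong) (auto simp: indicator_def)
  also have "\<dots> = (\<integral>t. t \<partial>spectral_distr E w) + (\<integral>t. t \<partial>spectral_distr E v)"
    using integral_spectral_distr_restrict[OF pvm I, of "\<lambda>t. t" "v + w"]
      integral_spectral_distr_restrict[OF pvm B, of "\<lambda>t. t" "v + w"]
    by (subst Bochner_Integration.integral_add[OF ii[OF I] ii[OF B]]) (simp add: EI)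
  finally have "l2_inner (v + w) (Tv + Tw) = l2_inner w Tw + l2_inner v Tv"
    unfolding form_eq[OF sum] form_eq[OF v(1)] form_eq[OF w(1)] by simp
  moreover have "l2_inner w Tv = cnj (l2_inner v Tw)"
    unfolding spectral_graph_symmetric[OF U l w(1) v(1)] by (rule l2_inner_commute)
  ultimately have "l2_inner v Tw + cnj (l2_inner v Tw) = 0"
    by (simp add: l2_inner_simps add.commute)
  then show ?thesis
    by (simp add: complex_add_cnj)
qed

text \<open>
  A spectral measure is tied to its operator by second and first moments only, and its uniqueness
  takes an argument. Let \<open>w\<close> be in the range of the projection to the interval with centre \<open>m\<close>
  and radius \<open>d\<close>. The operator maps this range into itself, and minus \<open>m\<close> it is bounded by \<open>d\<close> there.
  By iteration, \<open>(l - m) ^ j\<close> times \<open>U w\<close> has norm at most \<open>d ^ j * norm w\<close> for all \<open>j\<close>, which is possible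
  only if \<open>U w\<close> vanishes where \<open>\<bar>l - m\<bar> > d\<close>. So the range consists of vectors that \<open>U\<close> localises where
  \<open>l\<close> has its values in the interval.
\<close>

context
  fixes m d :: real
  assumes d: "d \<ge> 0"
begin

abbreviation (input) "window \<equiv> {m - d..m + d}"

lemma window_integral_bound:
  assumes w: "E window w = w"
  shows "integrable (spectral_distr E w) (\<lambda>t. t\<^sup>2)"
    and "\<bar>(\<integral>t. t \<partial>spectral_distr E w) - m * (norm w)\<^sup>2\<bar> \<le> d * (norm w)\<^sup>2"
proof -
  interpret finite_measure "spectral_distr E w"
    by (rule finite_spectral_distr[OF pvm])
  have sets: "sets (spectral_distr E w) = sets borel"
    by (rule sets_spectral_distr[OF pvm])
  have "emeasure (spectral_distr E w) (- window) = 0"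
    using w by (simp add: emeasure_spectral_distr[OF pvm] pvm_Compl[OF pvm])
  then have AE: "AE t in spectral_distr E w. t \<in> window"
    by (intro AE_I[of _ _ "- window"]) (auto simp: sets)
  have meas: "(\<lambda>t. t) \<in> borel_measurable (spectral_distr E w)" "(\<lambda>t. t\<^sup>2) \<in> borel_measurable (spectral_distr E w)"
    by (simp_all add: measurable_cong_sets[OF sets])
  have mass: "measure (spectral_distr E w) (space (spectral_distr E w)) = (norm w)\<^sup>2"
    by (simp add: measure_def space_spectral_distr[OF pvm] emeasure_spectral_distr[OF pvm] pvm_UNIV[OF pvm])
  have abs: "\<bar>t\<bar> \<le> \<bar>m\<bar> + d" if "t \<in> window" for t
    using that by auto
  show sq: "integrable (spectral_distr E w) (\<lambda>t. t\<^sup>2)"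
  proof (rule integrable_const_bound[where B = "(\<bar>m\<bar> + d)\<^sup>2"])
    show "AE t in spectral_distr E w. norm (t\<^sup>2) \<le> (\<bar>m\<bar> + d)\<^sup>2"
      using AE by eventually_elim (use abs in \<open>simp add: abs_le_square_iff[symmetric]\<close>)
  qed (rule meas)
  have id: "integrable (spectral_distr E w) (\<lambda>t. t)"
    by (rule integrable_id[OF sq])
  have "(\<integral>t. t \<partial>spectral_distr E w) - m * (norm w)\<^sup>2 = (\<integral>t. t - m \<partial>spectral_distr E w)"
    using id by (simp add: mass)
  also have "\<bar>\<dots>\<bar> \<le> (\<integral>t. \<bar>t - m\<bar> \<partial>spectral_distr E w)"
    by (rule integral_abs_bound)
  also have "\<dots> \<le> (\<integral>t. d \<partial>spectral_distr E w)"
  proof (rule integral_mono_AE)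
    show "AE t in spectral_distr E w. \<bar>t - m\<bar> \<le> d"
      using AE by eventually_elim auto
  qed (use id in auto)
  also have "\<dots> = d * (norm w)\<^sup>2"
    by (simp add: mass)
  finally show "\<bar>(\<integral>t. t \<partial>spectral_distr E w) - m * (norm w)\<^sup>2\<bar> \<le> d * (norm w)\<^sup>2" .
qed

text \<open>
  For \<open>w\<close> in the range, \<open>Tw\<close> is orthogonal to every vector of the domain
  that the projection annihilates. Hence the component of \<open>Tw\<close> outside the range is
  orthogonal to the whole domain, and a self-adjoint operator has no such vector but zero.
\<close>

lemma window_invariant:
  assumes w: "E window w = w" and T: "(w, Tw) \<in> spectral_graph U l"
  shows "E window Tw = Tw"
proof -
  have W: "window \<in> sets borel" by simp
  have zero: "l2_inner v Tw = 0" if v: "(v, Tv) \<in> spectral_graph U l" "E window v = 0" for v Tv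
  proof -
    have "Re (l2_inner v Tw) = 0"
      by (rule form_splits[OF W T w v])
    moreover have "Re (l2_inner v (l2_scale \<i> Tw)) = 0"
      by (rule form_splits[OF W spectral_graph_scale[OF U l T] _ v])
         (simp add: w l2_linear_simps[OF pvm_linear[OF pvm W]])
    ultimately show ?thesis
      by (simp add: l2_inner_simps complex_eq_iff)
  qed
  define z where "z = Tw - E window Tw"
  have "l2_inner z f = 0" if f: "(f, g) \<in> spectral_graph U l" for f g
  proof -
    have "E window (E window f) = E window f"
      by (rule pvm_idem[OF pvm W])
    from window_integral_bound(1)[OF this] obtain h where "(E window f, h) \<in> spectral_graph U l"
      by (auto simp: domain_iff[symmetric])
    from zero[OF spectral_graph_diff[OF U l f this]]
    have "l2_inner (f - E window f) Tw = 0"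
      by (simp add: l2_linear_simps[OF pvm_linear[OF pvm W]] pvm_idem[OF pvm W])
    then have "l2_inner f z = 0"
      by (simp add: z_def l2_inner_simps pvm_adjoint[OF pvm W])
    then show ?thesis
      using l2_inner_commute[of z f] by simp
  qed
  then have "(0, z) \<in> adjoint_graph (spectral_graph U l)"
    by (auto simp: adjoint_graph_def)
  then have "(0, z) \<in> spectral_graph U l"
    using self_adjoint_spectral_graph[OF U l] by (simp add: self_adjoint_def)
  moreover have "(0, 0) \<in> spectral_graph U l"
    using spectral_graph_scale[OF U l T, of 0] by simp
  ultimately have "z = 0"
    using single_valued_spectral_graph[OF U l] by (auto dest: single_valuedD)
  then show ?thesis by (simp add: z_def)
qed

lemma window_shift_bound:
  assumes w: "E window w = w"
  shows "\<exists>w'. E window w' = w' \<and> norm w' \<le> d * norm w \<and>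
    (AE a in lborel. rep_l2 (U w') a = of_real (l a - m) * rep_l2 (U w) a)"
proof -
  have W: "window \<in> sets borel" by simp
  define R where "R = {w. E window w = w}"
  note lin = l2_linear_simps[OF pvm_linear[OF pvm W]]
  have R: "l2.subspace R"
  proof (rule l2.subspaceI)
    show "0 \<in> R" using lin(2)[of 0 0] by (simp add: R_def)
  qed (simp_all add: R_def lin)
  have "\<exists>v. (w, v) \<in> spectral_graph U l" if "w \<in> R" for w
    using window_integral_bound(1)[of w] that by (auto simp: R_def domain_iff[symmetric])
  then obtain T where T: "\<And>w. w \<in> R \<Longrightarrow> (w, T w) \<in> spectral_graph U l"
    by metis
  have T_unique: "v = T w" if "w \<in> R" "(w, v) \<in> spectral_graph U l" for v w
    using single_valuedD[OF single_valued_spectral_graph[OF U l] that(2) T[OF that(1)]] .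
  have TR: "T w \<in> R" if "w \<in> R" for w
    using window_invariant[OF _ T[OF that]] that by (simp add: R_def)
  have T_add: "T (v + w) = T v + T w" if "v \<in> R" "w \<in> R" for v w
    by (rule T_unique[symmetric]) (intro l2.subspace_add[OF R] spectral_graph_add[OF U l] T that)+
  have T_scale: "T (l2_scale c w) = l2_scale c (T w)" if "w \<in> R" for c w
    by (rule T_unique[symmetric]) (intro l2.subspace_scale[OF R] spectral_graph_scale[OF U l] T that)+
  define S where "S w = T w - l2_scale (of_real m) w" for w
  have "norm (S w) \<le> d * norm w"
  proof (rule symmetric_norm_le_form[OF R])
    show "S w \<in> R" if "w \<in> R" for w
      unfolding S_def by (intro l2.subspace_diff[OF R] l2.subspace_scale[OF R] TR that)
    show "S (v + w) = S v + S w" if "v \<in> R" "w \<in> R" for v w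
      by (simp add: S_def T_add that l2.scale_right_distrib)
    show "S (l2_scale c w) = l2_scale c (S w)" if "w \<in> R" for c w
      by (simp add: S_def T_scale that l2.scale_right_diff_distrib mult.commute)
    show "l2_inner v (S w) = l2_inner (S v) w" if "v \<in> R" "w \<in> R" for v w
      using spectral_graph_symmetric[OF U l T T, OF that] by (simp add: S_def l2_inner_simps)
    show "cmod (l2_inner w (S w)) \<le> d * (norm w)\<^sup>2" if "w \<in> R" for w
    proof -
      have "l2_inner w (S w) = of_real ((\<integral>t. t \<partial>spectral_distr E w) - m * (norm w)\<^sup>2)"
        by (simp add: S_def l2_inner_simps form_eq[OF T[OF that]] l2_inner_self_norm)
      then show ?thesis
        using window_integral_bound(2)[of w] that by (simp add: R_def del: of_real_diff)
    qed
    show "w \<in> R" using w by (simp add: R_def)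
  qed
  moreover have "S w \<in> R"
    unfolding S_def using w by (intro l2.subspace_diff[OF R] l2.subspace_scale[OF R] TR) (simp_all add: R_def)
  moreover have "AE a in lborel. rep_l2 (U (S w)) a = of_real (l a - m) * rep_l2 (U w) a"
  proof -
    have "w \<in> R" using w by (simp add: R_def)
    from T[OF this] have "AE a in lborel. rep_l2 (U (T w)) a = of_real (l a) * rep_l2 (U w) a"
      by (simp add: spectral_graph_def)
    then show ?thesis
      using rep_minus[of "U (T w)" "l2_scale (of_real m) (U w)"] rep_scale[of "of_real m" "U w"]
      unfolding S_def unitary_linear[OF U] by eventually_elim (simp add: left_diff_distrib)
  qed
  ultimately show ?thesis
    by (intro exI[of _ "S w"]) (simp add: R_def)
qed

lemma window_iterate_bound:
  assumes w: "E window w = w"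
  shows "\<exists>w'. E window w' = w' \<and> norm w' \<le> d ^ j * norm w \<and>
    (AE a in lborel. rep_l2 (U w') a = of_real ((l a - m) ^ j) * rep_l2 (U w) a)"
proof (induction j)
  case 0
  show ?case using w by (intro exI[of _ w]) simp
next
  case (Suc j)
  then obtain v where v: "E window v = v" "norm v \<le> d ^ j * norm w"
    and v': "AE a in lborel. rep_l2 (U v) a = of_real ((l a - m) ^ j) * rep_l2 (U w) a"
    by blast
  obtain w' where w': "E window w' = w'" "norm w' \<le> d * norm v"
    "AE a in lborel. rep_l2 (U w') a = of_real (l a - m) * rep_l2 (U v) a"
    using window_shift_bound[OF v(1)] by blast
  have "norm w' \<le> d ^ Suc j * norm w"
    using order_trans[OF w'(2) mult_left_mono[OF v(2) d]] by (simp add: mult.assoc)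
  moreover have "AE a in lborel. rep_l2 (U w') a = of_real ((l a - m) ^ Suc j) * rep_l2 (U w) a"
    using w'(3) v' by eventually_elim (simp add: mult.assoc del: of_real_diff)
  ultimately show ?case using w'(1) by blast
qed

text \<open>
  Where \<open>\<bar>l - m\<bar> \<ge> e > d\<close>, the mass of \<open>U w\<close> is at most
  \<open>(d / e) ^ (2 * j) * (norm w)\<^sup>2\<close> for all \<open>j\<close>.
\<close>

lemma window_localised:
  assumes w: "E window w = w"
  shows "AE a in lborel. l a \<notin> window \<longrightarrow> rep_l2 (U w) a = 0"
proof -
  have "AE a in lborel. d + 1 / real (Suc N) \<le> \<bar>l a - m\<bar> \<longrightarrow> rep_l2 (U w) a = 0" for N
  proof -
    define e where "e = d + 1 / real (Suc N)"
    have e: "e > 0" "d < e" using d by (auto simp: e_def intro: add_nonneg_pos)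
    define G where "G = {a. e \<le> \<bar>l a - m\<bar>}"
    have [measurable]: "G \<in> sets borel" unfolding G_def by measurable
    have i: "integrable lborel (\<lambda>a. indicator G a * (cmod (rep_l2 (U w) a))\<^sup>2)"
      by (rule Bochner_Integration.integrable_bound[OF integrable_rep_sq[of "U w"]]) (auto simp: indicator_def)
    define c where "c = (\<integral>a. indicator G a * (cmod (rep_l2 (U w) a))\<^sup>2 \<partial>lborel)"
    have bound: "c \<le> ((d / e)\<^sup>2) ^ j * (norm w)\<^sup>2" for j
    proof -
      obtain w' where w': "norm w' \<le> d ^ j * norm w"
        "AE a in lborel. rep_l2 (U w') a = of_real ((l a - m) ^ j) * rep_l2 (U w) a"
        using window_iterate_bound[OF w, of j] by blast
      have "(e ^ j)\<^sup>2 * c = (\<integral>a. (e ^ j)\<^sup>2 * (indicator G a * (cmod (rep_l2 (U w) a))\<^sup>2) \<partial>lborel)"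
        by (simp add: c_def)
      also have "\<dots> \<le> (\<integral>a. (cmod (rep_l2 (U w') a))\<^sup>2 \<partial>lborel)"
      proof (rule integral_mono_AE)
        show "AE a in lborel. (e ^ j)\<^sup>2 * (indicator G a * (cmod (rep_l2 (U w) a))\<^sup>2) \<le> (cmod (rep_l2 (U w') a))\<^sup>2"
          using w'(2)
        proof eventually_elim
          case (elim a)
          show ?case
          proof (cases "a \<in> G")
            case True
            then have "e ^ j * cmod (rep_l2 (U w) a) \<le> \<bar>l a - m\<bar> ^ j * cmod (rep_l2 (U w) a)"
              using e by (intro mult_right_mono power_mono) (auto simp: G_def)
            then have "(e ^ j * cmod (rep_l2 (U w) a))\<^sup>2 \<le> (cmod (rep_l2 (U w') a))\<^sup>2"
              using e unfolding elim by (intro power_mono) (auto simp: norm_mult norm_power power_abs simp del: of_real_power of_real_diff)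
            then show ?thesis using True by (simp add: power_mult_distrib)
          qed simp
        qed
      qed (use i in \<open>simp_all add: integrable_rep_sq\<close>)
      also have "\<dots> = (norm w')\<^sup>2"
        unfolding l2_norm_sq[symmetric] unitary_norm[OF U] ..
      also have "\<dots> \<le> (d ^ j * norm w)\<^sup>2"
        by (intro power_mono w') simp
      finally show ?thesis
        using e by (simp add: power_divide power_mult_distrib field_simps power_mult[symmetric] mult.commute)
    qed
    have "(\<lambda>j. ((d / e)\<^sup>2) ^ j * (norm w)\<^sup>2) \<longlonglongrightarrow> 0"
      by (intro tendsto_mult_left_zero LIMSEQ_power_zero) (use d e in \<open>simp add: power_less_one_iff abs_square_less_1\<close>)
    then have "c \<le> 0"
      by (rule LIMSEQ_le_const) (use bound in auto)
    moreover have "c \<ge> 0"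
      unfolding c_def by simp
    ultimately have "c = 0" by simp
    then have "AE a in lborel. indicator G a * (cmod (rep_l2 (U w) a))\<^sup>2 = 0"
      using integral_nonneg_eq_0_iff_AE[OF i] by (simp add: c_def)
    then show ?thesis
      by eventually_elim (auto simp: G_def e_def)
  qed
  then have "AE a in lborel. \<forall>N. d + 1 / real (Suc N) \<le> \<bar>l a - m\<bar> \<longrightarrow> rep_l2 (U w) a = 0"
    unfolding AE_all_countable by blast
  then show ?thesis
  proof eventually_elim
    case (elim a)
    show ?case
    proof
      assume "l a \<notin> window"
      then have "\<bar>l a - m\<bar> - d > 0" by auto
      then obtain N where "inverse (real (Suc N)) < \<bar>l a - m\<bar> - d"
        using reals_Archimedean by blast
      then have "d + 1 / real (Suc N) \<le> \<bar>l a - m\<bar>"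
        by (simp add: inverse_eq_divide)
      with elim show "rep_l2 (U w) a = 0" by blast
    qed
  qed
qed

end

text \<open>
  The localisation passes from closed intervals inside \<open>C\<close> to countable unions, by
  countable additivity.
\<close>

lemma localised_countable_union:
  assumes C [measurable]: "C \<in> sets borel" and A: "\<And>N. A N \<in> sets borel" "\<And>N::nat. A N \<subseteq> {x N..y N}" "\<And>N. {x N..y N} \<subseteq> C"
  shows "AE a in lborel. l a \<notin> C \<longrightarrow> rep_l2 (U (E (\<Union>N. A N) u)) a = 0"
proof -
  define D where "D = disjointed A"
  have D: "D N \<in> sets borel" "D N \<subseteq> A N" for N
    using sets.range_disjointed_sets[of A borel] A(1) disjointed_subset[of A N] by (auto simp: D_def)
  define P where "P = mult_op (\<lambda>a. indicator (- C) (l a))"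
  have b: "bounded_borel (\<lambda>a. indicator (- C) (l a))"
    by (intro bounded_borel_compose[OF bounded_borel_indicator l] borel_comp C)
  have piece: "P (U (E (D N) v)) = 0" for N v
  proof -
    \<comment> \<open>the interval in terms of its centre and radius\<close>
    define J where "J = {(x N + y N) / 2 - (y N - x N) / 2..(x N + y N) / 2 + (y N - x N) / 2}"
    have J: "J = {x N..y N}" by (simp add: J_def field_simps)
    have sub: "D N \<subseteq> {x N..y N}" using D(2) A(2) by blast
    show ?thesis
    proof (cases "x N \<le> y N")
      case True
      have "E J (E (D N) v) = E (D N) v"
        using pvm_Int[OF pvm _ D(1)[of N], of J v] sub by (simp add: J Int_absorb1)
      then have "AE a in lborel. l a \<notin> J \<longrightarrow> rep_l2 (U (E (D N) v)) a = 0"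
        unfolding J_def by (intro window_localised) (use True in simp_all)
      then have "AE a in lborel. rep_l2 (P (U (E (D N) v))) a = rep_l2 0 a"
        using rep_mult_op[OF b, of "U (E (D N) v)"] rep_zero unfolding P_def
      proof eventually_elim
        case (elim a)
        then show ?case using A(3)[of N] by (auto simp: indicator_def J)
      qed
      then show ?thesis by (simp add: l2_eq_iff)
    next
      case False
      then have "D N = {}" using sub by auto
      then show ?thesis
        using mult_op_linear(2)[OF b, of 0 0] by (simp add: pvm_empty[OF pvm] unitary_linear[OF U] P_def)
    qed
  qed
  have zero: "P (U (E (\<Union>N. A N) u)) = 0"
  proof (rule l2_inner_eqI)
    fix v
    have form: "l2_inner v (P (U z)) = l2_inner (inv U (P v)) z" for z
    proof -
      have "(\<lambda>a. cnj (indicator (- C) (l a)) :: complex) = (\<lambda>a. indicator (- C) (l a))"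
        by (auto simp: indicator_def)
      then have "l2_inner v (P (U z)) = l2_inner (P v) (U z)"
        using inner_mult_op_adjoint[OF b, of v "U z"] by (simp add: P_def)
      also have "\<dots> = l2_inner (inv U (P v)) z"
        using unitary_inner[OF U, of "inv U (P v)" z] by (simp add: unitary_inv[OF U])
      finally show ?thesis .
    qed
    have "(\<lambda>N. l2_inner (inv U (P v)) (E (D N) u)) sums l2_inner (inv U (P v)) (E (\<Union>N. D N) u)"
      by (rule pvm_sums[OF pvm]) (use D in \<open>auto simp: D_def disjoint_family_disjointed\<close>)
    moreover have "(\<lambda>N. l2_inner (inv U (P v)) (E (D N) u)) sums 0"
      by (simp add: form[symmetric] piece)
    moreover have "(\<Union>N. D N) = (\<Union>N. A N)"
      by (simp add: D_def UN_disjointed_eq)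
    ultimately show "l2_inner v (P (U (E (\<Union>N. A N) u))) = l2_inner v 0"
      unfolding form using sums_unique2 by fastforce
  qed
  show ?thesis
    using rep_mult_op[OF b, of "U (E (\<Union>N. A N) u)"] rep_zero unfolding zero[unfolded P_def]
    by eventually_elim (auto simp: indicator_def)
qed

text \<open>
  Both the half line and its complement are exhausted by closed intervals. So the two components
  of \<open>u\<close> are localised where \<open>l > x\<close> and where \<open>l \<le> x\<close>,
  which determines them.
\<close>

lemma pvm_half_line: "E {x<..} u = spectral_op U l (indicator {x<..}) u"
proof -
  have pos: "x < x + 1 / real (Suc N)" for N by simp
  have upper_sub: "{x + 1 / real (Suc N)..x + real N + 1} \<subseteq> {x<..}" for N
    using less_le_trans[OF pos[of N]] by (auto simp del: of_nat_Suc)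
  have upper_eq: "(\<Union>N::nat. {x + 1 / real (Suc N)..x + real N + 1}) = {x<..}"
  proof (intro subset_antisym subsetI)
    fix t assume t: "t \<in> {x<..}"
    then obtain N where N: "inverse (real (Suc N)) < t - x"
      using reals_Archimedean[of "t - x"] by auto
    obtain M :: nat where M: "t - x \<le> real M"
      using real_arch_simple by blast
    have "1 / real (Suc (max N M)) \<le> 1 / real (Suc N)"
      by (intro divide_left_mono) auto
    then have "t \<in> {x + 1 / real (Suc (max N M))..x + real (max N M) + 1}"
      using N M by (auto simp: inverse_eq_divide)
    then show "t \<in> (\<Union>N::nat. {x + 1 / real (Suc N)..x + real N + 1})" by blast
  qed (use upper_sub in blast)
  have lower_eq: "(\<Union>N::nat. {x - real N..x}) = {..x}"
  proof (intro subset_antisym subsetI)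
    fix t assume t: "t \<in> {..x}"
    obtain M :: nat where "x - t \<le> real M"
      using real_arch_simple by blast
    with t have "t \<in> {x - real M..x}" by auto
    then show "t \<in> (\<Union>N::nat. {x - real N..x})" by blast
  qed auto
  have "AE a in lborel. l a \<notin> {x<..} \<longrightarrow> rep_l2 (U (E (\<Union>N::nat. {x + 1 / real (Suc N)..x + real N + 1}) u)) a = 0"
    by (rule localised_countable_union[OF _ _ order_refl upper_sub]) auto
  then have upper: "AE a in lborel. l a \<notin> {x<..} \<longrightarrow> rep_l2 (U (E {x<..} u)) a = 0"
    unfolding upper_eq .
  have "AE a in lborel. l a \<notin> {..x} \<longrightarrow> rep_l2 (U (E (\<Union>N::nat. {x - real N..x}) u)) a = 0"
    by (rule localised_countable_union[OF _ _ order_refl]) auto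
  then have lower: "AE a in lborel. l a \<notin> {..x} \<longrightarrow> rep_l2 (U (E {..x} u)) a = 0"
    unfolding lower_eq .
  have "- {x<..} = {..x}" by auto
  then have Ex: "E {..x} u = u - E {x<..} u"
    using pvm_Compl[OF pvm, of "{x<..}" u] by simp
  have lower': "AE a in lborel. l a \<notin> {..x} \<longrightarrow> rep_l2 (U u) a = rep_l2 (U (E {x<..} u)) a"
    using lower rep_minus[of "U u" "U (E {x<..} u)"] unfolding Ex unitary_linear[OF U]
    by eventually_elim auto
  have b: "bounded_borel (\<lambda>a. indicator {x<..} (l a))"
    by (intro bounded_borel_compose[OF bounded_borel_indicator l]) simp
  have "U (E {x<..} u) = mult_op (\<lambda>a. indicator {x<..} (l a)) (U u)"
    unfolding l2_eq_iff using upper lower' rep_mult_op[OF b, of "U u"]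
    by eventually_elim (auto simp: indicator_def)
  from arg_cong[OF this, of "inv U"] show ?thesis
    by (simp add: spectral_op_def unitary_inv[OF U])
qed

lemma spectral_distr_unique: "spectral_distr E u = spectral_law U l u"
proof -
  note pvm' = spectral_measure_exists[OF U l, unfolded spectral_measure_def, THEN conjunct2, THEN conjunct1]
  have "spectral_distr E u = spectral_distr (\<lambda>A. spectral_op U l (indicator A)) u"
    by (rule measure_eqI_lessThan)
       (simp_all add: emeasure_spectral_distr[OF pvm] emeasure_spectral_distr[OF pvm'] sets_spectral_distr[OF pvm]
         sets_spectral_distr[OF pvm'] pvm_half_line)
  then show ?thesis
    by (simp add: spectral_distr_spectral_op[OF U l])
qed

end

theorem func_calc_spectral_graph:
  fixes U :: "'n::finite l2 \<Rightarrow> 'n l2"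
  assumes U: "unitary U" and l: "l \<in> borel_measurable borel" and \<phi>: "bounded_borel \<phi>"
  shows "func_calc \<phi> (spectral_graph U l) = spectral_op U l \<phi>"
  unfolding func_calc_def
proof (rule the_equality)
  show "l2_linear (spectral_op U l \<phi>) \<and> (\<exists>E. spectral_measure (spectral_graph U l) E \<and>
      (\<forall>u. l2_inner u (spectral_op U l \<phi> u) = (\<integral>t. \<phi> t \<partial>spectral_distr E u)))"
    using spectral_op_linear[OF U l \<phi>] spectral_measure_exists[OF U l] inner_spectral_op_law[OF U l \<phi>]
    by (auto simp: spectral_distr_spectral_op[OF U l])
next
  fix S assume "l2_linear S \<and> (\<exists>E. spectral_measure (spectral_graph U l) E \<and>
      (\<forall>u. l2_inner u (S u) = (\<integral>t. \<phi> t \<partial>spectral_distr E u)))"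
  then obtain E where S: "l2_linear S" and E: "spectral_measure (spectral_graph U l) E"
    and form: "\<And>u. l2_inner u (S u) = (\<integral>t. \<phi> t \<partial>spectral_distr E u)" by blast
  show "S = spectral_op U l \<phi>"
  proof (rule form_determines_operator[OF S spectral_op_linear[OF U l \<phi>]])
    fix u
    show "l2_inner u (S u) = l2_inner u (spectral_op U l \<phi> u)"
      unfolding form spectral_distr_unique[OF U l E] inner_spectral_op_law[OF U l \<phi>] ..
  qed
qed


section \<open>One-dimensional Gaussian integrals\<close>

lemma gauss_decay_exp_quadratic: "gauss_decay (\<lambda>t::real. exp (w * of_real t - of_real (t\<^sup>2)))"
proof -
  have "gauss_decay (\<lambda>t::real. complex_of_real (exp (- (t\<^sup>2))))"
    by (rule gauss_decayI[of 1 _ 1]) auto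
  moreover have "subgauss_growth (\<lambda>t::real. exp (w * of_real t))"
  proof (rule subgauss_growth_exp_linear)
    fix t :: real
    have "Re (w * of_real t) \<le> cmod w * norm t"
      using complex_Re_le_cmod[of "w * of_real t"] by (simp add: norm_mult)
    then show "cmod (exp (w * of_real t)) \<le> exp (cmod w * norm t)" by simp
  qed
  ultimately have "gauss_decay (\<lambda>t::real. of_real (exp (- (t\<^sup>2))) * exp (w * of_real t))"
    by (rule gauss_decay_subgauss)
  also have "(\<lambda>t::real. of_real (exp (- (t\<^sup>2))) * exp (w * of_real t)) = (\<lambda>t. exp (w * of_real t - of_real (t\<^sup>2)))"
    by (simp add: exp_diff exp_minus field_simps flip: exp_of_real)
  finally show ?thesis .
qed

lemma gauss_decay_tendsto_0:
  fixes f :: "real \<Rightarrow> complex"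
  assumes "gauss_decay f"
  shows "(f \<longlongrightarrow> 0) at_top" "(f \<longlongrightarrow> 0) at_bot"
proof -
  obtain C e where C: "C \<ge> 0" "e > 0" "\<And>t. cmod (f t) \<le> C * exp (- e * (norm t)\<^sup>2)"
    using gauss_decayE[OF assms] by metis
  have ev: "\<forall>\<^sub>F t in F. norm (f t) \<le> C * exp (- e * t\<^sup>2)" for F
    using C(3) by (intro always_eventually) simp
  have "((\<lambda>t. C * exp (- e * t\<^sup>2)) \<longlongrightarrow> 0) at_top"
    using C(2) by real_asymp
  with ev show "(f \<longlongrightarrow> 0) at_top" by (rule Lim_null_comparison)
  have "((\<lambda>t. C * exp (- e * t\<^sup>2)) \<longlongrightarrow> 0) at_bot"
    using C(2) by real_asymp
  with ev show "(f \<longlongrightarrow> 0) at_bot" by (rule Lim_null_comparison)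
qed

lemma integral_derivative_zero:
  fixes f f' :: "real \<Rightarrow> complex"
  assumes deriv: "\<And>t. (f has_vector_derivative f' t) (at t)"
    and cont: "\<And>t. isCont f' t"
    and decay: "gauss_decay f" "gauss_decay f'"
  shows "(\<integral>t. f' t \<partial>lborel) = 0"
proof -
  have UNIV: "einterval (- \<infinity>) \<infinity> = UNIV"
    by (auto simp: einterval_def)
  have "f' \<in> borel_measurable borel"
    using cont by (intro borel_measurable_continuous_onI continuous_at_imp_continuous_on) auto
  then have i: "integrable lborel f'"
    by (rule gauss_decay_integrable[OF decay(2)])
  have "(LBINT t=-\<infinity>..\<infinity>. f' t) = 0 - 0"
  proof (rule interval_integral_FTC_integrable)
    show "((f \<circ> real_of_ereal) \<longlongrightarrow> 0) (at_right (- \<infinity>))" "((f \<circ> real_of_ereal) \<longlongrightarrow> 0) (at_left \<infinity>)"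
      using gauss_decay_tendsto_0[OF decay(1)] by (simp_all add: ereal_tendsto_simps)
    show "set_integrable lborel (einterval (- \<infinity>) \<infinity>) f'"
      unfolding UNIV set_integrable_def using i by simp
  qed (use deriv cont in auto)
  then show ?thesis
    unfolding interval_lebesgue_integral_def UNIV set_lebesgue_integral_def by simp
qed

text \<open>
  The characteristic function of the normal distribution, rescaled by \<open>sqrt 2\<close>.
\<close>

lemma integral_exp_imaginary:
  "(\<integral>(t::real). exp (\<i> * of_real v * of_real t - of_real (t\<^sup>2)) \<partial>lborel) = of_real (sqrt pi * exp (- v\<^sup>2 / 4))"
proof -
  define s where "s = v / sqrt 2"
  have "of_real (exp (- (s\<^sup>2) / 2)) = char std_normal_distribution s"
    by (simp add: char_std_normal_distribution)
  also have "\<dots> = (\<integral>x. std_normal_density x *\<^sub>R iexp (s * x) \<partial>lborel)"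
    unfolding char_def
    by (subst integral_density) (auto simp: normal_density_nonneg)
  also have "\<dots> = sqrt 2 *\<^sub>R (\<integral>t. std_normal_density (sqrt 2 * t) *\<^sub>R iexp (s * (sqrt 2 * t)) \<partial>lborel)"
    by (subst lborel_integral_real_affine[where c = "sqrt 2" and t = 0]) simp_all
  also have "\<dots> = sqrt 2 *\<^sub>R (\<integral>t. of_real (1 / sqrt (2 * pi)) * exp (\<i> * of_real v * of_real t - of_real (t\<^sup>2)) \<partial>lborel)"
  proof -
    have "std_normal_density (sqrt 2 * t) *\<^sub>R iexp (s * (sqrt 2 * t))
        = of_real (1 / sqrt (2 * pi)) * exp (\<i> * of_real v * of_real t - of_real (t\<^sup>2))" for t
    proof -
      have e: "s * (sqrt 2 * t) = v * t"
        by (simp add: s_def)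
      have d: "std_normal_density (sqrt 2 * t) = 1 / sqrt (2 * pi) * exp (- (t\<^sup>2))"
        by (simp add: std_normal_density_def power_mult_distrib)
      have "std_normal_density (sqrt 2 * t) *\<^sub>R iexp (s * (sqrt 2 * t))
          = of_real (1 / sqrt (2 * pi)) * (exp (of_real (- (t\<^sup>2))) * iexp (v * t))"
        unfolding e d scaleR_conv_of_real of_real_mult exp_of_real by (simp only: mult.assoc)
      also have "exp (of_real (- (t\<^sup>2))) * iexp (v * t) = exp (\<i> * of_real v * of_real t - of_real (t\<^sup>2))"
        unfolding exp_add[symmetric] by (simp add: mult.assoc)
      finally show ?thesis .
    qed
    then show ?thesis by simp
  qed
  also have "\<dots> = of_real (1 / sqrt pi) * (\<integral>t. exp (\<i> * of_real v * of_real t - of_real (t\<^sup>2)) \<partial>lborel)"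
    by (simp add: scaleR_conv_of_real real_sqrt_mult)
  finally have "(\<integral>t. exp (\<i> * of_real v * of_real t - of_real (t\<^sup>2)) \<partial>lborel)
      = of_real (sqrt pi) * of_real (exp (- (s\<^sup>2) / 2))"
    by (simp add: field_simps)
  then show ?thesis
    by (simp add: s_def power_divide)
qed

text \<open>
  A translation by half the real part of \<open>w\<close> makes \<open>w\<close> purely imaginary.
\<close>

lemma integral_exp_quadratic:
  fixes w :: complex
  shows "(\<integral>(t::real). exp (w * of_real t - of_real (t\<^sup>2)) \<partial>lborel) = of_real (sqrt pi) * exp (w\<^sup>2 / 4)"
proof -
  define u v where "u = Re w" and "v = Im w"
  have w: "w = of_real u + \<i> * of_real v"
    by (simp add: u_def v_def complex_eq)
  have "(\<integral>(t::real). exp (w * of_real t - of_real (t\<^sup>2)) \<partial>lborel)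
      = (\<integral>(t::real). exp (w * of_real (u / 2 + 1 * t) - of_real ((u / 2 + 1 * t)\<^sup>2)) \<partial>lborel)"
    by (subst lborel_integral_real_affine[where c = 1 and t = "u / 2"]) simp_all
  also have "\<dots> = (\<integral>(t::real). exp (of_real (u\<^sup>2 / 4) + \<i> * of_real (u * v / 2))
      * exp (\<i> * of_real v * of_real t - of_real (t\<^sup>2)) \<partial>lborel)"
    unfolding exp_add[symmetric]
    by (rule Bochner_Integration.integral_cong, rule refl, rule arg_cong[where f = exp])
       (simp add: w power2_eq_square field_simps)
  also have "\<dots> = exp (of_real (u\<^sup>2 / 4) + \<i> * of_real (u * v / 2)) * of_real (sqrt pi * exp (- v\<^sup>2 / 4))"
    by (simp only: integral_mult_right_zero integral_exp_imaginary)
  also have "\<dots> = of_real (sqrt pi) * exp (of_real (u\<^sup>2 / 4) + \<i> * of_real (u * v / 2) + of_real (- v\<^sup>2 / 4))"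
    by (simp only: exp_add exp_of_real of_real_mult mult_ac)
  also have "of_real (u\<^sup>2 / 4) + \<i> * of_real (u * v / 2) + of_real (- v\<^sup>2 / 4) = w\<^sup>2 / 4"
    by (simp add: w power2_eq_square field_simps)
  finally show ?thesis .
qed

lemma integrable_exp_quadratic:
  fixes w :: complex
  shows "integrable lborel (\<lambda>t::real. exp (w * of_real t - of_real (t\<^sup>2)))"
  by (intro gauss_decay_integrable gauss_decay_exp_quadratic borel_measurable_continuous_onI continuous_intros)

lemma gauss_decay_exp_quadratic_times:
  fixes w :: complex
  shows "gauss_decay (\<lambda>t::real. of_real t * exp (w * of_real t - of_real (t\<^sup>2)))"
proof -
  have "subgauss_growth (\<lambda>t::real. complex_of_real t)"
    by (rule subgauss_growth_linear[where K = 1]) simp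
  from gauss_decay_subgauss[OF gauss_decay_exp_quadratic this] show ?thesis
    by (simp add: mult.commute)
qed

lemma integrable_exp_quadratic_times:
  fixes w :: complex
  shows "integrable lborel (\<lambda>t::real. of_real t * exp (w * of_real t - of_real (t\<^sup>2)))"
  by (intro gauss_decay_integrable gauss_decay_exp_quadratic_times borel_measurable_continuous_onI continuous_intros)

text \<open>Integrate the derivative of \<open>exp (w * t - t\<^sup>2)\<close>.\<close>

lemma integral_exp_quadratic_times:
  fixes w :: complex
  shows "(\<integral>(t::real). of_real t * exp (w * of_real t - of_real (t\<^sup>2)) \<partial>lborel)
    = w / 2 * (of_real (sqrt pi) * exp (w\<^sup>2 / 4))"
proof -
  define f where "f t = exp (w * of_real t - of_real (t\<^sup>2))" for t :: real
  have "(\<integral>t. w * f t - 2 * (of_real t * f t) \<partial>lborel) = 0"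
  proof (rule integral_derivative_zero)
    show "(f has_vector_derivative w * f t - 2 * (of_real t * f t)) (at t)" for t
    proof -
      have "((\<lambda>z. exp (w * z - z\<^sup>2)) has_field_derivative (w - 2 * of_real t) * exp (w * of_real t - (of_real t)\<^sup>2)) (at (of_real t))"
        by (auto intro!: derivative_eq_intros)
      from has_vector_derivative_real_field[OF this]
      show ?thesis by (simp add: f_def[abs_def] left_diff_distrib mult.assoc)
    qed
    show "isCont (\<lambda>t. w * f t - 2 * (of_real t * f t)) t" for t
      unfolding f_def by (intro continuous_intros)
    show "gauss_decay f"
      unfolding f_def by (rule gauss_decay_exp_quadratic)
    have "gauss_decay (\<lambda>t. w * f t + (- 2) * (of_real t * f t))"
      unfolding f_def by (intro gauss_decay_add gauss_decay_scale gauss_decay_exp_quadratic gauss_decay_exp_quadratic_times)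
    then show "gauss_decay (\<lambda>t. w * f t - 2 * (of_real t * f t))" by simp
  qed
  moreover have "integrable lborel f" "integrable lborel (\<lambda>t. of_real t * f t)"
    unfolding f_def by (rule integrable_exp_quadratic integrable_exp_quadratic_times)+
  ultimately have "w * (\<integral>t. f t \<partial>lborel) - 2 * (\<integral>t. of_real t * f t \<partial>lborel) = 0"
    by simp
  then show ?thesis
    unfolding f_def integral_exp_quadratic by simp
qed

section \<open>A total family of Gaussians\<close>

text \<open>
  Complex exponents make the family closed under multiplication by characters and under Fourier
  transforms.
\<close>

definition gauss :: "complex^'n \<Rightarrow> real^'n \<Rightarrow> complex" where
  "gauss c a = exp (\<Sum>i\<in>UNIV. c $ i * of_real (a $ i) - of_real ((a $ i)\<^sup>2) / 2)"

lemma norm_vec_sq: "(norm (a :: real^'n))\<^sup>2 = (\<Sum>i\<in>UNIV. (a $ i)\<^sup>2)"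
  unfolding power2_norm_eq_inner inner_vec_def by (simp add: power2_eq_square)

lemma gauss_eq: "gauss c a = of_real (exp (- (norm a)\<^sup>2 / 2)) * exp (\<Sum>i\<in>UNIV. c $ i * of_real (a $ i))"
proof -
  have "(\<Sum>i\<in>UNIV. c $ i * of_real (a $ i) - of_real ((a $ i)\<^sup>2) / 2)
      = (\<Sum>i\<in>UNIV. c $ i * of_real (a $ i)) + of_real (- (norm a)\<^sup>2 / 2)"
    by (simp add: sum_subtractf norm_vec_sq sum_divide_distrib)
  then have "gauss c a = exp (of_real (- (norm a)\<^sup>2 / 2)) * exp (\<Sum>i\<in>UNIV. c $ i * of_real (a $ i))"
    by (simp only: gauss_def exp_add mult.commute)
  then show ?thesis
    by (simp only: exp_of_real)
qed

lemma continuous_gauss: "continuous_on A (gauss c)"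
  unfolding gauss_def by (intro continuous_intros) simp

lemma measurable_gauss [measurable]: "gauss c \<in> borel_measurable borel"
  by (rule borel_measurable_continuous_onI[OF continuous_gauss])

lemma cmod_sum_linear_le: "cmod (\<Sum>i\<in>UNIV. c $ i * of_real ((a :: real^'n) $ i)) \<le> (\<Sum>i\<in>UNIV. cmod (c $ i)) * norm a"
  unfolding sum_distrib_right
  by (rule order_trans[OF norm_sum]) (auto simp: norm_mult intro!: sum_mono mult_left_mono component_le_norm_cart)

lemma gauss_decay_gauss: "gauss_decay (gauss c)"
proof -
  have "gauss_decay (\<lambda>a::real^'a. complex_of_real (exp (- (norm a)\<^sup>2 / 2)))"
    by (rule gauss_decayI[of "1/2" _ 1]) auto
  moreover have "subgauss_growth (\<lambda>a::real^'a. exp (\<Sum>i\<in>UNIV. c $ i * of_real (a $ i)))"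
  proof (rule subgauss_growth_exp_linear)
    fix a :: "real^'a"
    have "Re (\<Sum>i\<in>UNIV. c $ i * of_real (a $ i)) \<le> (\<Sum>i\<in>UNIV. cmod (c $ i)) * norm a"
      by (rule order_trans[OF complex_Re_le_cmod cmod_sum_linear_le])
    then show "cmod (exp (\<Sum>i\<in>UNIV. c $ i * of_real (a $ i))) \<le> exp ((\<Sum>i\<in>UNIV. cmod (c $ i)) * norm a)"
      by simp
  qed
  ultimately show ?thesis
    unfolding gauss_eq[abs_def] by (rule gauss_decay_subgauss)
qed

lemma sq_integrable_gauss [simp]: "sq_integrable (gauss c)"
  by (rule gauss_decay_sq_integrable[OF gauss_decay_gauss measurable_gauss])

lemma cnj_gauss: "cnj (gauss c a) = gauss (\<chi> i. cnj (c $ i)) a"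
  by (simp add: gauss_def exp_cnj)

lemma gauss_times_iexp: "gauss c a * iexp (b \<bullet> a) = gauss (\<chi> i. c $ i + \<i> * of_real (b $ i)) a"
proof -
  have "(\<Sum>i\<in>UNIV. c $ i * of_real (a $ i)) + \<i> * of_real (b \<bullet> a)
      = (\<Sum>i\<in>UNIV. (c $ i + \<i> * of_real (b $ i)) * of_real (a $ i))"
    by (simp add: inner_vec_def distrib_right sum.distrib sum_distrib_left mult.assoc)
  then show ?thesis
    by (simp add: gauss_eq mult.assoc flip: exp_add)
qed

text \<open>
  The integrals against Gaussians with imaginary exponents are the Fourier integrals of the
  integrable function \<open>w * gauss 0\<close>.
\<close>

lemma AE_zero_if_orthogonal_to_gauss:
  fixes w :: "real^'n \<Rightarrow> complex"
  assumes i: "\<And>c. integrable lborel (\<lambda>a. w a * gauss c a)"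
    and zero: "\<And>c. (\<integral>a. w a * gauss c a \<partial>lborel) = 0"
  shows "AE a in lborel. w a = 0"
proof -
  have "AE a in lborel. w a * gauss 0 a = 0"
  proof (rule fourier_injective[OF i])
    fix b :: "real^'n"
    show "(\<integral>a. w a * gauss 0 a * iexp (b \<bullet> a) \<partial>lborel) = 0"
      unfolding mult.assoc gauss_times_iexp by (rule zero)
  qed
  then show ?thesis
    by eventually_elim (simp add: gauss_def)
qed

lemma inner_abs_l2:
  assumes "sq_integrable f" "sq_integrable g"
  shows "l2_inner (abs_l2 f) (abs_l2 g) = (\<integral>a. cnj (f a) * g a \<partial>lborel)"
  unfolding l2_inner_eq
proof (rule integral_cong_AE)
  have [measurable]: "f \<in> borel_measurable borel" "g \<in> borel_measurable borel"
    using assms by (auto simp: sq_integrable_def)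
  show "(\<lambda>a. cnj (f a) * g a) \<in> borel_measurable lborel"
    by measurable
  show "AE a in lborel. cnj (rep_l2 (abs_l2 f) a) * rep_l2 (abs_l2 g) a = cnj (f a) * g a"
    using rep_abs_l2[OF assms(1)] rep_abs_l2[OF assms(2)] by eventually_elim simp
qed simp

lemma inner_abs_l2_right:
  assumes "sq_integrable g"
  shows "l2_inner u (abs_l2 g) = (\<integral>a. cnj (rep_l2 u a) * g a \<partial>lborel)"
  using inner_abs_l2[OF sq_integrable_rep[of u] assms] by simp

lemma total_gauss: "total (\<lambda>c. abs_l2 (gauss c))"
  unfolding total_def
proof (intro allI impI)
  fix w :: "'a l2" assume zero: "\<forall>c. l2_inner (abs_l2 (gauss c)) w = 0"
  have "AE a in lborel. rep_l2 w a = 0"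
  proof (rule AE_zero_if_orthogonal_to_gauss)
    fix c :: "complex^'a"
    show "integrable lborel (\<lambda>a. rep_l2 w a * gauss c a)"
      by (rule integrable_sq_prod) simp_all
    define c' where "c' = (\<chi> i. cnj (c $ i))"
    have c': "cnj (gauss c' a) = gauss c a" for a
      unfolding cnj_gauss c'_def by simp
    have "0 = l2_inner (abs_l2 (gauss c')) (abs_l2 (rep_l2 w))"
      using zero by simp
    also have "\<dots> = (\<integral>a. rep_l2 w a * gauss c a \<partial>lborel)"
      by (subst inner_abs_l2) (simp_all add: c' mult.commute)
    finally show "(\<integral>a. rep_l2 w a * gauss c a \<partial>lborel) = 0" by simp
  qed
  then show "w = 0"
    using rep_zero unfolding l2_eq_iff by eventually_elim simp
qed

section \<open>The partial Fourier transform\<close>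

text \<open>
  With the kernel \<open>exp (- \<i> * s * t) / sqrt (2 * pi)\<close> in the variable \<open>a $ k\<close>, the Fourier transform of
  \<open>gauss c\<close> is \<open>gauss_hat k c\<close>: up to a constant, the exponent in direction \<open>k\<close> is multiplied by \<open>- \<i>\<close>.
\<close>

definition turn :: "'n \<Rightarrow> complex^'n \<Rightarrow> complex^'n" where
  "turn k c = (\<chi> i. if i = k then - \<i> * c $ k else c $ i)"

lemma gauss_on_fibre:
  fixes a :: "real^'n"
  assumes "a $ k = 0"
  shows "gauss c (a + t *\<^sub>R axis k 1) = gauss c a * exp (c $ k * of_real t - of_real (t\<^sup>2) / 2)"
proof -
  have nth: "(a + t *\<^sub>R axis k 1) $ i = (if i = k then t else a $ i)" for i
    using assms by (simp add: axis_def)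
  show ?thesis
    unfolding gauss_def nth
    using assms by (simp add: sum.remove[of UNIV k] mult.commute flip: exp_add cong: if_cong)
qed

lemma gauss_turn:
  fixes a :: "real^'n"
  assumes "a $ k = 0"
  shows "gauss (turn k c) a = gauss c a"
  unfolding gauss_def using assms by (intro arg_cong[where f = exp] sum.cong) (auto simp: turn_def)

lemma turn_nth [simp]: "turn k c $ k = - \<i> * c $ k"
  by (simp add: turn_def)

lemma surj_turn: "\<exists>c'. turn k c' = c"
  by (rule exI[of _ "\<chi> i. if i = k then \<i> * c $ k else c $ i"]) (simp add: turn_def vec_eq_iff)

definition gauss_hat :: "'n \<Rightarrow> complex^'n \<Rightarrow> real^'n \<Rightarrow> complex" where
  "gauss_hat k c a = exp ((c $ k)\<^sup>2 / 2) * gauss (turn k c) a"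

lemma measurable_gauss_hat [measurable]: "gauss_hat k c \<in> borel_measurable borel"
  unfolding gauss_hat_def by measurable

lemma gauss_decay_gauss_hat: "gauss_decay (gauss_hat k c)"
  unfolding gauss_hat_def by (intro gauss_decay_scale gauss_decay_gauss)

lemma sq_integrable_gauss_hat [simp]: "sq_integrable (gauss_hat k c)"
  by (rule gauss_decay_sq_integrable[OF gauss_decay_gauss_hat measurable_gauss_hat])

lemma gauss_hat_on_fibre:
  fixes a :: "real^'n"
  assumes "a $ k = 0"
  shows "gauss_hat k c (a + t *\<^sub>R axis k 1)
    = gauss c a * exp ((c $ k)\<^sup>2 / 2 - \<i> * c $ k * of_real t - of_real (t\<^sup>2) / 2)"
  unfolding gauss_hat_def gauss_on_fibre[OF assms] gauss_turn[OF assms] turn_nth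
  by (simp add: mult.left_commute flip: exp_add) (simp add: algebra_simps)

lemma fibre_gauss_product:
  fixes a :: "real^'n"
  assumes "a $ k = 0"
  shows "cnj (gauss b (a + t *\<^sub>R axis k 1)) * gauss c (a + t *\<^sub>R axis k 1)
    = cnj (gauss b a) * gauss c a * exp ((cnj (b $ k) + c $ k) * of_real t - of_real (t\<^sup>2))"
  unfolding gauss_on_fibre[OF assms]
  by (simp add: exp_cnj mult_ac distrib_right flip: exp_add) (simp add: algebra_simps)

lemma fibre_gauss_hat_product:
  fixes a :: "real^'n"
  assumes "a $ k = 0"
  shows "cnj (gauss_hat k b (a + t *\<^sub>R axis k 1)) * gauss_hat k c (a + t *\<^sub>R axis k 1)
    = cnj (gauss b a) * gauss c a * exp (((cnj (b $ k))\<^sup>2 + (c $ k)\<^sup>2) / 2)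
      * exp (\<i> * (cnj (b $ k) - c $ k) * of_real t - of_real (t\<^sup>2))"
  unfolding gauss_hat_on_fibre[OF assms]
  by (simp add: exp_cnj mult_ac algebra_simps add_divide_distrib flip: exp_add)

text \<open>
  Since \<open>(c $ k - a $ k) * gauss c a\<close> is the derivative of \<open>gauss c\<close> in direction \<open>k\<close>, this is the
  correspondence of \<open>\<i> * \<kappa>\<close> times the derivative with multiplication by \<open>- \<kappa> * a $ k\<close>, for matrix elements.
  The case \<open>\<kappa> = 0\<close>, \<open>m = 1\<close> is the equality of Gram matrices. On each line in direction \<open>k\<close> both sides
  are Gaussian integrals, with exponents \<open>B + C\<close> and \<open>\<i> * (B - C)\<close>.
\<close>

lemma gauss_hat_matrix_element:
  fixes m :: "real^'n \<Rightarrow> complex" and \<kappa> :: complex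
  assumes m: "\<And>a t. m (a + t *\<^sub>R axis k 1) = m a" "m \<in> borel_measurable borel" "subgauss_growth m"
  shows "(\<integral>a. cnj (gauss b a) * ((\<i> * \<kappa> * (c $ k - of_real (a $ k)) + m a) * gauss c a) \<partial>lborel)
    = (\<integral>a. cnj (gauss_hat k b a) * ((- \<kappa> * of_real (a $ k) + m a) * gauss_hat k c a) \<partial>lborel)"
proof (rule integral_eq_if_fibres_eq[where k = k])
  note [measurable] = m(2)
  have growth: "subgauss_growth (\<lambda>a::real^'n. complex_of_real (a $ k))"
    by (rule subgauss_growth_linear[where K = 1]) (simp add: component_le_norm_cart)
  have "gauss_decay (\<lambda>a. (cnj (gauss b a) * gauss c a) * ((\<i> * \<kappa> * c $ k + (- \<i> * \<kappa>) * of_real (a $ k)) + m a))"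
    by (intro gauss_decay_subgauss gauss_decay_mult gauss_decay_cnj gauss_decay_gauss subgauss_growth_add
        subgauss_growth_mult subgauss_growth_const growth m)
  then have "integrable lborel (\<lambda>a. (cnj (gauss b a) * gauss c a) * ((\<i> * \<kappa> * c $ k + (- \<i> * \<kappa>) * of_real (a $ k)) + m a))"
    by (rule gauss_decay_integrable) measurable
  then show "integrable lborel (\<lambda>a. cnj (gauss b a) * ((\<i> * \<kappa> * (c $ k - of_real (a $ k)) + m a) * gauss c a))"
    by (simp add: algebra_simps)
  have "gauss_decay (\<lambda>a. (cnj (gauss_hat k b a) * gauss_hat k c a) * ((- \<kappa>) * of_real (a $ k) + m a))"
    by (intro gauss_decay_subgauss gauss_decay_mult gauss_decay_cnj gauss_decay_gauss_hat subgauss_growth_add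
        subgauss_growth_mult subgauss_growth_const growth m)
  then have "integrable lborel (\<lambda>a. (cnj (gauss_hat k b a) * gauss_hat k c a) * ((- \<kappa>) * of_real (a $ k) + m a))"
    by (rule gauss_decay_integrable) measurable
  then show "integrable lborel (\<lambda>a. cnj (gauss_hat k b a) * ((- \<kappa> * of_real (a $ k) + m a) * gauss_hat k c a))"
    by (simp add: algebra_simps)
next
  fix a :: "real^'n" assume a: "a $ k = 0"
  define P where "P = cnj (gauss b a) * gauss c a"
  define B C where "B = cnj (b $ k)" and "C = c $ k"
  define I where "I w = of_real (sqrt pi) * exp (w\<^sup>2 / 4)" for w :: complex
  have nth: "(a + t *\<^sub>R axis k 1) $ k = t" for t
    using a by (simp add: axis_def)
  have 1: "cnj (gauss b (a + t *\<^sub>R axis k 1)) * ((\<i> * \<kappa> * (C - of_real t) + m a) * gauss c (a + t *\<^sub>R axis k 1))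
      = (P * (\<i> * \<kappa> * C + m a)) * exp ((B + C) * of_real t - of_real (t\<^sup>2))
        - (P * \<i> * \<kappa>) * (of_real t * exp ((B + C) * of_real t - of_real (t\<^sup>2)))" for t
  proof -
    have "cnj (gauss b (a + t *\<^sub>R axis k 1)) * ((\<i> * \<kappa> * (C - of_real t) + m a) * gauss c (a + t *\<^sub>R axis k 1))
        = (\<i> * \<kappa> * (C - of_real t) + m a) * (cnj (gauss b (a + t *\<^sub>R axis k 1)) * gauss c (a + t *\<^sub>R axis k 1))"
      by simp
    then show ?thesis
      unfolding fibre_gauss_product[OF a] P_def[symmetric] B_def[symmetric] C_def[symmetric]
      by (simp add: algebra_simps)
  qed
  define Q where "Q = P * exp ((B\<^sup>2 + C\<^sup>2) / 2)"
  have 2: "cnj (gauss_hat k b (a + t *\<^sub>R axis k 1)) * ((- \<kappa> * of_real t + m a) * gauss_hat k c (a + t *\<^sub>R axis k 1))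
      = (Q * m a) * exp (\<i> * (B - C) * of_real t - of_real (t\<^sup>2))
        - (Q * \<kappa>) * (of_real t * exp (\<i> * (B - C) * of_real t - of_real (t\<^sup>2)))" for t
  proof -
    have "cnj (gauss_hat k b (a + t *\<^sub>R axis k 1)) * ((- \<kappa> * of_real t + m a) * gauss_hat k c (a + t *\<^sub>R axis k 1))
        = (- \<kappa> * of_real t + m a) * (cnj (gauss_hat k b (a + t *\<^sub>R axis k 1)) * gauss_hat k c (a + t *\<^sub>R axis k 1))"
      by simp
    then show ?thesis
      unfolding fibre_gauss_hat_product[OF a] P_def[symmetric] B_def[symmetric] C_def[symmetric] Q_def[symmetric]
      by (simp add: algebra_simps)
  qed
  have QI: "Q * I (\<i> * (B - C)) = P * I (B + C)"
  proof -
    have "(B\<^sup>2 + C\<^sup>2) / 2 + (\<i> * (B - C))\<^sup>2 / 4 = (B + C)\<^sup>2 / 4"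
      by (simp add: power2_sum power2_diff power_mult_distrib) (simp add: field_simps)
    then have e: "exp ((B\<^sup>2 + C\<^sup>2) / 2) * exp ((\<i> * (B - C))\<^sup>2 / 4) = exp ((B + C)\<^sup>2 / 4)"
      by (simp only: exp_add[symmetric])
    have "Q * I (\<i> * (B - C)) = P * of_real (sqrt pi) * (exp ((B\<^sup>2 + C\<^sup>2) / 2) * exp ((\<i> * (B - C))\<^sup>2 / 4))"
      by (simp only: Q_def I_def mult_ac)
    then show ?thesis
      unfolding e by (simp only: I_def mult_ac)
  qed
  have L: "(\<integral>t. cnj (gauss b (a + t *\<^sub>R axis k 1)) * ((\<i> * \<kappa> * (C - of_real t) + m a) * gauss c (a + t *\<^sub>R axis k 1)) \<partial>lborel)
      = (P * (\<i> * \<kappa> * C + m a)) * I (B + C) - (P * \<i> * \<kappa>) * ((B + C) / 2 * I (B + C))"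
    unfolding 1
    by (subst Bochner_Integration.integral_diff)
       (simp_all only: integrable_mult_right integrable_exp_quadratic integrable_exp_quadratic_times
         integral_mult_right_zero integral_exp_quadratic integral_exp_quadratic_times I_def simp_thms)
  have R: "(\<integral>t. cnj (gauss_hat k b (a + t *\<^sub>R axis k 1)) * ((- \<kappa> * of_real t + m a) * gauss_hat k c (a + t *\<^sub>R axis k 1)) \<partial>lborel)
      = (Q * m a) * I (\<i> * (B - C)) - (Q * \<kappa>) * (\<i> * (B - C) / 2 * I (\<i> * (B - C)))"
    unfolding 2
    by (subst Bochner_Integration.integral_diff)
       (simp_all only: integrable_mult_right integrable_exp_quadratic integrable_exp_quadratic_times
         integral_mult_right_zero integral_exp_quadratic integral_exp_quadratic_times I_def simp_thms)
  have "(P * (\<i> * \<kappa> * C + m a)) * I (B + C) - (P * \<i> * \<kappa>) * ((B + C) / 2 * I (B + C))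
      = (m a - \<kappa> * (\<i> * (B - C) / 2)) * (P * I (B + C))"
    by (simp add: field_simps)
  also have "\<dots> = (Q * m a) * I (\<i> * (B - C)) - (Q * \<kappa>) * (\<i> * (B - C) / 2 * I (\<i> * (B - C)))"
    unfolding QI[symmetric] by (simp add: algebra_simps)
  finally show "(\<integral>t. cnj (gauss b (a + t *\<^sub>R axis k 1)) * ((\<i> * \<kappa> * (c $ k - of_real ((a + t *\<^sub>R axis k 1) $ k)) + m (a + t *\<^sub>R axis k 1)) * gauss c (a + t *\<^sub>R axis k 1)) \<partial>lborel)
      = (\<integral>t. cnj (gauss_hat k b (a + t *\<^sub>R axis k 1)) * ((- \<kappa> * of_real ((a + t *\<^sub>R axis k 1) $ k) + m (a + t *\<^sub>R axis k 1)) * gauss_hat k c (a + t *\<^sub>R axis k 1)) \<partial>lborel)"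
    unfolding nth m(1) C_def[symmetric] L R .
qed

lemma total_gauss_hat: "total (\<lambda>c. abs_l2 (gauss_hat k c))"
  unfolding total_def
proof (intro allI impI)
  fix w :: "'a l2" assume zero: "\<forall>c. l2_inner (abs_l2 (gauss_hat k c)) w = 0"
  have "l2_inner (abs_l2 (gauss c)) w = 0" for c
  proof -
    obtain c' where c': "turn k c' = c" using surj_turn by blast
    have "0 = l2_inner (abs_l2 (gauss_hat k c')) (abs_l2 (rep_l2 w))"
      using zero by simp
    also have "\<dots> = cnj (exp ((c' $ k)\<^sup>2 / 2)) * (\<integral>a. cnj (gauss c a) * rep_l2 w a \<partial>lborel)"
      by (subst inner_abs_l2) (simp_all add: gauss_hat_def c' mult.assoc)
    also have "(\<integral>a. cnj (gauss c a) * rep_l2 w a \<partial>lborel) = l2_inner (abs_l2 (gauss c)) (abs_l2 (rep_l2 w))"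
      by (subst inner_abs_l2) simp_all
    finally show ?thesis by simp
  qed
  then show "w = 0"
    using total_gauss unfolding total_def by blast
qed

theorem partial_fourier_exists:
  "\<exists>U :: 'n::finite l2 \<Rightarrow> 'n l2. unitary U \<and> (\<forall>c. U (abs_l2 (gauss c)) = abs_l2 (gauss_hat k c))"
proof -
  have "l2_inner (abs_l2 (gauss b)) (abs_l2 (gauss c)) = l2_inner (abs_l2 (gauss_hat k b)) (abs_l2 (gauss_hat k c))"
    for b c :: "complex^'n"
    using gauss_hat_matrix_element[of "\<lambda>_. 1" k b 0 c] by (simp add: inner_abs_l2 subgauss_growth_const)
  from unitary_of_equal_gram[OF this total_gauss total_gauss_hat] show ?thesis
    by metis
qed

definition partial_fourier :: "'n \<Rightarrow> 'n::finite l2 \<Rightarrow> 'n l2" where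
  "partial_fourier k = (SOME U. unitary U \<and> (\<forall>c. U (abs_l2 (gauss c)) = abs_l2 (gauss_hat k c)))"

lemma unitary_partial_fourier: "unitary (partial_fourier k)"
  and partial_fourier_gauss: "partial_fourier k (abs_l2 (gauss c)) = abs_l2 (gauss_hat k c)"
  using someI_ex[OF partial_fourier_exists[of k]] unfolding partial_fourier_def by auto


section \<open>Reflected translations along a coordinate\<close>

definition reflect :: "'n \<Rightarrow> (real^'n \<Rightarrow> real) \<Rightarrow> real^'n \<Rightarrow> real^'n" where
  "reflect k N a = (\<chi> i. if i = k then N a - a $ k else a $ i)"

text \<open>
  The inner products of \<open>V u - W u\<close> with the images of the total family can be computed from those of
  \<open>u\<close>, once through \<open>V\<close> and once through \<open>W\<close>, and so they vanish.
\<close>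

lemma unitary_eq_if_eq_on_total:
  fixes V W :: "'n::finite l2 \<Rightarrow> 'n l2"
  assumes V: "unitary V" and W: "\<And>u v. l2_inner (W u) (W v) = l2_inner u v"
    and x: "total x" "\<And>i. V (x i) = W (x i)"
  shows "V u = W u"
proof -
  have "l2_inner (x i) (inv V (V u - W u)) = 0" for i
  proof -
    have "l2_inner (x i) (inv V (V u - W u)) = l2_inner (V (x i)) (V u - W u)"
      using unitary_inner[OF V, of "x i" "inv V (V u - W u)"] by (simp add: unitary_inv[OF V])
    also have "\<dots> = l2_inner (V (x i)) (V u) - l2_inner (W (x i)) (W u)"
      by (simp add: l2_inner_simps x)
    finally show ?thesis by (simp add: unitary_inner[OF V] W)
  qed
  then have "inv V (V u - W u) = 0"
    using x(1) by (simp add: total_def)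
  then have "V (inv V (V u - W u)) = 0"
    by (simp add: unitary_linear[OF V])
  then show ?thesis
    by (simp add: unitary_inv[OF V])
qed

context
  fixes k :: "'n::finite" and N :: "real^'n \<Rightarrow> real"
  assumes N: "\<And>a t. N (a + t *\<^sub>R axis k 1) = N a" and N_meas [measurable]: "N \<in> borel_measurable borel"
begin

lemma reflect_nth [simp]: "reflect k N a $ k = N a - a $ k" "i \<noteq> k \<Longrightarrow> reflect k N a $ i = a $ i"
  by (simp_all add: reflect_def)

lemma reflect_on_fibre: "a $ k = 0 \<Longrightarrow> reflect k N (a + t *\<^sub>R axis k 1) = a + (N a - t) *\<^sub>R axis k 1"
  by (simp add: reflect_def vec_eq_iff N) (simp add: axis_def)

lemma reflect_eq: "reflect k N a = a + (N a - 2 * a $ k) *\<^sub>R axis k 1"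
  by (simp add: reflect_def vec_eq_iff axis_def)

lemma measurable_reflect [measurable]: "reflect k N \<in> borel_measurable borel"
proof -
  have "reflect k N = (\<lambda>a. a + (N a - 2 * a $ k) *\<^sub>R axis k 1)"
    by (rule ext) (rule reflect_eq)
  then show ?thesis by simp
qed

lemma measure_preserving_reflect: "measure_preserving (reflect k N)"
  unfolding measure_preserving_def
  using distr_lborel_eq_if_fibres_preserved[where T = "reflect k N" and s = N and k = k]
  by (simp add: reflect_on_fibre)

lemma reflect_reflect: "reflect k N (reflect k N a) = a"
proof -
  have "N (reflect k N a) = N a"
    unfolding reflect_eq by (rule N)
  then show ?thesis
    by (simp add: vec_eq_iff reflect_def)
qed

lemma unitary_comp_reflect: "unitary (comp_op (reflect k N))"
proof -
  have inv: "comp_op (reflect k N) (comp_op (reflect k N) u) = u" for u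
    by (simp add: comp_op_comp_op measure_preserving_reflect reflect_reflect) (simp add: comp_op_def)
  have "l2_linear (comp_op (reflect k N))"
    by standard (simp_all add: comp_op_linear measure_preserving_reflect)
  moreover have "bij (comp_op (reflect k N))"
    by (rule o_bij[of "comp_op (reflect k N)"]) (auto simp: inv)
  ultimately show ?thesis
    by (simp add: unitary_def inner_comp_op measure_preserving_reflect)
qed

end

lemma unitary_compose:
  assumes V: "unitary V" and W: "unitary W"
  shows "unitary (\<lambda>u. V (W u))"
proof -
  have "l2_linear (\<lambda>u. V (W u))"
    by standard (simp_all add: unitary_linear[OF V] unitary_linear[OF W])
  moreover have "bij (\<lambda>u. V (W u))"
    using bij_comp[of W V] V W by (simp add: unitary_def o_def)
  ultimately show ?thesis
    by (simp add: unitary_def unitary_inner[OF V] unitary_inner[OF W])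
qed

text \<open>
  In the next theorem the matrix elements between Gaussians are, on each line in direction \<open>k\<close>,
  integrals of the first two products; after integration they agree by the third identity.
\<close>

lemma exponent_reflected:
  fixes B C M T :: complex
  shows "exp (B * T - T\<^sup>2 / 2) * exp (C * (M - T) - (M - T)\<^sup>2 / 2)
    = exp (C * M - M\<^sup>2 / 2) * exp ((B - C + M) * T - T\<^sup>2)"
  unfolding exp_add[symmetric]
  by (rule arg_cong[where f = exp]) (simp add: field_simps power2_eq_square)

lemma exponent_hat:
  fixes B C M T :: complex
  shows "exp (B\<^sup>2 / 2 + \<i> * B * T - T\<^sup>2 / 2) * (exp (- \<i> * M * T) * exp (C\<^sup>2 / 2 + \<i> * C * T - T\<^sup>2 / 2))
    = exp ((B\<^sup>2 + C\<^sup>2) / 2) * exp (\<i> * (B + C - M) * T - T\<^sup>2)"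
  unfolding exp_add[symmetric]
  by (rule arg_cong[where f = exp]) (simp add: field_simps)

lemma exponent_match:
  fixes B C M :: complex
  shows "exp (C * M - M\<^sup>2 / 2) * exp ((B - C + M)\<^sup>2 / 4) = exp ((B\<^sup>2 + C\<^sup>2) / 2) * exp ((\<i> * (B + C - M))\<^sup>2 / 4)"
  unfolding exp_add[symmetric] power_mult_distrib i_squared
  by (rule arg_cong[where f = exp]) (simp add: field_simps power2_eq_square)

text \<open>
  The Fourier transform commutes with \<open>a $ k \<mapsto> - a $ k\<close> and turns the
  translation by \<open>N\<close> into multiplication by a character. As both sides preserve inner
  products, it suffices to compare them on Gaussians, and there in terms of matrix elements.
\<close>

theorem partial_fourier_reflect:
  fixes N :: "real^'n \<Rightarrow> real"
  assumes N: "\<And>a t. N (a + t *\<^sub>R axis k 1) = N a" and N_meas [measurable]: "N \<in> borel_measurable borel"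
  shows "partial_fourier k (comp_op (reflect k N) u)
    = mult_op (\<lambda>a. iexp (- (N a * a $ k))) (comp_op (reflect k (\<lambda>_. 0)) (partial_fourier k u))"
proof -
  define U where "U = partial_fourier k"
  define r where "r = reflect k N"
  define r0 where "r0 = reflect k (\<lambda>_. 0 :: real)"
  define \<phi> where "\<phi> a = iexp (- (N a * a $ k))" for a
  have U: "unitary U" by (simp add: U_def unitary_partial_fourier)
  have r: "measure_preserving r" and r0: "measure_preserving r0"
    unfolding r_def r0_def by (intro measure_preserving_reflect N N_meas refl borel_measurable_const)+
  have \<phi>_meas [measurable]: "\<phi> \<in> borel_measurable borel"
  proof -
    have [measurable]: "iexp \<in> borel_measurable borel"
      by (intro borel_measurable_continuous_onI continuous_intros)
    show ?thesis unfolding \<phi>_def by measurable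
  qed
  have \<phi>: "bounded_borel \<phi>"
    by (rule bounded_borelI[OF \<phi>_meas, of 1]) (simp add: \<phi>_def)
  have cnj_\<phi>: "cnj (\<phi> a) * \<phi> a = 1" for a
    by (simp add: \<phi>_def exp_cnj flip: exp_add)
  define V where "V u = U (comp_op r u)" for u
  define W where "W u = mult_op \<phi> (comp_op r0 (U u))" for u
  have V: "unitary V"
    unfolding V_def r_def by (rule unitary_compose[OF U unitary_comp_reflect[OF N N_meas]])
  have W: "l2_inner (W u) (W v) = l2_inner u v" for u v
  proof -
    have b: "bounded_borel (\<lambda>a. cnj (\<phi> a))"
      using \<phi> by (auto simp: bounded_borel_def)
    have "l2_inner (W u) (W v) = l2_inner (mult_op (\<lambda>a. cnj (\<phi> a)) (mult_op \<phi> (comp_op r0 (U u)))) (comp_op r0 (U v))"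
      unfolding W_def by (rule inner_mult_op_adjoint[OF \<phi>, symmetric])
    also have "\<dots> = l2_inner u v"
      unfolding mult_op_mult_op[OF b \<phi>] cnj_\<phi> mult_op_one
      by (simp add: inner_comp_op[OF r0] unitary_inner[OF U])
    finally show ?thesis .
  qed
  have "V (abs_l2 (gauss c)) = W (abs_l2 (gauss c))" for c
  proof -
    have sq: "sq_integrable (\<lambda>a. \<phi> a * gauss_hat k c (r0 a))"
      by (intro sq_integrable_mult \<phi> sq_integrable_compose[OF r0] sq_integrable_gauss_hat)
    have Wc: "W (abs_l2 (gauss c)) = abs_l2 (\<lambda>a. \<phi> a * gauss_hat k c (r0 a))"
    proof -
      have "W (abs_l2 (gauss c)) = mult_op \<phi> (abs_l2 (\<lambda>a. gauss_hat k c (r0 a)))"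
        by (simp add: W_def U_def partial_fourier_gauss comp_op_abs r0)
      also have "\<dots> = abs_l2 (\<lambda>a. \<phi> a * gauss_hat k c (r0 a))"
      proof (rule abs_l2_eqI[OF sq, symmetric])
        show "AE a in lborel. rep_l2 (mult_op \<phi> (abs_l2 (\<lambda>a. gauss_hat k c (r0 a)))) a = \<phi> a * gauss_hat k c (r0 a)"
          using rep_mult_op[OF \<phi>, of "abs_l2 (\<lambda>a. gauss_hat k c (r0 a))"]
            rep_abs_l2[OF sq_integrable_compose[OF r0 sq_integrable_gauss_hat[of k c]]]
          by eventually_elim simp
      qed
      finally show ?thesis .
    qed
    have "l2_inner (abs_l2 (gauss_hat k b)) (V (abs_l2 (gauss c))) = l2_inner (abs_l2 (gauss_hat k b)) (W (abs_l2 (gauss c)))" for b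
    proof -
      have "l2_inner (abs_l2 (gauss_hat k b)) (V (abs_l2 (gauss c))) = l2_inner (abs_l2 (gauss b)) (abs_l2 (\<lambda>a. gauss c (r a)))"
        unfolding V_def U_def partial_fourier_gauss[symmetric] unitary_inner[OF unitary_partial_fourier] comp_op_abs[OF r sq_integrable_gauss] ..
      also have "\<dots> = (\<integral>a. cnj (gauss b a) * gauss c (r a) \<partial>lborel)"
        by (intro inner_abs_l2 sq_integrable_gauss sq_integrable_compose[OF r])
      also have "\<dots> = (\<integral>a. cnj (gauss_hat k b a) * (\<phi> a * gauss_hat k c (r0 a)) \<partial>lborel)"
      proof (rule integral_eq_if_fibres_eq[where k = k])
        show "integrable lborel (\<lambda>a. cnj (gauss b a) * gauss c (r a))"
          by (intro integrable_sq_prod sq_integrable_gauss sq_integrable_compose[OF r])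
        show "integrable lborel (\<lambda>a. cnj (gauss_hat k b a) * (\<phi> a * gauss_hat k c (r0 a)))"
          by (intro integrable_sq_prod sq_integrable_gauss_hat sq)
        fix a :: "real^'n" assume a: "a $ k = 0"
        define P where "P = cnj (gauss b a) * gauss c a"
        define B C M where "B = cnj (b $ k)" and "C = c $ k" and "M = complex_of_real (N a)"
        have 1: "cnj (gauss b (a + t *\<^sub>R axis k 1)) * gauss c (r (a + t *\<^sub>R axis k 1))
            = (P * exp (C * M - M\<^sup>2 / 2)) * exp ((B - C + M) * of_real t - of_real (t\<^sup>2))" for t
        proof -
          have "cnj (gauss b (a + t *\<^sub>R axis k 1)) * gauss c (r (a + t *\<^sub>R axis k 1))
              = P * (exp (B * of_real t - (of_real t)\<^sup>2 / 2) * exp (C * (M - of_real t) - (M - of_real t)\<^sup>2 / 2))"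
            unfolding r_def reflect_on_fibre[OF N N_meas a] gauss_on_fibre[OF a] P_def B_def C_def M_def
            by (simp add: exp_cnj)
          then show ?thesis
            unfolding exponent_reflected by (simp only: mult.assoc of_real_power)
        qed
        have 2: "cnj (gauss_hat k b (a + t *\<^sub>R axis k 1)) * (\<phi> (a + t *\<^sub>R axis k 1) * gauss_hat k c (r0 (a + t *\<^sub>R axis k 1)))
            = (P * exp ((B\<^sup>2 + C\<^sup>2) / 2)) * exp ((\<i> * (B + C - M)) * of_real t - of_real (t\<^sup>2))" for t
        proof -
          have nth: "(a + t *\<^sub>R axis k 1) $ k = t"
            using a by (simp add: axis_def)
          have r0_fibre: "r0 (a + t *\<^sub>R axis k 1) = a + (- t) *\<^sub>R axis k 1"
            unfolding r0_def using reflect_on_fibre[of "\<lambda>_. 0" k a t] a by simp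
          have g: "cnj (gauss_hat k b (a + t *\<^sub>R axis k 1)) = cnj (gauss b a) * exp (B\<^sup>2 / 2 + \<i> * B * of_real t - (of_real t)\<^sup>2 / 2)"
            unfolding gauss_hat_on_fibre[OF a] B_def by (simp add: exp_cnj)
          have h: "gauss_hat k c (r0 (a + t *\<^sub>R axis k 1)) = gauss c a * exp (C\<^sup>2 / 2 + \<i> * C * of_real t - (of_real t)\<^sup>2 / 2)"
            unfolding r0_fibre gauss_hat_on_fibre[OF a] C_def by simp
          have p: "\<phi> (a + t *\<^sub>R axis k 1) = exp (- \<i> * M * of_real t)"
            unfolding \<phi>_def nth N M_def by (simp add: mult.assoc)
          have "cnj (gauss_hat k b (a + t *\<^sub>R axis k 1)) * (\<phi> (a + t *\<^sub>R axis k 1) * gauss_hat k c (r0 (a + t *\<^sub>R axis k 1)))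
              = P * (exp (B\<^sup>2 / 2 + \<i> * B * of_real t - (of_real t)\<^sup>2 / 2) * (exp (- \<i> * M * of_real t) * exp (C\<^sup>2 / 2 + \<i> * C * of_real t - (of_real t)\<^sup>2 / 2)))"
            unfolding g h p P_def by (simp only: mult_ac)
          then show ?thesis
            unfolding exponent_hat by (simp only: mult.assoc of_real_power)
        qed
        have "P * exp (C * M - M\<^sup>2 / 2) * (of_real (sqrt pi) * exp ((B - C + M)\<^sup>2 / 4))
            = P * of_real (sqrt pi) * (exp (C * M - M\<^sup>2 / 2) * exp ((B - C + M)\<^sup>2 / 4))"
          by (simp only: mult_ac)
        also have "\<dots> = P * exp ((B\<^sup>2 + C\<^sup>2) / 2) * (of_real (sqrt pi) * exp ((\<i> * (B + C - M))\<^sup>2 / 4))"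
          unfolding exponent_match by (simp only: mult_ac)
        finally show "(\<integral>t. cnj (gauss b (a + t *\<^sub>R axis k 1)) * gauss c (r (a + t *\<^sub>R axis k 1)) \<partial>lborel)
            = (\<integral>t. cnj (gauss_hat k b (a + t *\<^sub>R axis k 1)) * (\<phi> (a + t *\<^sub>R axis k 1) * gauss_hat k c (r0 (a + t *\<^sub>R axis k 1))) \<partial>lborel)"
          unfolding 1 2 integral_mult_right_zero integral_exp_quadratic .
      qed
      also have "\<dots> = l2_inner (abs_l2 (gauss_hat k b)) (W (abs_l2 (gauss c)))"
        unfolding Wc by (rule inner_abs_l2[symmetric]) (intro sq_integrable_gauss_hat sq)+
      finally show ?thesis .
    qed
    then have "V (abs_l2 (gauss c)) - W (abs_l2 (gauss c)) = 0"
      by (intro total_gauss_hat[unfolded total_def, rule_format, of k]) (simp add: l2_inner_diff_right)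
    then show ?thesis by simp
  qed
  then have "V u = W u"
    by (rule unitary_eq_if_eq_on_total[OF V W total_gauss])
  then show ?thesis
    unfolding V_def W_def U_def r_def r0_def \<phi>_def .
qed


section \<open>Differentiation on the span of Gaussians times polynomials\<close>

text \<open>
  Functions together with their partial derivative in direction \<open>k\<close>. The first kind of regularity is
  what integration by parts requires; the second is that of polynomials, which multiply the first
  kind into itself.
\<close>

definition fibre_derivative :: "'n \<Rightarrow> (real^'n \<Rightarrow> complex) \<Rightarrow> (real^'n \<Rightarrow> complex) \<Rightarrow> bool" where
  "fibre_derivative k f f' \<longleftrightarrow> (\<forall>a. ((\<lambda>t. f (a + t *\<^sub>R axis k 1)) has_vector_derivative f' a) (at 0))"

definition gauss_regular :: "'n \<Rightarrow> (real^'n \<Rightarrow> complex) \<Rightarrow> (real^'n \<Rightarrow> complex) \<Rightarrow> bool" where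
  "gauss_regular k f f' \<longleftrightarrow> continuous_on UNIV f \<and> continuous_on UNIV f' \<and>
     gauss_decay f \<and> gauss_decay f' \<and> fibre_derivative k f f'"

definition growth_regular :: "'n \<Rightarrow> (real^'n \<Rightarrow> complex) \<Rightarrow> (real^'n \<Rightarrow> complex) \<Rightarrow> bool" where
  "growth_regular k f f' \<longleftrightarrow> continuous_on UNIV f \<and> continuous_on UNIV f' \<and>
     subgauss_growth f \<and> subgauss_growth f' \<and> fibre_derivative k f f'"

lemma fibre_derivative_at:
  assumes "fibre_derivative k f f'"
  shows "((\<lambda>t. f (a + t *\<^sub>R axis k 1)) has_vector_derivative f' (a + s *\<^sub>R axis k 1)) (at s)"
proof -
  have "((\<lambda>t. f ((a + s *\<^sub>R axis k 1) + t *\<^sub>R axis k 1)) has_vector_derivative f' (a + s *\<^sub>R axis k 1)) (at (s - s))"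
    using assms by (simp add: fibre_derivative_def)
  then have "((\<lambda>t. f ((a + s *\<^sub>R axis k 1) + t *\<^sub>R axis k 1)) \<circ> (\<lambda>t. t - s) has_vector_derivative
      1 *\<^sub>R f' (a + s *\<^sub>R axis k 1)) (at s)"
    by (intro vector_diff_chain_at) (auto intro!: derivative_eq_intros)
  moreover have "(\<lambda>t. f ((a + s *\<^sub>R axis k 1) + t *\<^sub>R axis k 1)) \<circ> (\<lambda>t. t - s) = (\<lambda>t. f (a + t *\<^sub>R axis k 1))"
    by (simp add: fun_eq_iff scaleR_diff_left)
  ultimately show ?thesis by simp
qed

lemma fibre_derivative_mult:
  assumes "fibre_derivative k f f'" "fibre_derivative k g g'"
  shows "fibre_derivative k (\<lambda>a. f a * g a) (\<lambda>a. f' a * g a + f a * g' a)"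
  unfolding fibre_derivative_def
proof
  fix a
  have "((\<lambda>t. f (a + t *\<^sub>R axis k 1) * g (a + t *\<^sub>R axis k 1)) has_vector_derivative
      f (a + 0 *\<^sub>R axis k 1) * g' a + f' a * g (a + 0 *\<^sub>R axis k 1)) (at 0)"
    by (rule has_vector_derivative_mult) (use assms in \<open>auto simp: fibre_derivative_def\<close>)
  then show "((\<lambda>t. f (a + t *\<^sub>R axis k 1) * g (a + t *\<^sub>R axis k 1)) has_vector_derivative f' a * g a + f a * g' a) (at 0)"
    by (simp add: add.commute)
qed

lemma fibre_derivative_add:
  assumes "fibre_derivative k f f'" "fibre_derivative k g g'"
  shows "fibre_derivative k (\<lambda>a. f a + g a) (\<lambda>a. f' a + g' a)"
  using assms unfolding fibre_derivative_def by (auto intro: has_vector_derivative_add)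

lemma growth_regular_mult:
  assumes "growth_regular k f f'" "growth_regular k g g'"
  shows "growth_regular k (\<lambda>a. f a * g a) (\<lambda>a. f' a * g a + f a * g' a)"
  using assms unfolding growth_regular_def
  by (auto intro!: continuous_intros subgauss_growth_mult subgauss_growth_add fibre_derivative_mult)

lemma growth_regular_add:
  assumes "growth_regular k f f'" "growth_regular k g g'"
  shows "growth_regular k (\<lambda>a. f a + g a) (\<lambda>a. f' a + g' a)"
  using assms unfolding growth_regular_def
  by (auto intro!: continuous_intros subgauss_growth_add fibre_derivative_add)

lemma growth_regular_const: "growth_regular k (\<lambda>a. c) (\<lambda>a. 0)"
  unfolding growth_regular_def fibre_derivative_def
  by (auto intro!: subgauss_growth_const)

lemma gauss_regular_growth:
  assumes "gauss_regular k f f'" "growth_regular k g g'"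
  shows "gauss_regular k (\<lambda>a. f a * g a) (\<lambda>a. f' a * g a + f a * g' a)"
  using assms unfolding gauss_regular_def growth_regular_def
  by (auto intro!: continuous_intros gauss_decay_subgauss gauss_decay_add fibre_derivative_mult)

lemma gauss_regular_mult:
  assumes "gauss_regular k f f'" "gauss_regular k g g'"
  shows "gauss_regular k (\<lambda>a. f a * g a) (\<lambda>a. f' a * g a + f a * g' a)"
  using assms unfolding gauss_regular_def
  by (auto intro!: continuous_intros gauss_decay_mult gauss_decay_add fibre_derivative_mult)

lemma gauss_regular_add:
  assumes "gauss_regular k f f'" "gauss_regular k g g'"
  shows "gauss_regular k (\<lambda>a. f a + g a) (\<lambda>a. f' a + g' a)"
  using assms unfolding gauss_regular_def
  by (auto intro!: continuous_intros gauss_decay_add fibre_derivative_add)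

lemma gauss_regular_scale:
  assumes "gauss_regular k f f'"
  shows "gauss_regular k (\<lambda>a. c * f a) (\<lambda>a. c * f' a)"
  using assms gauss_regular_growth[OF assms growth_regular_const[of k c]] by (simp add: mult.commute)

lemma gauss_regular_cnj:
  assumes "gauss_regular k f f'"
  shows "gauss_regular k (\<lambda>a. cnj (f a)) (\<lambda>a. cnj (f' a))"
  using assms unfolding gauss_regular_def fibre_derivative_def
  by (auto intro!: continuous_intros gauss_decay_cnj has_vector_derivative_cnj)

lemma real_polynomial_growth_regular:
  fixes p :: "real^'n \<Rightarrow> real"
  assumes "real_polynomial_function p"
  shows "\<exists>p'. growth_regular k (\<lambda>a. complex_of_real (p a)) p'"
  using assms
proof induction
  case (linear f)
  then interpret f: bounded_linear f .
  obtain K where K: "\<And>a. norm (f a) \<le> norm a * K"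
    using f.bounded by blast
  have "growth_regular k (\<lambda>a. complex_of_real (f a)) (\<lambda>a. complex_of_real (f (axis k 1)))"
    unfolding growth_regular_def fibre_derivative_def
  proof (intro conjI allI)
    show "continuous_on UNIV (\<lambda>a. complex_of_real (f a))"
      by (intro continuous_intros f.continuous_on)
    show "subgauss_growth (\<lambda>a. complex_of_real (f a))"
      by (rule subgauss_growth_linear[where K = K]) (use K in \<open>simp add: mult.commute\<close>)
    show "((\<lambda>t. complex_of_real (f (a + t *\<^sub>R axis k 1))) has_vector_derivative complex_of_real (f (axis k 1))) (at 0)" for a
      unfolding f.add f.scaleR by (auto intro!: derivative_eq_intros)
  qed (auto intro: subgauss_growth_const)
  then show ?case by blast
next
  case (const c)
  show ?case using growth_regular_const by blast
next
  case (add f g)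
  then obtain f' g' where "growth_regular k (\<lambda>a. complex_of_real (f a)) f'" "growth_regular k (\<lambda>a. complex_of_real (g a)) g'"
    by blast
  from growth_regular_add[OF this] show ?case by auto
next
  case (mult f g)
  then obtain f' g' where "growth_regular k (\<lambda>a. complex_of_real (f a)) f'" "growth_regular k (\<lambda>a. complex_of_real (g a)) g'"
    by blast
  from growth_regular_mult[OF this] show ?case by auto
qed

lemma polynomial_growth_regular:
  fixes P :: "real^'n \<Rightarrow> complex"
  assumes P: "polynomial_function P"
  shows "\<exists>P'. growth_regular k P P'"
proof -
  have "real_polynomial_function (Re \<circ> P)" "real_polynomial_function (Im \<circ> P)"
    using P bounded_linear_Re bounded_linear_Im by (auto simp: polynomial_function_def)
  then obtain R I where R: "growth_regular k (\<lambda>a. complex_of_real (Re (P a))) R"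
    and I: "growth_regular k (\<lambda>a. complex_of_real (Im (P a))) I"
    using real_polynomial_growth_regular[of "Re \<circ> P" k] real_polynomial_growth_regular[of "Im \<circ> P" k]
    unfolding comp_def by blast
  from growth_regular_add[OF R growth_regular_mult[OF growth_regular_const[of k \<i>] I]] show ?thesis
    by (auto simp: complex_eq[symmetric])
qed

text \<open>
  Splitting off \<open>exp (- m * (norm a)\<^sup>2)\<close>, with \<open>m\<close> the least real
  part of the quadratic coefficients, leaves a factor of at most exponential growth.
\<close>

lemma gauss_decay_general_gaussian:
  fixes \<alpha> \<beta> :: "'n::finite \<Rightarrow> complex"
  assumes \<alpha>: "\<forall>i. Re (\<alpha> i) > 0"
  shows "gauss_decay (\<lambda>a::real^'n. exp (- (\<Sum>i\<in>UNIV. \<alpha> i * of_real ((a $ i)\<^sup>2) + \<beta> i * of_real (a $ i))))"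
proof -
  define m where "m = Min (range (\<lambda>i. Re (\<alpha> i)))"
  have m: "m > 0" "m \<le> Re (\<alpha> i)" for i
    using \<alpha> by (auto simp: m_def)
  define rest where "rest a = exp (of_real (m * (norm a)\<^sup>2) - (\<Sum>i\<in>UNIV. \<alpha> i * of_real ((a $ i)\<^sup>2) + \<beta> i * of_real (a $ i)))" for a :: "real^'n"
  have "gauss_decay (\<lambda>a::real^'n. complex_of_real (exp (- m * (norm a)\<^sup>2)))"
    by (rule gauss_decayI[OF m(1), of _ 1]) auto
  moreover have "subgauss_growth rest"
  proof (rule subgauss_growth_exp_linear)
    fix a :: "real^'n"
    have "m * (norm a)\<^sup>2 - Re (\<Sum>i\<in>UNIV. \<alpha> i * of_real ((a $ i)\<^sup>2) + \<beta> i * of_real (a $ i))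
        = (\<Sum>i\<in>UNIV. (m - Re (\<alpha> i)) * (a $ i)\<^sup>2 - Re (\<beta> i) * a $ i)"
      by (simp add: norm_vec_sq sum_distrib_left sum_subtractf left_diff_distrib sum.distrib del: of_real_power)
    also have "\<dots> \<le> (\<Sum>i\<in>UNIV. cmod (\<beta> i) * norm a)"
    proof (rule sum_mono)
      fix i
      have "(m - Re (\<alpha> i)) * (a $ i)\<^sup>2 \<le> 0"
        using m(2)[of i] by (simp add: mult_nonpos_nonneg)
      moreover have "\<bar>Re (\<beta> i) * a $ i\<bar> \<le> cmod (\<beta> i) * norm a"
        unfolding abs_mult by (intro mult_mono abs_Re_le_cmod component_le_norm_cart) auto
      ultimately show "(m - Re (\<alpha> i)) * (a $ i)\<^sup>2 - Re (\<beta> i) * a $ i \<le> cmod (\<beta> i) * norm a"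
        by linarith
    qed
    finally show "cmod (rest a) \<le> exp ((\<Sum>i\<in>UNIV. cmod (\<beta> i)) * norm a)"
      by (simp add: rest_def sum_distrib_right)
  qed
  ultimately have "gauss_decay (\<lambda>a. complex_of_real (exp (- m * (norm a)\<^sup>2)) * rest a)"
    by (rule gauss_decay_subgauss)
  moreover have "complex_of_real (exp (- m * (norm a)\<^sup>2)) * rest a
      = exp (- (\<Sum>i\<in>UNIV. \<alpha> i * of_real ((a $ i)\<^sup>2) + \<beta> i * of_real (a $ i)))" for a
    unfolding rest_def exp_of_real[symmetric] exp_add[symmetric] by simp
  ultimately show ?thesis by simp
qed

lemma gauss_regular_general_gaussian:
  fixes \<alpha> \<beta> :: "'n::finite \<Rightarrow> complex"
  assumes \<alpha>: "\<forall>i. Re (\<alpha> i) > 0"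
  defines "g \<equiv> \<lambda>a::real^'n. exp (- (\<Sum>i\<in>UNIV. \<alpha> i * of_real ((a $ i)\<^sup>2) + \<beta> i * of_real (a $ i)))"
  shows "gauss_regular k g (\<lambda>a. g a * (- (2 * \<alpha> k * of_real (a $ k) + \<beta> k)))"
proof -
  have decay: "gauss_decay g"
    unfolding g_def by (rule gauss_decay_general_gaussian[OF \<alpha>])
  have cont: "continuous_on UNIV g"
    unfolding g_def by (intro continuous_intros)
  have "subgauss_growth (\<lambda>a::real^'n. (- (2 * \<alpha> k)) * of_real (a $ k) + (- \<beta> k))"
    by (intro subgauss_growth_add subgauss_growth_mult subgauss_growth_const subgauss_growth_linear[where K = 1])
       (simp add: component_le_norm_cart)
  then have "gauss_decay (\<lambda>a. g a * ((- (2 * \<alpha> k)) * of_real (a $ k) + (- \<beta> k)))"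
    by (rule gauss_decay_subgauss[OF decay])
  then have decay': "gauss_decay (\<lambda>a. g a * (- (2 * \<alpha> k * of_real (a $ k) + \<beta> k)))"
    by simp
  have "fibre_derivative k g (\<lambda>a. g a * (- (2 * \<alpha> k * of_real (a $ k) + \<beta> k)))"
    unfolding fibre_derivative_def
  proof
    fix a :: "real^'n"
    have "g (a + t *\<^sub>R axis k 1) = g a * exp (- (\<alpha> k * (2 * of_real (a $ k) * of_real t + (of_real t)\<^sup>2) + \<beta> k * of_real t))" for t
    proof -
      have "(\<Sum>i\<in>UNIV. \<alpha> i * of_real (((a + t *\<^sub>R axis k 1) $ i)\<^sup>2) + \<beta> i * of_real ((a + t *\<^sub>R axis k 1) $ i))
          = (\<Sum>i\<in>UNIV. (\<alpha> i * of_real ((a $ i)\<^sup>2) + \<beta> i * of_real (a $ i))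
              + (if i = k then \<alpha> k * (2 * of_real (a $ k) * of_real t + (of_real t)\<^sup>2) + \<beta> k * of_real t else 0))"
        by (rule sum.cong) (auto simp: axis_def power2_sum algebra_simps)
      also have "\<dots> = (\<Sum>i\<in>UNIV. \<alpha> i * of_real ((a $ i)\<^sup>2) + \<beta> i * of_real (a $ i))
          + (\<alpha> k * (2 * of_real (a $ k) * of_real t + (of_real t)\<^sup>2) + \<beta> k * of_real t)"
        by (simp only: sum.distrib sum.delta finite UNIV_I if_True)
      finally show ?thesis
        unfolding g_def by (simp only: minus_add_distrib exp_add)
    qed
    moreover have "((\<lambda>z. g a * exp (- (\<alpha> k * (2 * of_real (a $ k) * z + z\<^sup>2) + \<beta> k * z))) has_field_derivative
        g a * (- (2 * \<alpha> k * of_real (a $ k) + \<beta> k))) (at (of_real 0))"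
      by (auto intro!: derivative_eq_intros simp: algebra_simps)
    from has_vector_derivative_real_field[OF this]
    have "((\<lambda>t. g a * exp (- (\<alpha> k * (2 * of_real (a $ k) * of_real t + (of_real t)\<^sup>2) + \<beta> k * of_real t))) has_vector_derivative
        g a * (- (2 * \<alpha> k * of_real (a $ k) + \<beta> k))) (at 0)" .
    ultimately show "((\<lambda>t. g (a + t *\<^sub>R axis k 1)) has_vector_derivative g a * (- (2 * \<alpha> k * of_real (a $ k) + \<beta> k))) (at 0)"
      by simp
  qed
  then show ?thesis
    unfolding gauss_regular_def using cont decay decay' by (auto intro!: continuous_intros)
qed

lemma gauss_poly_regular: "f \<in> gauss_poly \<Longrightarrow> \<exists>f'. gauss_regular k f f'"
proof (induction rule: gauss_poly.induct)
  case (base \<alpha> P \<beta>)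
  obtain P' where "growth_regular k P P'"
    using polynomial_growth_regular[OF base(2)] by blast
  from gauss_regular_growth[OF gauss_regular_general_gaussian[OF base(1)] this] show ?case by blast
next
  case (scale f c)
  then show ?case using gauss_regular_scale by blast
next
  case (add f g)
  then show ?case using gauss_regular_add by blast
qed

lemma gauss_in_gauss_poly: "gauss c \<in> gauss_poly"
proof -
  have "gauss c = (\<lambda>a. exp (- (\<Sum>i\<in>UNIV. (1 / 2) * of_real ((a $ i)\<^sup>2) + (- c $ i) * of_real (a $ i))) * 1)"
    unfolding gauss_def by (simp add: fun_eq_iff sum_negf[symmetric])
  also have "\<dots> \<in> gauss_poly"
    by (rule gauss_poly.base) simp_all
  finally show ?thesis .
qed

lemma gauss_regular_gauss: "gauss_regular k (gauss c) (\<lambda>a. (c $ k - of_real (a $ k)) * gauss c a)"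
proof -
  have "gauss c = (\<lambda>a. exp (- (\<Sum>i\<in>UNIV. (1 / 2) * of_real ((a $ i)\<^sup>2) + (- c $ i) * of_real (a $ i))))"
    unfolding gauss_def by (simp add: fun_eq_iff sum_negf[symmetric])
  then show ?thesis
    using gauss_regular_general_gaussian[where \<alpha> = "\<lambda>_. 1 / 2" and \<beta> = "\<lambda>i. - c $ i" and k = k]
    by (simp add: mult.commute)
qed

text \<open>The fundamental theorem of calculus on each line in direction \<open>k\<close>.\<close>

lemma integral_fibre_derivative_zero:
  assumes f: "gauss_regular k f f'"
  shows "(\<integral>a. f' a \<partial>lborel) = 0"
proof -
  have decay: "gauss_decay f" "gauss_decay f'" and deriv: "fibre_derivative k f f'"
    and cont: "continuous_on UNIV f'"
    using f by (auto simp: gauss_regular_def)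
  have [measurable]: "f' \<in> borel_measurable borel"
    by (rule borel_measurable_continuous_onI[OF cont])
  have on_fibre: "gauss_decay (\<lambda>t. h (a + t *\<^sub>R axis k 1))" if h: "gauss_decay h" and a: "a $ k = 0" for h and a :: "real^'a"
  proof -
    obtain C e where C: "C \<ge> 0" "e > 0" "\<And>a. cmod (h a) \<le> C * exp (- e * (norm a)\<^sup>2)"
      using gauss_decayE[OF h] by metis
    have "cmod (h (a + t *\<^sub>R axis k 1)) \<le> C * exp (- e * (norm t)\<^sup>2)" for t
    proof -
      have "\<bar>(a + t *\<^sub>R axis k 1) $ k\<bar> \<le> norm (a + t *\<^sub>R axis k 1)"
        by (rule component_le_norm_cart)
      then have "\<bar>t\<bar> \<le> norm (a + t *\<^sub>R axis k 1)"
        using a by (simp add: axis_def)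
      then have "(norm t)\<^sup>2 \<le> (norm (a + t *\<^sub>R axis k 1))\<^sup>2"
        by (intro power_mono) auto
      then have "C * exp (- e * (norm (a + t *\<^sub>R axis k 1))\<^sup>2) \<le> C * exp (- e * (norm t)\<^sup>2)"
        using C by (intro mult_left_mono) auto
      with C(3)[of "a + t *\<^sub>R axis k 1"] show ?thesis by linarith
    qed
    with C(2) show ?thesis by (rule gauss_decayI)
  qed
  have "(\<integral>a. f' a \<partial>lborel) = (\<integral>(a::real^'a). 0 \<partial>lborel)"
  proof (rule integral_eq_if_fibres_eq[where k = k])
    show "integrable lborel f'"
      by (rule gauss_decay_integrable[OF decay(2)]) simp
    fix a :: "real^'a" assume a: "a $ k = 0"
    have "(\<integral>t. f' (a + t *\<^sub>R axis k 1) \<partial>lborel) = 0"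
    proof (rule integral_derivative_zero)
      show "((\<lambda>t. f (a + t *\<^sub>R axis k 1)) has_vector_derivative f' (a + t *\<^sub>R axis k 1)) (at t)" for t
        by (rule fibre_derivative_at[OF deriv])
      have "continuous_on UNIV (\<lambda>t. f' (a + t *\<^sub>R axis k 1))"
        by (rule continuous_on_compose2[OF cont]) (auto intro!: continuous_intros)
      then show "isCont (\<lambda>t. f' (a + t *\<^sub>R axis k 1)) t" for t
        by (simp add: continuous_on_eq_continuous_at)
    qed (intro on_fibre decay a)+
    then show "(\<integral>t. f' (a + t *\<^sub>R axis k 1) \<partial>lborel) = (\<integral>t. 0 \<partial>lborel)" by simp
  qed simp
  then show ?thesis by simp
qed


section \<open>Essential self-adjointness\<close>

text \<open>
  Both operators of the intertwiner have this form, with a linear form \<open>m\<close> that does not involve the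
  variable \<open>a $ k\<close>.
\<close>

definition fibre_op :: "real \<Rightarrow> (real^'n \<Rightarrow> real) \<Rightarrow> 'n \<Rightarrow> (real^'n \<Rightarrow> complex) \<Rightarrow> real^'n \<Rightarrow> complex" where
  "fibre_op \<kappa> m k f a = \<i> * of_real \<kappa> * vector_derivative (\<lambda>t. f (a + t *\<^sub>R axis k 1)) (at 0) + of_real (m a) * f a"

text \<open>
  Passing to adjoints reverses inclusions: any self-adjoint \<open>R\<close> that extends \<open>T\<close> lies in the adjoint
  of \<open>T\<close> and thus in \<open>S\<close>, and then \<open>S\<close> lies in \<open>R\<close>.
\<close>

lemma self_adjoint_ext_eqI:
  fixes S T :: "('n::finite l2 \<times> 'n l2) set"
  assumes S: "self_adjoint S" and ext: "T \<subseteq> S" and adj: "adjoint_graph T \<subseteq> S"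
  shows "self_adjoint_ext T = S"
  unfolding self_adjoint_ext_def
proof (rule the_equality)
  show "self_adjoint S \<and> T \<subseteq> S" using S ext by blast
  fix R assume R: "self_adjoint R \<and> T \<subseteq> R"
  have anti: "adjoint_graph B \<subseteq> adjoint_graph A" if "A \<subseteq> B" for A B :: "('n l2 \<times> 'n l2) set"
    using that by (auto simp: adjoint_graph_def)
  have "R = adjoint_graph R" using R by (simp add: self_adjoint_def)
  also have "\<dots> \<subseteq> adjoint_graph T" using R by (intro anti) simp
  finally have RS: "R \<subseteq> S" using adj by blast
  have "S = adjoint_graph S" using S by (simp add: self_adjoint_def)
  also have "\<dots> \<subseteq> adjoint_graph R" by (rule anti[OF RS])
  also have "\<dots> = R" using R by (simp add: self_adjoint_def)
  finally show "R = S" using RS by blast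
qed

context
  fixes \<kappa> :: real and m :: "real^'n::finite \<Rightarrow> real" and k :: 'n
  assumes m: "\<And>a t. m (a + t *\<^sub>R axis k 1) = m a" "continuous_on UNIV m" "subgauss_growth (\<lambda>a. complex_of_real (m a))"
begin

lemma measurable_m [measurable]: "m \<in> borel_measurable borel"
  by (rule borel_measurable_continuous_onI[OF m(2)])

text \<open>The multiplier to which the partial Fourier transform takes \<open>fibre_op \<kappa> m k\<close>.\<close>

definition symbol :: "real^'n \<Rightarrow> real" where
  "symbol a = - \<kappa> * a $ k + m a"

lemma measurable_symbol [measurable]: "symbol \<in> borel_measurable borel"
  unfolding symbol_def by measurable

lemma fibre_op_eq:
  assumes "gauss_regular k f f'"
  shows "fibre_op \<kappa> m k f = (\<lambda>a. \<i> * of_real \<kappa> * f' a + of_real (m a) * f a)"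
proof
  fix a
  have "vector_derivative (\<lambda>t. f (a + t *\<^sub>R axis k 1)) (at 0) = f' a"
    using assms by (intro vector_derivative_at) (simp add: gauss_regular_def fibre_derivative_def)
  then show "fibre_op \<kappa> m k f a = \<i> * of_real \<kappa> * f' a + of_real (m a) * f a"
    by (simp add: fibre_op_def)
qed

lemma gauss_regular_sq_integrable:
  assumes "gauss_regular k f f'"
  shows "sq_integrable f" "sq_integrable f'" "sq_integrable (\<lambda>a. of_real (m a) * f a)" "sq_integrable (fibre_op \<kappa> m k f)"
proof -
  have f: "continuous_on UNIV f" "continuous_on UNIV f'" "gauss_decay f" "gauss_decay f'"
    using assms by (auto simp: gauss_regular_def)
  have meas [measurable]: "f \<in> borel_measurable borel" "f' \<in> borel_measurable borel"
    by (intro borel_measurable_continuous_onI f)+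
  show "sq_integrable f" "sq_integrable f'"
    by (intro gauss_decay_sq_integrable f meas)+
  have "gauss_decay (\<lambda>a. f a * of_real (m a))"
    by (rule gauss_decay_subgauss[OF f(3) m(3)])
  then show mf: "sq_integrable (\<lambda>a. of_real (m a) * f a)"
    by (intro gauss_decay_sq_integrable) (simp_all add: mult.commute)
  show "sq_integrable (fibre_op \<kappa> m k f)"
    unfolding fibre_op_eq[OF assms]
    by (intro sq_integrable_add mf sq_integrable_scale) fact
qed

text \<open>Integration by parts; the sign is absorbed by the conjugation of \<open>\<i>\<close>.\<close>

lemma fibre_op_symmetric:
  assumes f: "gauss_regular k f f'" and g: "gauss_regular k g g'"
  shows "l2_inner (abs_l2 f) (abs_l2 (fibre_op \<kappa> m k g)) = l2_inner (abs_l2 (fibre_op \<kappa> m k f)) (abs_l2 g)"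
proof -
  note sq = gauss_regular_sq_integrable[OF f] gauss_regular_sq_integrable[OF g]
  have i: "integrable lborel (\<lambda>a. cnj (f a) * g' a)" "integrable lborel (\<lambda>a. cnj (f' a) * g a)"
    "integrable lborel (\<lambda>a. cnj (f a) * (of_real (m a) * g a))"
    by (intro integrable_sq_prod sq)+
  have "(\<integral>a. cnj (f' a) * g a + cnj (f a) * g' a \<partial>lborel) = 0"
    by (rule integral_fibre_derivative_zero[OF gauss_regular_mult[OF gauss_regular_cnj[OF f] g]])
  then have parts: "(\<integral>a. cnj (f a) * g' a \<partial>lborel) = - (\<integral>a. cnj (f' a) * g a \<partial>lborel)"
    using i by (simp add: eq_neg_iff_add_eq_0 add.commute)
  have "l2_inner (abs_l2 f) (abs_l2 (fibre_op \<kappa> m k g))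
      = (\<integral>a. \<i> * of_real \<kappa> * (cnj (f a) * g' a) + cnj (f a) * (of_real (m a) * g a) \<partial>lborel)"
    unfolding inner_abs_l2[OF sq(1) sq(8)] unfolding fibre_op_eq[OF g]
    by (rule Bochner_Integration.integral_cong) (simp_all add: algebra_simps)
  also have "\<dots> = \<i> * of_real \<kappa> * (\<integral>a. cnj (f a) * g' a \<partial>lborel) + (\<integral>a. cnj (f a) * (of_real (m a) * g a) \<partial>lborel)"
    using i by simp
  also have "\<dots> = - \<i> * of_real \<kappa> * (\<integral>a. cnj (f' a) * g a \<partial>lborel) + (\<integral>a. cnj (f a) * (of_real (m a) * g a) \<partial>lborel)"
    unfolding parts by simp
  also have "\<dots> = (\<integral>a. - \<i> * of_real \<kappa> * (cnj (f' a) * g a) + cnj (f a) * (of_real (m a) * g a) \<partial>lborel)"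
    using i by simp
  also have "\<dots> = l2_inner (abs_l2 (fibre_op \<kappa> m k f)) (abs_l2 g)"
    unfolding inner_abs_l2[OF sq(4) sq(5)] unfolding fibre_op_eq[OF f]
    by (rule Bochner_Integration.integral_cong) (simp_all add: algebra_simps)
  finally show ?thesis .
qed

lemma partial_fourier_fibre_op_gauss:
  "sq_integrable (\<lambda>a. of_real (symbol a) * gauss_hat k c a)"
  "partial_fourier k (abs_l2 (fibre_op \<kappa> m k (gauss c))) = abs_l2 (\<lambda>a. of_real (symbol a) * gauss_hat k c a)"
proof -
  note g = gauss_regular_gauss[of k c]
  have "subgauss_growth (\<lambda>a::real^'n. complex_of_real (- \<kappa>) * of_real (a $ k) + of_real (m a))"
    by (intro subgauss_growth_add subgauss_growth_mult subgauss_growth_const m subgauss_growth_linear[where K = 1])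
       (simp add: component_le_norm_cart)
  then have "subgauss_growth (\<lambda>a. complex_of_real (symbol a))"
    by (simp add: symbol_def)
  from gauss_decay_subgauss[OF gauss_decay_gauss_hat this]
  show sq: "sq_integrable (\<lambda>a. of_real (symbol a) * gauss_hat k c a)"
    by (intro gauss_decay_sq_integrable) (simp_all add: mult.commute)
  define u where "u = partial_fourier k (abs_l2 (fibre_op \<kappa> m k (gauss c)))"
  define v where "v = abs_l2 (\<lambda>a. of_real (symbol a) * gauss_hat k c a)"
  have "l2_inner (abs_l2 (gauss_hat k b)) u = l2_inner (abs_l2 (gauss_hat k b)) v" for b
  proof -
    have "l2_inner (abs_l2 (gauss_hat k b)) u = l2_inner (abs_l2 (gauss b)) (abs_l2 (fibre_op \<kappa> m k (gauss c)))"
      unfolding u_def partial_fourier_gauss[symmetric] unitary_inner[OF unitary_partial_fourier] ..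
    also have "\<dots> = (\<integral>a. cnj (gauss b a) * fibre_op \<kappa> m k (gauss c) a \<partial>lborel)"
      by (rule inner_abs_l2[OF sq_integrable_gauss gauss_regular_sq_integrable(4)[OF g]])
    also have "\<dots> = (\<integral>a. cnj (gauss b a) * ((\<i> * of_real \<kappa> * (c $ k - of_real (a $ k)) + of_real (m a)) * gauss c a) \<partial>lborel)"
      unfolding fibre_op_eq[OF g] by (simp add: distrib_right mult.assoc)
    also have "\<dots> = (\<integral>a. cnj (gauss_hat k b a) * ((- of_real \<kappa> * of_real (a $ k) + of_real (m a)) * gauss_hat k c a) \<partial>lborel)"
      by (rule gauss_hat_matrix_element) (simp_all add: m)
    also have "\<dots> = l2_inner (abs_l2 (gauss_hat k b)) v"
      unfolding v_def inner_abs_l2[OF sq_integrable_gauss_hat sq] by (simp add: symbol_def)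
    finally show ?thesis .
  qed
  then have "u - v = 0"
    by (intro total_gauss_hat[unfolded total_def, rule_format, of k]) (simp add: l2_inner_diff_right)
  then show "partial_fourier k (abs_l2 (fibre_op \<kappa> m k (gauss c))) = abs_l2 (\<lambda>a. of_real (symbol a) * gauss_hat k c a)"
    by (simp add: u_def v_def)
qed

text \<open>
  The pairs that are adjoint to the operator on Gaussians alone are already in the graph of the
  multiplication operator, because the transformed Gaussians separate functions. This covers the
  pairs adjoint to the operator on its whole domain and, by symmetry, the operator itself.
\<close>

lemma adjoint_on_gauss:
  assumes uv: "\<And>c. l2_inner u (abs_l2 (fibre_op \<kappa> m k (gauss c))) = l2_inner v (abs_l2 (gauss c))"
  shows "(u, v) \<in> spectral_graph (partial_fourier k) symbol"
proof -
  define U where "U = partial_fourier k"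
  have U: "unitary U" by (simp add: U_def unitary_partial_fourier)
  define w where "w a = cnj (rep_l2 (U u) a) * of_real (symbol a) - cnj (rep_l2 (U v) a)" for a
  have i: "integrable lborel (\<lambda>a. cnj (rep_l2 (U u) a) * (of_real (symbol a) * gauss_hat k c a))"
    "integrable lborel (\<lambda>a. cnj (rep_l2 (U v) a) * gauss_hat k c a)" for c
    by (intro integrable_sq_prod sq_integrable_rep partial_fourier_fibre_op_gauss sq_integrable_gauss_hat)+
  have eq: "w a * gauss_hat k c a = cnj (rep_l2 (U u) a) * (of_real (symbol a) * gauss_hat k c a) - cnj (rep_l2 (U v) a) * gauss_hat k c a" for a c
    by (simp add: w_def algebra_simps)
  have i_hat: "integrable lborel (\<lambda>a. w a * gauss_hat k c a)" for c
    unfolding eq by (intro Bochner_Integration.integrable_diff i)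
  have zero_hat: "(\<integral>a. w a * gauss_hat k c a \<partial>lborel) = 0" for c
  proof -
    have "(\<integral>a. w a * gauss_hat k c a \<partial>lborel) = l2_inner (U u) (abs_l2 (\<lambda>a. of_real (symbol a) * gauss_hat k c a))
        - l2_inner (U v) (abs_l2 (gauss_hat k c))"
      unfolding eq Bochner_Integration.integral_diff[OF i]
        inner_abs_l2_right[OF partial_fourier_fibre_op_gauss(1)] inner_abs_l2_right[OF sq_integrable_gauss_hat] ..
    also have "\<dots> = l2_inner u (abs_l2 (fibre_op \<kappa> m k (gauss c))) - l2_inner v (abs_l2 (gauss c))"
      unfolding U_def partial_fourier_fibre_op_gauss(2)[symmetric] partial_fourier_gauss[symmetric]
        unitary_inner[OF unitary_partial_fourier] ..
    finally show ?thesis by (simp add: uv)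
  qed
  have "AE a in lborel. w a = 0"
  proof (rule AE_zero_if_orthogonal_to_gauss)
    fix c :: "complex^'n"
    obtain c' where c': "turn k c' = c" using surj_turn by blast
    define s where "s = exp ((c' $ k)\<^sup>2 / 2)"
    have g: "w a * gauss c a = inverse s * (w a * gauss_hat k c' a)" for a
      by (simp add: gauss_hat_def c' s_def)
    show "integrable lborel (\<lambda>a. w a * gauss c a)"
      unfolding g by (intro integrable_mult_right i_hat)
    show "(\<integral>a. w a * gauss c a \<partial>lborel) = 0"
      unfolding g integral_mult_right_zero zero_hat by simp
  qed
  then have "AE a in lborel. rep_l2 (U v) a = of_real (symbol a) * rep_l2 (U u) a"
  proof eventually_elim
    case (elim a)
    then have "cnj (rep_l2 (U v) a) = cnj (of_real (symbol a) * rep_l2 (U u) a)"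
      by (simp add: w_def mult.commute)
    then show ?case by (simp only: complex_cnj_cancel_iff)
  qed
  then show ?thesis
    by (simp add: spectral_graph_def U_def)
qed

theorem self_adjoint_ext_fibre_op:
  "self_adjoint_ext (graph_on_gauss_poly (fibre_op \<kappa> m k)) = spectral_graph (partial_fourier k) symbol"
proof (rule self_adjoint_ext_eqI)
  show "self_adjoint (spectral_graph (partial_fourier k) symbol)"
    by (rule self_adjoint_spectral_graph[OF unitary_partial_fourier measurable_symbol])
  show "graph_on_gauss_poly (fibre_op \<kappa> m k) \<subseteq> spectral_graph (partial_fourier k) symbol"
  proof
    fix x assume "x \<in> graph_on_gauss_poly (fibre_op \<kappa> m k)"
    then obtain f where x: "x = (abs_l2 f, abs_l2 (fibre_op \<kappa> m k f))" and "f \<in> gauss_poly"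
      by (auto simp: graph_on_gauss_poly_def)
    then obtain f' where "gauss_regular k f f'"
      using gauss_poly_regular by blast
    then show "x \<in> spectral_graph (partial_fourier k) symbol"
      unfolding x by (intro adjoint_on_gauss fibre_op_symmetric[OF _ gauss_regular_gauss])
  qed
  show "adjoint_graph (graph_on_gauss_poly (fibre_op \<kappa> m k)) \<subseteq> spectral_graph (partial_fourier k) symbol"
  proof
    fix x assume x: "x \<in> adjoint_graph (graph_on_gauss_poly (fibre_op \<kappa> m k))"
    obtain u v where uv: "x = (u, v)" by (cases x)
    have "l2_inner u (abs_l2 (fibre_op \<kappa> m k (gauss c))) = l2_inner v (abs_l2 (gauss c))" for c
      using x gauss_in_gauss_poly[of c] unfolding uv adjoint_graph_def graph_on_gauss_poly_def by blast
    then show "x \<in> spectral_graph (partial_fourier k) symbol"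
      unfolding uv by (rule adjoint_on_gauss)
  qed
qed

end


section \<open>The quantum dilogarithm\<close>

lemma sinh_nonzero_near_0:
  assumes "w \<noteq> 0" "cmod w < pi"
  shows "sinh w \<noteq> 0"
proof
  assume "sinh w = 0"
  then have *: "exp w = exp (- w)"
    unfolding sinh_field_def by (metis divide_eq_0_iff zero_neq_numeral eq_iff_diff_eq_0)
  have "exp (2 * w) = exp w * exp w"
    unfolding mult_2 exp_add ..
  also have "\<dots> = exp (- w) * exp w"
    by (rule arg_cong[OF *])
  also have "\<dots> = 1"
    unfolding exp_add[symmetric] by simp
  finally have "Re (2 * w) = 0 \<and> (\<exists>n::int. Im (2 * w) = of_int (2 * n) * pi)"
    by (rule exp_eq_1[THEN iffD1])
  then obtain n :: int where n: "Re (2 * w) = 0" "Im (2 * w) = of_int (2 * n) * pi"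
    by blast
  then have n: "Re w = 0" "Im w = of_int n * pi"
    by simp_all
  have "n \<noteq> 0"
    using assms(1) n by (auto simp: complex_eq_iff)
  then have "1 * pi \<le> \<bar>of_int n\<bar> * pi"
    by (intro mult_right_mono) auto
  moreover have "cmod w = \<bar>of_int n\<bar> * pi"
    by (simp add: cmod_def n abs_mult)
  ultimately show False
    using assms(2) by simp
qed

definition sinhc :: "complex \<Rightarrow> complex" where
  "sinhc w = (if w = 0 then 1 else sinh w / w)"

lemma holomorphic_sinhc: "sinhc holomorphic_on UNIV"
proof -
  have "(\<lambda>w. if w = 0 then deriv sinh 0 else (sinh w - sinh 0) / (w - 0)) holomorphic_on (UNIV :: complex set)"
    by (rule pole_lemma_open) (auto intro!: holomorphic_intros simp: sinh_field_def[abs_def])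
  moreover have "deriv sinh (0::complex) = 1"
    by (rule DERIV_imp_deriv) (auto intro!: derivative_eq_intros)
  then have "(\<lambda>w. if w = 0 then deriv sinh 0 else (sinh w - sinh 0) / (w - 0)) = sinhc"
    by (auto simp: sinhc_def fun_eq_iff)
  ultimately show ?thesis by simp
qed

lemma sinhc_minus: "sinhc (- w) = sinhc w"
  by (simp add: sinhc_def)

lemma sinhc_nonzero: "cmod w < pi \<Longrightarrow> sinhc w \<noteq> 0"
  using sinh_nonzero_near_0[of w] by (auto simp: sinhc_def)

text \<open>The integrand at \<open>z = 0\<close> times \<open>p ^ 3\<close>, continued to the origin: an even function, holomorphic near 0.\<close>

definition regular_factor :: "real \<Rightarrow> complex \<Rightarrow> complex" where
  "regular_factor h p = inverse (of_real (pi\<^sup>2 * h) * sinhc (of_real pi * p) * sinhc (of_real (pi * h) * p))"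

lemma qdilog_radius_pos: "h > 0 \<Longrightarrow> qdilog_radius h > 0"
  by (simp add: qdilog_radius_def)

lemma within_poles:
  assumes "h > 0" "cmod p < 2 * qdilog_radius h"
  shows "cmod (of_real pi * p) < pi" "cmod (of_real (pi * h) * p) < pi"
proof -
  have "cmod p < 1" "cmod p < 1 / h"
    using assms by (auto simp: qdilog_radius_def)
  then have "pi * cmod p < pi * 1" "pi * (h * cmod p) < pi * 1"
    using assms by (auto simp: field_simps)
  then show "cmod (of_real pi * p) < pi" "cmod (of_real (pi * h) * p) < pi"
    using assms by (auto simp: norm_mult mult.assoc)
qed

lemma qdilog_integrand_eq:
  assumes "h > 0" "p \<noteq> 0"
  shows "qdilog_integrand h z p = exp (- \<i> * of_real z * p) * regular_factor h p / p ^ 3"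
proof -
  have cancel: "inverse (P\<^sup>2 * H * (s / (P * p)) * (t / (P * H * p))) / p ^ 3 = inverse (s * t) / p"
    if "P \<noteq> 0" "H \<noteq> 0" for P H s t :: complex
  proof -
    have "P\<^sup>2 * H * (s / (P * p)) * (t / (P * H * p)) = s * t / p\<^sup>2"
      using that assms(2) by (simp add: power2_eq_square)
    then show ?thesis
      using assms(2) by (simp add: power2_eq_square power3_eq_cube inverse_eq_divide)
  qed
  have "regular_factor h p / p ^ 3 = inverse (sinh (of_real pi * p) * sinh (of_real (pi * h) * p)) / p"
    using cancel[of "of_real pi" "of_real h" "sinh (of_real pi * p)" "sinh (of_real (pi * h) * p)"] assms
    by (simp add: regular_factor_def sinhc_def)
  then show ?thesis
    unfolding times_divide_eq_right[symmetric]
    by (simp add: qdilog_integrand_def divide_inverse mult.commute[of p] mult.assoc)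
qed

lemma holomorphic_regular_factor:
  assumes "h > 0"
  shows "regular_factor h holomorphic_on ball 0 (2 * qdilog_radius h)"
proof -
  have *: "(\<lambda>p. sinhc (c * p)) holomorphic_on A" for c A
  proof -
    have "(sinhc \<circ> (\<lambda>p. c * p)) holomorphic_on A"
      by (rule holomorphic_on_compose_gen[OF
            holomorphic_on_mult[OF holomorphic_on_const holomorphic_on_ident] holomorphic_sinhc])
         simp
    then show ?thesis by (simp add: o_def)
  qed
  show ?thesis
    unfolding regular_factor_def
  proof (intro holomorphic_on_inverse holomorphic_on_mult holomorphic_on_const *)
    fix p assume "p \<in> ball (0::complex) (2 * qdilog_radius h)"
    then have "sinhc (of_real pi * p) \<noteq> 0" "sinhc (of_real (pi * h) * p) \<noteq> 0"
      using within_poles[OF assms, of p] by (simp_all add: sinhc_nonzero del: of_real_mult)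
    then show "of_real (pi\<^sup>2 * h) * sinhc (of_real pi * p) * sinhc (of_real (pi * h) * p) \<noteq> 0"
      using assms by (simp del: of_real_mult)
  qed
qed

text \<open>
  The origin is a pole of order three, so the residue is half the second derivative of \<open>exp
  (- \<i> * z * p) * regular_factor h p\<close>. As the second factor is even, it has no term
  linear in \<open>z\<close>.
\<close>

lemma qdilog_circle_integral:
  assumes h: "h > 0"
  shows "contour_integral (circlepath 0 (qdilog_radius h)) (qdilog_integrand h z)
    = of_real pi * \<i> * (deriv (deriv (regular_factor h)) 0 - of_real (z\<^sup>2 / (pi\<^sup>2 * h)))"
proof -
  define r where "r = qdilog_radius h"
  have r: "r > 0" using h by (simp add: r_def qdilog_radius_pos)
  define k where "k = regular_factor h"
  define f where "f p = exp (- \<i> * of_real z * p) * k p" for p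
  have k_hol: "k holomorphic_on ball 0 (2 * r)"
    using holomorphic_regular_factor[OF h] by (simp add: k_def r_def)
  have f_hol: "f holomorphic_on ball 0 (2 * r)"
    unfolding f_def by (intro holomorphic_intros k_hol)
  have k': "(k has_field_derivative deriv k p) (at p)" if "p \<in> ball 0 (2 * r)" for p
    using holomorphic_derivI[OF k_hol open_ball that] .
  have k'': "(deriv k has_field_derivative deriv (deriv k) p) (at p)" if "p \<in> ball 0 (2 * r)" for p
    using holomorphic_derivI[OF holomorphic_deriv[OF k_hol open_ball] open_ball that] .
  have f': "deriv f p = exp (- \<i> * of_real z * p) * (deriv k p - \<i> * of_real z * k p)"
    if "p \<in> ball 0 (2 * r)" for p
    unfolding f_def
  proof (rule DERIV_imp_deriv)
    have "((\<lambda>p. exp (- \<i> * of_real z * p)) has_field_derivative exp (- \<i> * of_real z * p) * (- \<i> * of_real z)) (at p)"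
      by (auto intro!: derivative_eq_intros)
    from DERIV_mult'[OF this k'[OF that]]
    show "((\<lambda>p. exp (- \<i> * of_real z * p) * k p) has_field_derivative
        exp (- \<i> * of_real z * p) * (deriv k p - \<i> * of_real z * k p)) (at p)"
      by (simp add: algebra_simps)
  qed
  have z0: "(0::complex) \<in> ball 0 (2 * r)" using r by simp
  \<comment> \<open>The odd Taylor coefficients of the even function \<open>k\<close> vanish.\<close>
  have k1: "deriv k 0 = 0"
  proof -
    have "k (- p) = k p" for p
      by (simp add: k_def regular_factor_def sinhc_minus del: of_real_mult)
    then have "((\<lambda>p. k p) has_field_derivative - deriv k 0) (at 0)"
      using DERIV_chain2[of k "deriv k 0" uminus 0 "-1" UNIV] k'[OF z0]
      by (simp add: DERIV_minus[OF DERIV_ident])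
    with k'[OF z0] have "deriv k 0 = - deriv k 0" by (rule DERIV_unique)
    then show ?thesis by simp
  qed
  have k0: "k 0 = of_real (1 / (pi\<^sup>2 * h))"
    by (simp add: k_def regular_factor_def sinhc_def field_simps)
  have "deriv (deriv f) 0 = deriv (\<lambda>p. exp (- \<i> * of_real z * p) * (deriv k p - \<i> * of_real z * k p)) 0"
  proof (rule deriv_cong_ev)
    show "\<forall>\<^sub>F p in nhds 0. deriv f p = exp (- \<i> * of_real z * p) * (deriv k p - \<i> * of_real z * k p)"
      using eventually_nhds_in_open[OF open_ball z0] by eventually_elim (rule f')
  qed simp
  also have "\<dots> = deriv (deriv k) 0 - 2 * \<i> * of_real z * deriv k 0 - of_real (z\<^sup>2) * k 0"
    by (rule DERIV_imp_deriv)
       (auto intro!: derivative_eq_intros k'[OF z0] k''[OF z0] simp: algebra_simps power2_eq_square)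
  finally have f2: "deriv (deriv f) 0 = deriv (deriv k) 0 - of_real (z\<^sup>2 / (pi\<^sup>2 * h))"
    by (simp add: k1 k0)
  have "contour_integral (circlepath 0 r) (qdilog_integrand h z)
      = contour_integral (circlepath 0 r) (\<lambda>u. f u / (u - 0) ^ Suc 2)"
  proof (rule contour_integral_eq)
    fix p assume "p \<in> path_image (circlepath 0 r)"
    then have "p \<noteq> 0" using r by auto
    then show "qdilog_integrand h z p = f p / (p - 0) ^ Suc 2"
      using qdilog_integrand_eq[OF h, of p z] by (simp add: f_def k_def power3_eq_cube power2_eq_square mult.assoc)
  qed
  also have "\<dots> = (2 * pi * \<i>) * (deriv ^^ 2) f 0 / fact 2"
    by (rule Cauchy_contour_integral_circlepath)
       (use r in \<open>auto intro!: holomorphic_on_imp_continuous_on holomorphic_on_subset[OF f_hol]\<close>)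
  also have "\<dots> = pi * \<i> * deriv (deriv f) 0"
    by (simp add: numeral_2_eq_2)
  finally show ?thesis
    unfolding f2 r_def k_def by simp
qed

lemma qdilog_integrand_minus: "qdilog_integrand h (- z) p = - qdilog_integrand h z (- p)"
  by (simp add: qdilog_integrand_def)

lemma qdilog_integrand_cnj: "cnj (qdilog_integrand h z p) = - qdilog_integrand h z (- cnj p)"
proof -
  have "cnj (sinh w) = sinh (cnj w)" for w
    by (simp add: sinh_field_def exp_cnj)
  then show ?thesis
    by (simp add: qdilog_integrand_def exp_cnj)
qed

definition qdilog_arc :: "real \<Rightarrow> real \<Rightarrow> complex" where
  "qdilog_arc h z = contour_integral (part_circlepath 0 (qdilog_radius h) pi 0) (qdilog_integrand h z)"

definition circle_integrand :: "real \<Rightarrow> real \<Rightarrow> real \<Rightarrow> complex" where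
  "circle_integrand h z t = qdilog_integrand h z (of_real (qdilog_radius h) * cis t)
     * of_real (qdilog_radius h) * \<i> * cis t"

lemma continuous_circle_integrand:
  assumes h: "h > 0"
  shows "continuous_on UNIV (\<lambda>(z, t). circle_integrand h z t)"
proof -
  define r where "r = qdilog_radius h"
  have r: "r > 0" using h by (simp add: r_def qdilog_radius_pos)
  have "cmod (of_real r * cis t) < 2 * qdilog_radius h" for t
    using r by (simp add: norm_mult r_def)
  note small = within_poles[OF h this]
  have nz: "of_real r * cis t \<noteq> 0" for t
    using r by simp
  have nz1: "sinh (of_real pi * (of_real r * cis t)) \<noteq> 0" for t
    by (rule sinh_nonzero_near_0[OF _ small(1)]) (use r in simp)
  have nz2: "sinh (of_real (pi * h) * (of_real r * cis t)) \<noteq> 0" for t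
    by (rule sinh_nonzero_near_0[OF _ small(2)]) (use r h in simp)
  show ?thesis
    unfolding circle_integrand_def qdilog_integrand_def case_prod_unfold r_def[symmetric]
    by (intro continuous_intros ballI) (simp_all only: mult_eq_0_iff[of "sinh _"] nz nz1 nz2 simp_thms not_False_eq_True)
qed

lemma continuous_circle_integrand_t: "h > 0 \<Longrightarrow> continuous_on A (circle_integrand h z)"
  using continuous_on_compose2[OF continuous_circle_integrand, of h A "\<lambda>t. (z, t)"]
  by (simp add: continuous_on_Pair)

lemma qdilog_arc_eq: "qdilog_arc h z = - integral {0..pi} (circle_integrand h z)"
  unfolding qdilog_arc_def
  by (subst contour_integral_part_circlepath_reverse, subst contour_integral_part_circlepath_eq)
     (auto simp: circle_integrand_def[abs_def])

text \<open>
  Changing the sign of \<open>z\<close> amounts to changing that of \<open>p\<close>, which turns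
  the upper half circle into the lower one. The minus sign comes from the clockwise orientation of
  the half circle.
\<close>

lemma qdilog_arc_plus_minus:
  assumes h: "h > 0"
  shows "qdilog_arc h z + qdilog_arc h (- z)
    = - contour_integral (circlepath 0 (qdilog_radius h)) (qdilog_integrand h z)"
proof -
  have "cis (t + pi) = - cis t" for t
    by (simp add: complex_eq_iff)
  then have "circle_integrand h (- z) = (\<lambda>t. circle_integrand h z (t + pi))"
    by (simp add: circle_integrand_def qdilog_integrand_minus fun_eq_iff)
  then have "integral {0..pi} (circle_integrand h (- z)) = integral {pi..2 * pi} (circle_integrand h z)"
    using integral_shift_real_ivl[of pi pi "2 * pi" "circle_integrand h z"] by simp
  moreover have "integral {0..pi} (circle_integrand h z) + integral {pi..2 * pi} (circle_integrand h z)
      = integral {0..2 * pi} (circle_integrand h z)"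
    by (rule Henstock_Kurzweil_Integration.integral_combine)
       (auto intro!: integrable_continuous_real continuous_circle_integrand_t h)
  moreover have "contour_integral (circlepath 0 (qdilog_radius h)) (qdilog_integrand h z)
      = integral {0..2 * pi} (circle_integrand h z)"
    unfolding circlepath_def
    by (subst contour_integral_part_circlepath_eq) (auto simp: circle_integrand_def[abs_def])
  moreover have "qdilog_arc h z + qdilog_arc h (- z)
      = - (integral {0..pi} (circle_integrand h z) + integral {0..pi} (circle_integrand h (- z)))"
    by (simp add: qdilog_arc_eq)
  ultimately show ?thesis by simp
qed

text \<open>
  The map \<open>p \<mapsto> - cnj p\<close> takes the half circle to itself with the opposite
  orientation.
\<close>

lemma cnj_qdilog_arc:
  assumes h: "h > 0"
  shows "cnj (qdilog_arc h z) = - qdilog_arc h z"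
proof -
  have "cnj (circle_integrand h z t) = - circle_integrand h z (pi - t)" for t
  proof -
    have c: "cnj (cis t) = - cis (pi - t)"
      by (simp add: complex_eq_iff)
    show ?thesis
      unfolding circle_integrand_def complex_cnj_mult c qdilog_integrand_cnj by simp
  qed
  then have "cnj (integral {0..pi} (circle_integrand h z)) = - integral {0..pi} (\<lambda>t. circle_integrand h z (pi - t))"
    by (simp add: Henstock_Kurzweil_Integration.integral_cnj)
  also have "\<dots> = - integral {-pi..0} (\<lambda>t. circle_integrand h z (t + pi))"
    using Henstock_Kurzweil_Integration.integral_reflect_real[where a = "- pi" and b = 0
        and f = "\<lambda>t. circle_integrand h z (t + pi)"]
    by simp
  also have "\<dots> = - integral {0..pi} (circle_integrand h z)"
    using integral_shift_real_ivl[of 0 pi pi "circle_integrand h z"] by simp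
  finally have "cnj (integral {0..pi} (circle_integrand h z)) = - integral {0..pi} (circle_integrand h z)" .
  then show ?thesis by (simp add: qdilog_arc_eq)
qed


definition qdilog_tail :: "real \<Rightarrow> real \<Rightarrow> complex" where
  "qdilog_tail h z = (LINT p:{qdilog_radius h..}|lborel. qdilog_integrand h z (of_real p))"

lemma qdilog_left_tail:
  "(LINT p:{..- qdilog_radius h}|lborel. qdilog_integrand h z (of_real p)) = - qdilog_tail h (- z)"
proof -
  have s: "{p. - p \<in> {..- qdilog_radius h}} = {qdilog_radius h..}"
    by auto
  have F: "qdilog_integrand h z (of_real (- p)) = - qdilog_integrand h (- z) (of_real p)" for p :: real
    by (simp add: qdilog_integrand_minus)
  have "(LINT p:{..- qdilog_radius h}|lborel. qdilog_integrand h z (of_real p))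
      = (LINT p:{p. - p \<in> {..- qdilog_radius h}}|lborel. qdilog_integrand h z (of_real (- p)))"
    by (rule set_integral_reflect)
  then show ?thesis
    unfolding s F by (simp add: qdilog_tail_def set_lebesgue_integral_def)
qed

lemma qdilog_eq: "qdilog h z = exp (- (1 / 4) * (qdilog_tail h z - qdilog_tail h (- z) + qdilog_arc h z))"
  unfolding qdilog_def Let_def qdilog_left_tail qdilog_arc_def[symmetric] qdilog_tail_def[symmetric]
  by (simp add: algebra_simps)

lemma cnj_qdilog_tail: "cnj (qdilog_tail h z) = qdilog_tail h (- z)"
proof -
  have "cnj (qdilog_integrand h z (of_real p)) = qdilog_integrand h (- z) (of_real p)" for p :: real
    by (simp add: qdilog_integrand_minus qdilog_integrand_cnj)
  then show ?thesis
    unfolding qdilog_tail_def set_lebesgue_integral_def Bochner_Integration.integral_cnj[symmetric]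
    by simp
qed

text \<open>The exponent is purely imaginary.\<close>

lemma cmod_qdilog: "h > 0 \<Longrightarrow> cmod (qdilog h z) = 1"
proof -
  assume h: "h > 0"
  define w where "w = qdilog_tail h z - qdilog_tail h (- z) + qdilog_arc h z"
  have "cnj w = - w"
    using cnj_qdilog_tail[of h z] cnj_qdilog_tail[of h "- z"] cnj_qdilog_arc[OF h, of z]
    by (simp add: w_def)
  then have "Re w = 0"
    by (simp add: complex_eq_iff)
  then show ?thesis
    by (simp add: qdilog_eq w_def)
qed

text \<open>
  In the sum of the exponents at \<open>z\<close> and \<open>- z\<close> the half lines cancel,
  and the half circles make up a circle.
\<close>

lemma qdilog_mult_minus:
  assumes h: "h > 0"
  obtains C where "\<And>z. qdilog h z * qdilog h (- z) = C * exp (- \<i> * of_real (z\<^sup>2 / (4 * pi * h)))"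
proof
  define D where "D = of_real pi * \<i> * deriv (deriv (regular_factor h)) 0"
  fix z :: real
  define E :: complex where "E = \<i> * of_real (z\<^sup>2 / (4 * pi * h))"
  have E: "of_real pi * \<i> * of_real (z\<^sup>2 / (pi\<^sup>2 * h)) = 4 * E"
    using h by (simp add: E_def field_simps power2_eq_square)
  have arc: "qdilog_arc h z + qdilog_arc h (- z) = 4 * E - D"
    unfolding qdilog_arc_plus_minus[OF h] qdilog_circle_integral[OF h] D_def E[symmetric]
    by (simp only: right_diff_distrib minus_diff_eq)
  have "qdilog h z * qdilog h (- z) = exp (- (1 / 4) * (qdilog_arc h z + qdilog_arc h (- z)))"
    by (simp add: qdilog_eq mult_exp_exp algebra_simps)
  then show "qdilog h z * qdilog h (- z) = exp (D / 4) * exp (- \<i> * of_real (z\<^sup>2 / (4 * pi * h)))"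
    unfolding arc mult_minus_left E_def[symmetric] by (simp add: mult_exp_exp diff_divide_distrib)
qed

text \<open>
  The half lines contribute parameter integrals of measurable functions; the half circle
  contributes a continuous function, as its integrand is jointly continuous.
\<close>

lemma measurable_qdilog [measurable]:
  assumes h: "h > 0"
  shows "qdilog h \<in> borel_measurable borel"
proof -
  have [measurable]: "exp \<in> borel_measurable (borel :: complex measure)"
    by (intro borel_measurable_continuous_onI continuous_intros)
  have [measurable]: "(\<lambda>p :: real. sinh (of_real pi * of_real p) * sinh (of_real (pi * h) * of_real p) :: complex)
      \<in> borel_measurable borel"
    by (intro borel_measurable_continuous_onI continuous_intros)
  have *: "(\<lambda>(z, p). indicator {qdilog_radius h..} p *\<^sub>R qdilog_integrand h z (of_real p))
      \<in> borel_measurable (borel \<Otimes>\<^sub>M lborel)"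
    unfolding qdilog_integrand_def by measurable
  have [measurable]: "qdilog_tail h \<in> borel_measurable borel"
    using lborel.borel_measurable_lebesgue_integral[OF *]
    unfolding qdilog_tail_def[abs_def] set_lebesgue_integral_def by simp
  have "continuous_on UNIV (\<lambda>z. integral (cbox 0 pi) (circle_integrand h z))"
    by (rule integral_continuous_on_param)
       (rule continuous_on_subset[OF continuous_circle_integrand[OF h]], simp)
  then have [measurable]: "qdilog_arc h \<in> borel_measurable borel"
    unfolding qdilog_arc_eq[abs_def]
    by (intro borel_measurable_continuous_onI continuous_intros) simp_all
  show ?thesis
    unfolding qdilog_eq[abs_def] by measurable
qed


section \<open>The intertwiners in the Fourier picture\<close>

definition exch_form :: "'n::finite seed \<Rightarrow> 'n \<Rightarrow> real^'n \<Rightarrow> real" where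
  "exch_form \<Gamma> k a = (\<Sum>j\<in>UNIV. of_int (exch \<Gamma> k j) * a $ j)"

lemma D_seed_diag:
  assumes "D_seed \<Gamma>" shows "exch \<Gamma> k k = 0"
proof -
  have d: "symm \<Gamma> k > 0" using assms by (simp add: D_seed_def)
  have "real_of_int (exch \<Gamma> k k) * inverse (real (symm \<Gamma> k)) = - real_of_int (exch \<Gamma> k k) * inverse (real (symm \<Gamma> k))"
    using assms unfolding D_seed_def by blast
  then show ?thesis using d by simp
qed

lemma linear_form_regular:
  fixes c :: "'n::finite \<Rightarrow> real"
  assumes "c k = 0"
  defines "m \<equiv> \<lambda>a::real^'n. \<Sum>j\<in>UNIV. c j * a $ j"
  shows "m (a + t *\<^sub>R axis k 1) = m a" "continuous_on UNIV m" "subgauss_growth (\<lambda>a. complex_of_real (m a))"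
proof -
  show "m (a + t *\<^sub>R axis k 1) = m a"
    unfolding m_def using assms(1) by (intro sum.cong) (auto simp: axis_def)
  show "continuous_on UNIV m"
    unfolding m_def by (intro continuous_intros)
  show "subgauss_growth (\<lambda>a. complex_of_real (m a))"
  proof (rule subgauss_growth_linear)
    show "cmod (complex_of_real (m a)) \<le> (\<Sum>j\<in>UNIV. \<bar>c j\<bar>) * norm a" for a
      unfolding m_def norm_of_real sum_distrib_right
      by (rule order_trans[OF sum_abs]) (auto simp: abs_mult intro!: sum_mono mult_left_mono component_le_norm_cart)
  qed
qed

lemma x_op_eq_fibre_op:
  "x_op hbar \<Gamma> k = fibre_op (pi * hbar / real (symm \<Gamma> k)) (\<lambda>a. - exch_form \<Gamma> k a) k"
  "xt_op hbar \<Gamma> k = fibre_op (pi * hbar / real (symm \<Gamma> k)) (exch_form \<Gamma> k) k"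
proof -
  have s: "(\<Sum>j\<in>UNIV. of_int (exch \<Gamma> k j) * q_op j f a) = of_real (exch_form \<Gamma> k a) * f a" for f a
    by (simp add: q_op_def exch_form_def sum_distrib_right mult.assoc)
  show "x_op hbar \<Gamma> k = fibre_op (pi * hbar / real (symm \<Gamma> k)) (\<lambda>a. - exch_form \<Gamma> k a) k"
    by (intro ext) (simp add: x_op_def s p_op_def fibre_op_def divide_inverse[of _ "real (symm \<Gamma> k)"])
  show "xt_op hbar \<Gamma> k = fibre_op (pi * hbar / real (symm \<Gamma> k)) (exch_form \<Gamma> k) k"
    by (intro ext) (simp add: xt_op_def s p_op_def fibre_op_def divide_inverse[of _ "real (symm \<Gamma> k)"])
qed

lemma mutate_row: "exch (mutate k \<Gamma>) k j = - exch \<Gamma> k j" "symm (mutate k \<Gamma>) = symm \<Gamma>"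
  by (simp_all add: mutate_def)

text \<open>
  Mutation at \<open>k\<close> changes the sign of row \<open>k\<close>, so the two operators
  change places.
\<close>

lemma mutated_operators:
  "x_sa hbar (mutate k \<Gamma>) k = xt_sa hbar \<Gamma> k" "xt_sa hbar (mutate k \<Gamma>) k = x_sa hbar \<Gamma> k"
proof -
  have e: "exch_form (mutate k \<Gamma>) k = (\<lambda>a. - exch_form \<Gamma> k a)"
    by (simp add: fun_eq_iff exch_form_def mutate_row sum_negf)
  show "x_sa hbar (mutate k \<Gamma>) k = xt_sa hbar \<Gamma> k" "xt_sa hbar (mutate k \<Gamma>) k = x_sa hbar \<Gamma> k"
    unfolding x_sa_def xt_sa_def x_op_eq_fibre_op e mutate_row by simp_all
qed

definition shear_form :: "'n::finite seed \<Rightarrow> 'n \<Rightarrow> real^'n \<Rightarrow> real" where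
  "shear_form \<Gamma> k a = (\<Sum>j\<in>UNIV. of_int (max (- exch \<Gamma> k j) 0) * a $ j)"

lemma mutate_coord_eq: "mutate_coord \<Gamma> k = reflect k (shear_form \<Gamma> k)"
  by (simp add: fun_eq_iff mutate_coord_def reflect_def shear_form_def vec_eq_iff)

text \<open>The positive part of a number minus that of its negative is the number.\<close>

lemma shear_form_mutate: "shear_form (mutate k \<Gamma>) k a = shear_form \<Gamma> k a + exch_form \<Gamma> k a"
  unfolding shear_form_def exch_form_def sum.distrib[symmetric] mutate_row
  by (rule sum.cong) (auto simp: max_def distrib_right[symmetric])

lemma inv_spectral_op:
  assumes U: "unitary U" and l: "l \<in> borel_measurable borel" and \<phi>: "bounded_borel \<phi>"
    and one: "\<And>t. cmod (\<phi> t) = 1"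
  shows "inv (spectral_op U l \<phi>) = spectral_op U l (\<lambda>t. cnj (\<phi> t))"
proof -
  have b: "bounded_borel (\<lambda>t. cnj (\<phi> t))"
    using \<phi> by (auto simp: bounded_borel_def)
  have c: "cnj (\<phi> t) * \<phi> t = 1" "\<phi> t * cnj (\<phi> t) = 1" for t
    using complex_norm_square[of "\<phi> t"] one[of t] by (simp_all add: mult.commute)
  have id: "spectral_op U l (\<lambda>t. 1) u = u" for u
    by (simp add: spectral_op_def mult_op_one unitary_inv[OF U])
  show ?thesis
    by (rule inv_unique_comp) (simp_all add: fun_eq_iff spectral_op_mult[OF U l] \<phi> b c id)
qed

text \<open>
  All three factors of an intertwiner are conjugated by the same partial Fourier transform. The
  second intertwiner has the roles of \<open>l\<close> and \<open>lt\<close> interchanged.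
\<close>

lemma intertwiner_in_fourier_picture:
  fixes \<Gamma> :: "'n::finite seed" and k :: 'n
  assumes \<Gamma>: "D_seed \<Gamma>" and "hbar > 0"
  defines "h \<equiv> hbar / real (symm \<Gamma> k)"
  defines "l \<equiv> \<lambda>a. - (pi * h) * a $ k - exch_form \<Gamma> k a"
    and "lt \<equiv> \<lambda>a. - (pi * h) * a $ k + exch_form \<Gamma> k a"
  shows "partial_fourier k (intertwiner hbar \<Gamma> k u)
      = mult_op (\<lambda>a. qdilog h (l a)) (mult_op (\<lambda>a. cnj (qdilog h (lt a)))
          (mult_op (\<lambda>a. iexp (- (shear_form \<Gamma> k a * a $ k)))
            (comp_op (reflect k (\<lambda>_. 0)) (partial_fourier k u))))"
    and "partial_fourier k (intertwiner hbar (mutate k \<Gamma>) k u)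
      = mult_op (\<lambda>a. qdilog h (lt a)) (mult_op (\<lambda>a. cnj (qdilog h (l a)))
          (mult_op (\<lambda>a. iexp (- (shear_form (mutate k \<Gamma>) k a * a $ k)))
            (comp_op (reflect k (\<lambda>_. 0)) (partial_fourier k u))))"
proof -
  have h: "h > 0"
    using assms(1,2) by (simp add: h_def D_seed_def)
  have \<phi>: "bounded_borel (qdilog h)"
    by (rule bounded_borelI[of _ 1]) (simp_all add: measurable_qdilog[OF h] cmod_qdilog[OF h])
  have \<kappa>: "pi * hbar / real (symm \<Gamma> k) = pi * h"
    by (simp add: h_def)
  note diag = D_seed_diag[OF \<Gamma>, of k]
  have E: "exch_form \<Gamma> k (a + t *\<^sub>R axis k 1) = exch_form \<Gamma> k a" "continuous_on UNIV (exch_form \<Gamma> k)"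
    "subgauss_growth (\<lambda>a. complex_of_real (exch_form \<Gamma> k a))" for a t
    unfolding exch_form_def[abs_def] using linear_form_regular[of "\<lambda>j. of_int (exch \<Gamma> k j)" k] diag by simp_all
  have E': "- exch_form \<Gamma> k (a + t *\<^sub>R axis k 1) = - exch_form \<Gamma> k a" "continuous_on UNIV (\<lambda>a. - exch_form \<Gamma> k a)"
    "subgauss_growth (\<lambda>a. complex_of_real (- exch_form \<Gamma> k a))" for a t
    using E subgauss_growth_mult[OF subgauss_growth_const[of "-1"] E(3)] by (auto intro!: continuous_intros)
  have shear: "shear_form \<Delta> k (a + t *\<^sub>R axis k 1) = shear_form \<Delta> k a" "shear_form \<Delta> k \<in> borel_measurable borel"
    if "exch \<Delta> k k = 0" for \<Delta> a t
    unfolding shear_form_def[abs_def]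
    using linear_form_regular[of "\<lambda>j. of_int (max (- exch \<Delta> k j) 0)" k] that
    by (auto intro!: borel_measurable_continuous_onI)
  have diag': "exch (mutate k \<Gamma>) k k = 0"
    by (simp add: mutate_row diag)
  have symbols: "symbol (pi * h) (\<lambda>a. - exch_form \<Gamma> k a) k = l" "symbol (pi * h) (exch_form \<Gamma> k) k = lt"
    by (simp_all add: fun_eq_iff symbol_def[OF E] symbol_def[OF E'] l_def lt_def)
  have l_meas: "l \<in> borel_measurable borel" "lt \<in> borel_measurable borel"
    using measurable_symbol[OF E'] measurable_symbol[OF E] unfolding symbols[symmetric] by simp_all
  note U = unitary_partial_fourier[of k]
  have x: "x_sa hbar \<Gamma> k = spectral_graph (partial_fourier k) l" "xt_sa hbar \<Gamma> k = spectral_graph (partial_fourier k) lt"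
    unfolding x_sa_def xt_sa_def x_op_eq_fibre_op \<kappa> symbols[symmetric]
    by (intro self_adjoint_ext_fibre_op E E')+
  have A: "func_calc (qdilog h) (x_sa hbar \<Gamma> k) = spectral_op (partial_fourier k) l (qdilog h)"
    "func_calc (qdilog h) (xt_sa hbar \<Gamma> k) = spectral_op (partial_fourier k) lt (qdilog h)"
    unfolding x by (intro func_calc_spectral_graph U l_meas \<phi>)+
  note inv = inv_spectral_op[OF U l_meas(1) \<phi> cmod_qdilog[OF h]] inv_spectral_op[OF U l_meas(2) \<phi> cmod_qdilog[OF h]]
  have K: "partial_fourier k (K_prime \<Delta> k u)
      = mult_op (\<lambda>a. iexp (- (shear_form \<Delta> k a * a $ k))) (comp_op (reflect k (\<lambda>_. 0)) (partial_fourier k u))"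
    if "exch \<Delta> k k = 0" for \<Delta> u
    unfolding K_prime_def comp_op_def[symmetric] mutate_coord_eq
    by (rule partial_fourier_reflect) (rule shear[OF that])+
  show "partial_fourier k (intertwiner hbar \<Gamma> k u)
      = mult_op (\<lambda>a. qdilog h (l a)) (mult_op (\<lambda>a. cnj (qdilog h (lt a)))
          (mult_op (\<lambda>a. iexp (- (shear_form \<Gamma> k a * a $ k)))
            (comp_op (reflect k (\<lambda>_. 0)) (partial_fourier k u))))"
    unfolding intertwiner_def h_def[symmetric] A inv o_def U_spectral_op[OF U l_meas(1)] U_spectral_op[OF U l_meas(2)] K[OF diag] ..
  show "partial_fourier k (intertwiner hbar (mutate k \<Gamma>) k u)
      = mult_op (\<lambda>a. qdilog h (lt a)) (mult_op (\<lambda>a. cnj (qdilog h (l a)))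
          (mult_op (\<lambda>a. iexp (- (shear_form (mutate k \<Gamma>) k a * a $ k)))
            (comp_op (reflect k (\<lambda>_. 0)) (partial_fourier k u))))"
    unfolding intertwiner_def mutated_operators mutate_row h_def[symmetric] A inv o_def
      U_spectral_op[OF U l_meas(1)] U_spectral_op[OF U l_meas(2)] K[OF diag'] ..
qed

text \<open>
  The reflections of the two factors cancel after the multiplier of the second one has been pulled
  through, and the product of the multipliers is 1 by the inversion formula.
\<close>

theorem intertwiner_intertwiner_mutate:
  assumes \<Gamma>: "D_seed \<Gamma>" and "hbar > 0"
  shows "intertwiner hbar \<Gamma> k (intertwiner hbar (mutate k \<Gamma>) k u) = u"
proof -
  define h where "h = hbar / real (symm \<Gamma> k)"
  define l where "l a = - (pi * h) * a $ k - exch_form \<Gamma> k a" for a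
  define lt where "lt a = - (pi * h) * a $ k + exch_form \<Gamma> k a" for a
  define \<phi> where "\<phi> = qdilog h"
  define e where "e \<Delta> a = iexp (- (shear_form \<Delta> k a * a $ k))" for \<Delta> a
  define r where "r = reflect k (\<lambda>_::real^'a. 0 :: real)"
  have h: "h > 0"
    using assms by (simp add: h_def D_seed_def)
  have [measurable]: "\<phi> \<in> borel_measurable borel"
    unfolding \<phi>_def by (rule measurable_qdilog[OF h])
  have \<phi>1: "cmod (\<phi> t) = 1" for t
    unfolding \<phi>_def by (rule cmod_qdilog[OF h])
  have forms: "continuous_on UNIV (exch_form \<Gamma> k)" "continuous_on UNIV (shear_form \<Delta> k)" for \<Delta>
    unfolding exch_form_def[abs_def] shear_form_def[abs_def] by (intro continuous_intros)+
  have [measurable]: "exch_form \<Gamma> k \<in> borel_measurable borel" "shear_form \<Delta> k \<in> borel_measurable borel" for \<Delta>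
    by (intro borel_measurable_continuous_onI forms)+
  have [measurable]: "iexp \<in> borel_measurable borel"
    by (intro borel_measurable_continuous_onI continuous_intros)
  have [measurable]: "l \<in> borel_measurable borel" "lt \<in> borel_measurable borel" "e \<Delta> \<in> borel_measurable borel" for \<Delta>
    unfolding l_def lt_def e_def by measurable
  have r: "measure_preserving r"
    unfolding r_def by (rule measure_preserving_reflect) simp_all
  have r_nth: "r a $ k = - a $ k" and r_other: "j \<noteq> k \<Longrightarrow> r a $ j = a $ j" for a j
    by (simp_all add: r_def reflect_def)
  have form_r: "exch_form \<Gamma> k (r a) = exch_form \<Gamma> k a" "shear_form \<Gamma> k (r a) = shear_form \<Gamma> k a" for a
  proof -
    have "of_int (exch \<Gamma> k j) * r a $ j = of_int (exch \<Gamma> k j) * a $ j"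
      "of_int (max (- exch \<Gamma> k j) 0) * r a $ j = of_int (max (- exch \<Gamma> k j) 0) * a $ j" for j
      by (cases "j = k"; simp add: D_seed_diag[OF \<Gamma>] r_other)+
    then show "exch_form \<Gamma> k (r a) = exch_form \<Gamma> k a" "shear_form \<Gamma> k (r a) = shear_form \<Gamma> k a"
      unfolding exch_form_def shear_form_def by (simp_all only:)
  qed
  \<comment> \<open>the reflection interchanges \<open>l\<close> and \<open>lt\<close> up to the sign, which makes the inversion formula applicable\<close>
  have lr: "l (r a) = - lt a" "lt (r a) = - l a" for a
    unfolding l_def lt_def form_r r_nth by simp_all
  define \<psi> where "\<psi> a = \<phi> (l a) * (cnj (\<phi> (lt a)) * e \<Gamma> a)" for a
  define \<psi>' where "\<psi>' a = \<phi> (lt a) * (cnj (\<phi> (l a)) * e (mutate k \<Gamma>) a)" for a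
  have e1: "cmod (e \<Delta> a) = 1" for \<Delta> a
    by (simp add: e_def)
  have b: "bounded_borel (\<lambda>a. \<phi> (l a))" "bounded_borel (\<lambda>a. \<phi> (lt a))" "bounded_borel (\<lambda>a. cnj (\<phi> (l a)))"
    "bounded_borel (\<lambda>a. cnj (\<phi> (lt a)))" "bounded_borel (e \<Delta>)" for \<Delta>
    by (rule bounded_borelI[of _ 1]; simp add: \<phi>1 e1)+
  have b': "bounded_borel \<psi>" "bounded_borel \<psi>'"
    unfolding \<psi>_def \<psi>'_def by (intro bounded_borel_mult b)+
  have br: "bounded_borel (\<lambda>a. \<psi>' (r a))"
    using b'(2) r unfolding bounded_borel_def measure_preserving_def by (auto intro: measurable_compose)
  have K: "partial_fourier k (intertwiner hbar \<Gamma> k v) = mult_op \<psi> (comp_op r (partial_fourier k v))"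
    "partial_fourier k (intertwiner hbar (mutate k \<Gamma>) k v) = mult_op \<psi>' (comp_op r (partial_fourier k v))" for v
    using intertwiner_in_fourier_picture[OF \<Gamma> assms(2), of k v]
    unfolding h_def[symmetric] l_def[symmetric] lt_def[symmetric] \<phi>_def[symmetric] e_def[symmetric] r_def[symmetric]
    by (simp_all add: mult_op_mult_op b bounded_borel_mult \<psi>_def[abs_def] \<psi>'_def[abs_def])
  have rr: "comp_op r (comp_op r v) = v" for v
    unfolding comp_op_comp_op[OF r r] by (simp add: r_def reflect_reflect comp_op_def)
  have "\<psi> a * \<psi>' (r a) = 1" for a
  proof -
    obtain C where C: "\<And>z. \<phi> z * \<phi> (- z) = C * exp (- \<i> * of_real (z\<^sup>2 / (4 * pi * h)))"
      using qdilog_mult_minus[OF h] unfolding \<phi>_def by metis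
    have "cmod C = 1"
      using C[of 0] \<phi>1[of 0] by (metis (no_types, lifting) norm_mult norm_one exp_zero mult_1_right minus_zero mult_zero_right
          of_real_0 div_0 zero_power2)
    then have CC: "C * cnj C = 1"
      using complex_norm_square[of C] by simp
    define E where "E = exch_form \<Gamma> k a"
    have "\<psi> a * \<psi>' (r a) = (\<phi> (l a) * \<phi> (- l a)) * cnj (\<phi> (lt a) * \<phi> (- lt a)) * (e \<Gamma> a * e (mutate k \<Gamma>) (r a))"
      unfolding \<psi>_def \<psi>'_def lr by simp
    also have "e \<Gamma> a * e (mutate k \<Gamma>) (r a) = exp (\<i> * of_real (E * a $ k))"
      unfolding e_def form_r r_nth shear_form_mutate E_def exp_add[symmetric] by (simp add: algebra_simps)
    also have "(\<phi> (l a) * \<phi> (- l a)) * cnj (\<phi> (lt a) * \<phi> (- lt a))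
        = (C * cnj C) * (exp (- \<i> * of_real ((l a)\<^sup>2 / (4 * pi * h))) * cnj (exp (- \<i> * of_real ((lt a)\<^sup>2 / (4 * pi * h)))))"
      unfolding C by simp
    also have "cnj (exp (- \<i> * of_real ((lt a)\<^sup>2 / (4 * pi * h)))) = exp (\<i> * of_real ((lt a)\<^sup>2 / (4 * pi * h)))"
      by (simp add: exp_cnj)
    also have "exp (- \<i> * of_real ((l a)\<^sup>2 / (4 * pi * h))) * exp (\<i> * of_real ((lt a)\<^sup>2 / (4 * pi * h)))
        = exp (- (\<i> * of_real ((l a)\<^sup>2 / (4 * pi * h) - (lt a)\<^sup>2 / (4 * pi * h))))"
      unfolding exp_add[symmetric] by (simp add: algebra_simps)
    also have "(l a)\<^sup>2 / (4 * pi * h) - (lt a)\<^sup>2 / (4 * pi * h) = E * a $ k"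
      using h by (simp add: l_def lt_def E_def[symmetric] power2_eq_square field_simps)
    finally show ?thesis
      unfolding CC by (simp add: exp_minus_inverse mult.commute flip: exp_add)
  qed
  then have "partial_fourier k (intertwiner hbar \<Gamma> k (intertwiner hbar (mutate k \<Gamma>) k u)) = partial_fourier k u"
    unfolding K comp_op_mult_op[OF r b'(2)] mult_op_mult_op[OF b'(1) br] rr by (simp add: mult_op_one)
  then show ?thesis
    by (simp add: unitary_eq_iff[OF unitary_partial_fourier])
qed

text \<open>A scalar multiple of the identity determines the scalar only on a nonzero space.\<close>

lemma exists_nonzero_l2: "\<exists>u :: 'n::finite l2. u \<noteq> 0"
proof -
  have "abs_l2 (gauss (0 :: complex^'n)) \<noteq> 0"
  proof
    assume 0: "abs_l2 (gauss (0 :: complex^'n)) = 0"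
    have "AE a :: real^'n in lborel. (1::complex) = 0"
      using rep_abs_l2[OF sq_integrable_gauss[of "0 :: complex^'n"]] rep_zero unfolding 0
      by eventually_elim (simp add: gauss_def)
    then show False by (simp add: ae_filter_eq_bot_iff)
  qed
  then show ?thesis by blast
qed

theorem proposition130:
  fixes \<Gamma> \<Gamma>' :: "'n::finite seed" and k :: 'n and hbar :: real
  assumes "hbar > 0" and "hbar \<notin> \<rat>"
    and "D_seed \<Gamma>"
    and "\<Gamma>' = mutate k \<Gamma>"
  shows "(\<forall>c :: complex. cmod c = 1 \<and>
            (\<forall>f. (intertwiner hbar \<Gamma> k \<circ> intertwiner hbar \<Gamma>' k) f = l2_scale c f) \<longrightarrow> c = 1)
         \<and> intertwiner hbar \<Gamma> k \<circ> intertwiner hbar \<Gamma>' k = id"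
proof -
  have id: "intertwiner hbar \<Gamma> k \<circ> intertwiner hbar \<Gamma>' k = id"
    using intertwiner_intertwiner_mutate[OF assms(3,1)] assms(4) by (simp add: fun_eq_iff)
  moreover have "c = 1" if "\<forall>f. (intertwiner hbar \<Gamma> k \<circ> intertwiner hbar \<Gamma>' k) f = l2_scale c f" for c
  proof -
    obtain u :: "'n l2" where "u \<noteq> 0" using exists_nonzero_l2 by blast
    moreover have "l2_scale (c - 1) u = 0"
      using that unfolding id by (simp add: l2.scale_left_diff_distrib)
    ultimately show ?thesis by simp
  qed
  ultimately show ?thesis by blast
qed

end
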